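(* Suppose that $G$ is a finite group and $\mathbf{k}$ is a splitting field for $G$ in which the order of $G$ is invertible. Then the category $\mathrm{Rep}_{\mathbf{k}}(\mathbf{FI}_G)$ is equivalent to the category $\mathrm{Rep}_{\mathbf{k}}(\mathbf{FI}\times\mathbf{FB}^r)$, where $r$ is the number of (isomorphism classes of) non-trivial irreducible representations of $G$ over $\mathbf{k}$.
   Context: A $G$-map $R \to S$ between finite sets is a pair $(f,\rho)$ of functions $f\colon R \to S$ and $\rho\colon R \to G$. The composition of $(f,\rho)\colon R\to S$ followed by $(g,\sigma)\colon S\to T$ is $(g\circ f,\tau)$ with $\tau(x)=\sigma(f(x))\rho(x)$. The category $\mathbf{FI}_G$ has finite sets as objects and as morphisms the $G$-maps $(f,\rho)$ with $f$ injective. $\mathbf{FI}$ is the category of finite sets with injections. $\mathbf{FB}$ is the groupoid of finite sets with bijections. For an essentially small category $\mathcal{C}$, $\mathrm{Rep}_{\mathbf{k}}(\mathcal{C})$ is the category of functors from $\mathcal{C}$ to $\mathbf{k}$-vector spaces. *)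

theory Defs
  imports
    "Jordan_Normal_Form.Matrix"
    "HOL-Algebra.Algebraic_Closure_Type"
    "HOL-Library.Infinite_Typeclass"
begin

section \<open>Categories, functors and equivalences\<close>

text \<open>
  \<open>Hom C x y\<close> is the set of morphisms from \<open>x\<close> to \<open>y\<close>, and \<open>Cmp C x y z g f\<close> is the
  composite of \<open>f\<close> from \<open>x\<close> to \<open>y\<close> followed by \<open>g\<close> from \<open>y\<close> to \<open>z\<close>.  The objects are
  arguments of the composition, so Hom-sets need not be disjoint.
\<close>

record ('o, 'm) cat =
  Obj :: "'o set"
  Hom :: "'o \<Rightarrow> 'o \<Rightarrow> 'm set"
  Idt :: "'o \<Rightarrow> 'm"
  Cmp :: "'o \<Rightarrow> 'o \<Rightarrow> 'o \<Rightarrow> 'm \<Rightarrow> 'm \<Rightarrow> 'm"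

locale category =
  fixes C :: "('o, 'm) cat"
  assumes Idt_in_Hom: "x \<in> Obj C \<Longrightarrow> Idt C x \<in> Hom C x x"
    and Cmp_in_Hom:
      "\<lbrakk>x \<in> Obj C; y \<in> Obj C; z \<in> Obj C; f \<in> Hom C x y; g \<in> Hom C y z\<rbrakk>
        \<Longrightarrow> Cmp C x y z g f \<in> Hom C x z"
    and Cmp_Idt_right:
      "\<lbrakk>x \<in> Obj C; y \<in> Obj C; f \<in> Hom C x y\<rbrakk> \<Longrightarrow> Cmp C x x y f (Idt C x) = f"
    and Cmp_Idt_left:
      "\<lbrakk>x \<in> Obj C; y \<in> Obj C; f \<in> Hom C x y\<rbrakk> \<Longrightarrow> Cmp C x y y (Idt C y) f = f"
    and Cmp_assoc:
      "\<lbrakk>w \<in> Obj C; x \<in> Obj C; y \<in> Obj C; z \<in> Obj C;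
        f \<in> Hom C w x; g \<in> Hom C x y; h \<in> Hom C y z\<rbrakk>
        \<Longrightarrow> Cmp C w y z h (Cmp C w x y g f) = Cmp C w x z (Cmp C x y z h g) f"

definition is_iso :: "('o, 'm) cat \<Rightarrow> 'o \<Rightarrow> 'o \<Rightarrow> 'm \<Rightarrow> bool" where
  "is_iso C x y f \<longleftrightarrow> f \<in> Hom C x y \<and>
     (\<exists>g \<in> Hom C y x. Cmp C x y x g f = Idt C x \<and> Cmp C y x y f g = Idt C y)"

text \<open>
  Only the values of a functor on objects, and on morphisms between objects, are meaningful.
\<close>

record ('o1, 'm1, 'o2, 'm2) ftor =
  FObj :: "'o1 \<Rightarrow> 'o2"
  FHom :: "'o1 \<Rightarrow> 'o1 \<Rightarrow> 'm1 \<Rightarrow> 'm2"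

locale is_functor = dom: category C + cod: category D
  for C :: "('o1, 'm1) cat" and D :: "('o2, 'm2) cat" +
  fixes F :: "('o1, 'm1, 'o2, 'm2) ftor"
  assumes FObj_in_Obj: "x \<in> Obj C \<Longrightarrow> FObj F x \<in> Obj D"
    and FHom_in_Hom:
      "\<lbrakk>x \<in> Obj C; y \<in> Obj C; f \<in> Hom C x y\<rbrakk>
        \<Longrightarrow> FHom F x y f \<in> Hom D (FObj F x) (FObj F y)"
    and FHom_Idt: "x \<in> Obj C \<Longrightarrow> FHom F x x (Idt C x) = Idt D (FObj F x)"
    and FHom_Cmp:
      "\<lbrakk>x \<in> Obj C; y \<in> Obj C; z \<in> Obj C; f \<in> Hom C x y; g \<in> Hom C y z\<rbrakk>
        \<Longrightarrow> FHom F x z (Cmp C x y z g f) =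
            Cmp D (FObj F x) (FObj F y) (FObj F z) (FHom F y z g) (FHom F x y f)"

definition id_ftor :: "('o, 'm, 'o, 'm) ftor" where
  "id_ftor = \<lparr>FObj = (\<lambda>x. x), FHom = (\<lambda>x y f. f)\<rparr>"

definition comp_ftor ::
  "('o2, 'm2, 'o3, 'm3) ftor \<Rightarrow> ('o1, 'm1, 'o2, 'm2) ftor \<Rightarrow> ('o1, 'm1, 'o3, 'm3) ftor" where
  "comp_ftor G F =
     \<lparr>FObj = (\<lambda>x. FObj G (FObj F x)),
      FHom = (\<lambda>x y f. FHom G (FObj F x) (FObj F y) (FHom F x y f))\<rparr>"

text \<open>
  The components of a natural transformation are extensional on the objects of the source, so
  that equality of natural transformations is equality of all components.
\<close>

definition nat_trans ::
  "('o1, 'm1) cat \<Rightarrow> ('o2, 'm2) cat \<Rightarrow> ('o1, 'm1, 'o2, 'm2) ftor \<Rightarrow> ('o1, 'm1, 'o2, 'm2) ftor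
     \<Rightarrow> ('o1 \<Rightarrow> 'm2) set" where
  "nat_trans C D F G =
     {\<eta> \<in> (\<Pi>\<^sub>E x \<in> Obj C. Hom D (FObj F x) (FObj G x)).
        \<forall>x \<in> Obj C. \<forall>y \<in> Obj C. \<forall>f \<in> Hom C x y.
          Cmp D (FObj F x) (FObj F y) (FObj G y) (\<eta> y) (FHom F x y f) =
          Cmp D (FObj F x) (FObj G x) (FObj G y) (FHom G x y f) (\<eta> x)}"

definition naturally_isomorphic ::
  "('o1, 'm1) cat \<Rightarrow> ('o2, 'm2) cat \<Rightarrow> ('o1, 'm1, 'o2, 'm2) ftor \<Rightarrow> ('o1, 'm1, 'o2, 'm2) ftor
     \<Rightarrow> bool" where
  "naturally_isomorphic C D F G \<longleftrightarrow>
     (\<exists>\<eta> \<in> nat_trans C D F G. \<forall>x \<in> Obj C. is_iso D (FObj F x) (FObj G x) (\<eta> x))"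

definition equivalent_categories :: "('o1, 'm1) cat \<Rightarrow> ('o2, 'm2) cat \<Rightarrow> bool" where
  "equivalent_categories C D \<longleftrightarrow>
     (\<exists>F G. is_functor C D F \<and> is_functor D C G \<and>
        naturally_isomorphic C C (comp_ftor G F) id_ftor \<and>
        naturally_isomorphic D D (comp_ftor F G) id_ftor)"

definition functor_cat ::
  "('o1, 'm1) cat \<Rightarrow> ('o2, 'm2) cat \<Rightarrow> (('o1, 'm1, 'o2, 'm2) ftor, 'o1 \<Rightarrow> 'm2) cat" where
  "functor_cat C D =
     \<lparr>Obj = {F. is_functor C D F},
      Hom = nat_trans C D,
      Idt = (\<lambda>F. \<lambda>x \<in> Obj C. Idt D (FObj F x)),
      Cmp = (\<lambda>F G H \<theta> \<eta>. \<lambda>x \<in> Obj C. Cmp D (FObj F x) (FObj G x) (FObj H x) (\<theta> x) (\<eta> x))\<rparr>"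

lemma category_functor_cat: assumes "category C" "category D" shows "category (functor_cat C D)"
proof -
  interpret C: category C by fact
  interpret D: category D by fact
  show ?thesis
  proof
    fix x assume x: "x \<in> Obj (functor_cat C D)"
    then interpret is_functor C D x by (simp add: functor_cat_def)
    show "Idt (functor_cat C D) x \<in> Hom (functor_cat C D) x x"
      using FObj_in_Obj FHom_in_Hom D.Idt_in_Hom D.Cmp_Idt_left D.Cmp_Idt_right
      by (auto simp: functor_cat_def nat_trans_def)
  next
    fix x y z f g
    assume a: "x \<in> Obj (functor_cat C D)" "y \<in> Obj (functor_cat C D)"
      "z \<in> Obj (functor_cat C D)"
      "f \<in> Hom (functor_cat C D) x y" "g \<in> Hom (functor_cat C D) y z"
    interpret x: is_functor C D x using a by (simp add: functor_cat_def)
    interpret y: is_functor C D y using a by (simp add: functor_cat_def)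
    interpret z: is_functor C D z using a by (simp add: functor_cat_def)
    have f: "\<And>u. u \<in> Obj C \<Longrightarrow> f u \<in> Hom D (FObj x u) (FObj y u)"
      and g: "\<And>u. u \<in> Obj C \<Longrightarrow> g u \<in> Hom D (FObj y u) (FObj z u)"
      and fn: "\<And>u v h. u \<in> Obj C \<Longrightarrow> v \<in> Obj C \<Longrightarrow> h \<in> Hom C u v \<Longrightarrow>
         Cmp D (FObj x u) (FObj x v) (FObj y v) (f v) (FHom x u v h) =
          Cmp D (FObj x u) (FObj y u) (FObj y v) (FHom y u v h) (f u)"
      and gn: "\<And>u v h. u \<in> Obj C \<Longrightarrow> v \<in> Obj C \<Longrightarrow> h \<in> Hom C u v \<Longrightarrow>
         Cmp D (FObj y u) (FObj y v) (FObj z v) (g v) (FHom y u v h) =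
          Cmp D (FObj y u) (FObj z u) (FObj z v) (FHom z u v h) (g u)"
      using a by (auto simp: functor_cat_def nat_trans_def)
    have "Cmp D (FObj x u) (FObj x v) (FObj z v)
            (Cmp D (FObj x v) (FObj y v) (FObj z v) (g v) (f v)) (FHom x u v h) =
          Cmp D (FObj x u) (FObj z u) (FObj z v) (FHom z u v h)
            (Cmp D (FObj x u) (FObj y u) (FObj z u) (g u) (f u))"
      if "u \<in> Obj C" "v \<in> Obj C" "h \<in> Hom C u v" for u v h
      using that f g fn gn x.FObj_in_Obj y.FObj_in_Obj z.FObj_in_Obj
        x.FHom_in_Hom y.FHom_in_Hom z.FHom_in_Hom
      by (smt (verit) D.Cmp_assoc)
    then show "Cmp (functor_cat C D) x y z g f \<in> Hom (functor_cat C D) x z"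
      using f g D.Cmp_in_Hom x.FObj_in_Obj y.FObj_in_Obj z.FObj_in_Obj
      by (auto simp: functor_cat_def nat_trans_def)
  next
    fix x y f assume a: "x \<in> Obj (functor_cat C D)" "y \<in> Obj (functor_cat C D)"
      "f \<in> Hom (functor_cat C D) x y"
    interpret x: is_functor C D x using a by (simp add: functor_cat_def)
    interpret y: is_functor C D y using a by (simp add: functor_cat_def)
    show "Cmp (functor_cat C D) x x y f (Idt (functor_cat C D) x) = f"
     "Cmp (functor_cat C D) x y y (Idt (functor_cat C D) y) f = f"
      using a x.FObj_in_Obj y.FObj_in_Obj
      by (auto simp: functor_cat_def nat_trans_def PiE_iff extensional_def fun_eq_iff
          D.Cmp_Idt_right D.Cmp_Idt_left)
  next
    fix w x y z f g h
    assume a: "w \<in> Obj (functor_cat C D)" "x \<in> Obj (functor_cat C D)"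
      "y \<in> Obj (functor_cat C D)" "z \<in> Obj (functor_cat C D)"
      "f \<in> Hom (functor_cat C D) w x" "g \<in> Hom (functor_cat C D) x y" "h \<in> Hom (functor_cat C D) y z"
    then show "Cmp (functor_cat C D) w y z h (Cmp (functor_cat C D) w x y g f) =
       Cmp (functor_cat C D) w x z (Cmp (functor_cat C D) x y z h g) f"
      by (auto simp: functor_cat_def nat_trans_def PiE_iff fun_eq_iff
          intro!: D.Cmp_assoc is_functor.FObj_in_Obj)
  qed
qed

definition prod_cat ::
  "('o1, 'm1) cat \<Rightarrow> ('o2, 'm2) cat \<Rightarrow> ('o1 \<times> 'o2, 'm1 \<times> 'm2) cat" where
  "prod_cat C D =
     \<lparr>Obj = Obj C \<times> Obj D,
      Hom = (\<lambda>(x, x') (y, y'). Hom C x y \<times> Hom D x' y'),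
      Idt = (\<lambda>(x, x'). (Idt C x, Idt D x')),
      Cmp = (\<lambda>(x, x') (y, y') (z, z') (g, g') (f, f'). (Cmp C x y z g f, Cmp D x' y' z' g' f'))\<rparr>"

lemma category_prod_cat: "category C \<Longrightarrow> category D \<Longrightarrow> category (prod_cat C D)"
  unfolding category_def prod_cat_def by auto

text \<open>The \<open>r\<close>-fold power; \<open>r\<close>-tuples are extensional functions on \<open>{..<r}\<close>.\<close>

definition power_cat :: "('o, 'm) cat \<Rightarrow> nat \<Rightarrow> (nat \<Rightarrow> 'o, nat \<Rightarrow> 'm) cat" where
  "power_cat C r =
     \<lparr>Obj = {..<r} \<rightarrow>\<^sub>E Obj C,
      Hom = (\<lambda>x y. \<Pi>\<^sub>E i \<in> {..<r}. Hom C (x i) (y i)),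
      Idt = (\<lambda>x. \<lambda>i \<in> {..<r}. Idt C (x i)),
      Cmp = (\<lambda>x y z g f. \<lambda>i \<in> {..<r}. Cmp C (x i) (y i) (z i) (g i) (f i))\<rparr>"

lemma category_power_cat: assumes "category C" shows "category (power_cat C r)"
proof -
  interpret category C by fact
  show ?thesis
    by unfold_locales
      (auto simp: power_cat_def PiE_iff extensional_def fun_eq_iff
        intro: Idt_in_Hom Cmp_in_Hom Cmp_Idt_right Cmp_Idt_left Cmp_assoc)
qed


section \<open>Finite sets\<close>

text \<open>
  Finite sets are the finite subsets of an infinite type; every finite set is in bijection
  with one of these.
\<close>

definition FI :: "('s::infinite set, 's \<Rightarrow> 's) cat" where
  "FI =
     \<lparr>Obj = {S. finite S},
      Hom = (\<lambda>S T. {f \<in> S \<rightarrow>\<^sub>E T. inj_on f S}),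
      Idt = (\<lambda>S. \<lambda>x \<in> S. x),
      Cmp = (\<lambda>R S T g f. compose R g f)\<rparr>"

lemma category_FI: "category FI"
  by unfold_locales
    (auto simp: FI_def compose_def inj_on_def PiE_iff extensional_def fun_eq_iff)

definition FB :: "('s::infinite set, 's \<Rightarrow> 's) cat" where
  "FB =
     \<lparr>Obj = {S. finite S},
      Hom = (\<lambda>S T. {f \<in> S \<rightarrow>\<^sub>E T. bij_betw f S T}),
      Idt = (\<lambda>S. \<lambda>x \<in> S. x),
      Cmp = (\<lambda>R S T g f. compose R g f)\<rparr>"

lemma category_FB: "category FB"
proof -
  have FB: "FB = \<lparr>Obj = {S. finite S}, Hom = (\<lambda>S T. {f. f \<in> extensional S \<and> bij_betw f S T}),
      Idt = (\<lambda>S. \<lambda>x \<in> S. x), Cmp = (\<lambda>R S T g f. compose R g f)\<rparr>"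
    by (auto simp: FB_def fun_eq_iff PiE_def bij_betw_def)
  show ?thesis
    unfolding FB apply unfold_locales
    subgoal by (simp add: bij_betw_def inj_on_def)
    subgoal by (auto intro: bij_betw_compose)
    subgoal by (auto simp: compose_def fun_eq_iff extensional_def)
    subgoal by (auto simp: compose_def fun_eq_iff extensional_def bij_betw_def)
    subgoal by (auto simp: compose_def fun_eq_iff bij_betw_def)
    done
qed

definition FI\<^sub>G ::
  "('g, 'b) monoid_scheme \<Rightarrow> ('s::infinite set, ('s \<Rightarrow> 's) \<times> ('s \<Rightarrow> 'g)) cat" where
  "FI\<^sub>G G =
     \<lparr>Obj = {S. finite S},
      Hom = (\<lambda>S T. {f \<in> S \<rightarrow>\<^sub>E T. inj_on f S} \<times> (S \<rightarrow>\<^sub>E carrier G)),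
      Idt = (\<lambda>S. (\<lambda>x \<in> S. x, \<lambda>x \<in> S. \<one>\<^bsub>G\<^esub>)),
      Cmp = (\<lambda>R S T (g, \<sigma>) (f, \<rho>). (compose R g f, \<lambda>x \<in> R. \<sigma> (f x) \<otimes>\<^bsub>G\<^esub> \<rho> x))\<rparr>"

lemma category_FI_G: "group G \<Longrightarrow> category (FI\<^sub>G G)"
proof -
  assume "group G"
  then interpret group G .
  show ?thesis
    by unfold_locales
      (auto simp: FI\<^sub>G_def compose_def inj_on_def PiE_iff extensional_def fun_eq_iff m_assoc,
        metis+)
qed


section \<open>Vector spaces and representations of categories\<close>

text \<open>
  The type \<open>'v\<close> plays the role of the universe: a vector space over the field \<open>'k\<close> has as
  carrier a subset of \<open>'v\<close>, and may be infinite-dimensional.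
\<close>

definition Vec :: "(('k::field, 'v) module, 'v \<Rightarrow> 'v) cat" where
  "Vec =
     \<lparr>Obj = {V. Module.module ring_of_type_algebra V},
      Hom = (\<lambda>V W. {T \<in> carrier V \<rightarrow>\<^sub>E carrier W.
               (\<forall>x \<in> carrier V. \<forall>y \<in> carrier V. T (x \<oplus>\<^bsub>V\<^esub> y) = T x \<oplus>\<^bsub>W\<^esub> T y) \<and>
               (\<forall>c. \<forall>x \<in> carrier V. T (c \<odot>\<^bsub>V\<^esub> x) = c \<odot>\<^bsub>W\<^esub> T x)}),
      Idt = (\<lambda>V. \<lambda>x \<in> carrier V. x),
      Cmp = (\<lambda>U V W g f. compose (carrier U) g f)\<rparr>"

lemma category_Vec: "category Vec"
  apply unfold_locales
  subgoal for x
  proof -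
    assume "x \<in> Obj Vec"
    then interpret Module.module ring_of_type_algebra x by (simp add: Vec_def)
    show ?thesis using smult_closed by (auto simp: Vec_def ring_of_type_algebra_def)
  qed
  subgoal for x y z f g
    by (auto simp: Vec_def compose_def PiE_iff Module.module_def abelian_group_def
        abelian_monoid.a_closed Module.module_axioms_def ring_of_type_algebra_def)
  by (auto simp: Vec_def compose_def PiE_iff extensional_def fun_eq_iff)

definition Rep ::
  "'k::field itself \<Rightarrow> 'v itself \<Rightarrow> ('o, 'm) cat
     \<Rightarrow> (('o, 'm, ('k, 'v) module, 'v \<Rightarrow> 'v) ftor, 'o \<Rightarrow> 'v \<Rightarrow> 'v) cat" where
  "Rep _ _ C = functor_cat C (Vec :: (('k, 'v) module, 'v \<Rightarrow> 'v) cat)"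


section \<open>Irreducible representations of a group\<close>

text \<open>
  A pair \<open>(n, \<rho>)\<close> is a representation of degree \<open>n\<close>, i.e. a homomorphism into the general
  linear group.  For finite groups this loses no irreducible representation, since these are
  finite-dimensional.
\<close>

definition GL :: "'k::field itself \<Rightarrow> nat \<Rightarrow> 'k mat monoid" where
  "GL k n = units_of (ring_mat k n ())"

definition matrix_rep :: "('g, 'b) monoid_scheme \<Rightarrow> nat \<times> ('g \<Rightarrow> 'k::field mat) \<Rightarrow> bool" where
  "matrix_rep G = (\<lambda>(n, \<rho>). \<rho> \<in> hom G (GL TYPE('k) n))"

definition irreducible_rep :: "('g, 'b) monoid_scheme \<Rightarrow> nat \<times> ('g \<Rightarrow> 'k::field mat) \<Rightarrow> bool" where
  "irreducible_rep G = (\<lambda>(n, \<rho>). matrix_rep G (n, \<rho>) \<and> n \<noteq> 0 \<and>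
     (\<forall>W. submodule W ring_of_type_algebra (module_vec TYPE('k) n) \<and>
          (\<forall>g \<in> carrier G. \<forall>w \<in> W. \<rho> g *\<^sub>v w \<in> W)
        \<longrightarrow> W = {0\<^sub>v n} \<or> W = carrier_vec n))"

text \<open>
  A representation is absolutely irreducible if it stays irreducible after extension of
  scalars to the algebraic closure, and a splitting field is one over which every irreducible
  representation is absolutely irreducible.
\<close>

definition absolutely_irreducible_rep ::
  "('g, 'b) monoid_scheme \<Rightarrow> nat \<times> ('g \<Rightarrow> 'k::field mat) \<Rightarrow> bool" where
  "absolutely_irreducible_rep G =
     (\<lambda>(n, \<rho>). irreducible_rep G (n, \<lambda>g. map_mat (to_ac :: 'k \<Rightarrow> 'k alg_closure) (\<rho> g)))"

definition splitting_field_for :: "'k::field itself \<Rightarrow> ('g, 'b) monoid_scheme \<Rightarrow> bool" where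
  "splitting_field_for _ G \<longleftrightarrow>
     (\<forall>\<rho> :: nat \<times> ('g \<Rightarrow> 'k mat). irreducible_rep G \<rho> \<longrightarrow> absolutely_irreducible_rep G \<rho>)"

definition iso_reps ::
  "('g, 'b) monoid_scheme \<Rightarrow> ((nat \<times> ('g \<Rightarrow> 'k::field mat)) \<times> (nat \<times> ('g \<Rightarrow> 'k mat))) set" where
  "iso_reps G =
     {((n, \<rho>), (m, \<sigma>)). matrix_rep G (n, \<rho>) \<and> matrix_rep G (m, \<sigma>) \<and> n = m \<and>
        (\<exists>P \<in> carrier (GL TYPE('k) n). \<forall>g \<in> carrier G. P * \<rho> g = \<sigma> g * P)}"

definition trivial_rep :: "nat \<times> ('g \<Rightarrow> 'k::field mat)" where
  "trivial_rep = (1, \<lambda>_. 1\<^sub>m 1)"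

definition num_nontrivial_irreps :: "'k::field itself \<Rightarrow> ('g, 'b) monoid_scheme \<Rightarrow> nat" where
  "num_nontrivial_irreps _ G =
     card ({\<rho> :: nat \<times> ('g \<Rightarrow> 'k mat). irreducible_rep G \<rho> \<and> (\<rho>, trivial_rep) \<notin> iso_reps G}
           // iso_reps G)"

end

theory Submission
  imports Defs "Jordan_Normal_Form.Char_Poly" "HOL-Library.Function_Algebras"
begin

text \<open>
  Write \<open>kC\<close> for the linearisation of a category \<open>C\<close> over the field \<open>k\<close>.  A representation of \<open>C\<close> is
  the same thing as a linear functor on \<open>kC\<close>, and it extends uniquely to the closure of \<open>kC\<close> under
  images of idempotents and finite direct sums.  It therefore suffices to find, inside this closure
  for \<open>C = FI\<^sub>G\<close>, a full subcategory that is isomorphic to \<open>kD\<close> for \<open>D = FI \<times> FB\<^sup>r\<close> and of which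
  every object of \<open>C\<close> is a finite direct sum.  The locale \<open>morita_data\<close> describes this situation, and
  \<open>morita_equivalence\<close> draws the conclusion: cutting a representation of \<open>C\<close> down by the idempotents
  is a fully faithful and essentially surjective functor.

  To find the subcategory, note that the endomorphisms in \<open>kC\<close> of a finite set \<open>S\<close> contain the tensor
  power of the group algebra \<open>k[G]\<close> indexed by \<open>S\<close>.  Since \<open>k\<close> is a splitting field in which the order
  of \<open>G\<close> is invertible, \<open>k[G]\<close> is a product of matrix algebras, with matrix units \<open>E i a b\<close>, where
  \<open>i = 0\<close> is the trivial representation and \<open>1 \<le> i \<le> r\<close> the others.  A colouring \<open>c\<close> of \<open>S\<close> by
  \<open>{0..r}\<close> gives an idempotent, the tensor product of the \<open>E (c s) 0 0\<close>.  The identity of \<open>S\<close> is the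
  sum of the products of the \<open>E i a a\<close> over all ways to choose a pair \<open>(i, a)\<close> at each point, and each
  summand is isomorphic to the idempotent of its colouring; so the coloured sets generate.

  Now sandwich a morphism \<open>(f, \<rho>)\<close> between the idempotents of two coloured sets.  A point \<open>t\<close> outside
  the image of \<open>f\<close> contributes the sum of the coefficients of \<open>E (c t) 0 0\<close>, which is \<open>0\<close> unless the
  colour of \<open>t\<close> is trivial.  A point \<open>s\<close> of the source contributes
  \<open>E (c (f s)) 0 0 * \<rho> s * E (c s) 0 0\<close>, which is \<open>0\<close> unless \<open>f\<close> preserves the colour of \<open>s\<close>, and is
  a multiple of \<open>E (c s) 0 0\<close> otherwise.  What survives, up to scalars, are the injections that
  preserve colours and are bijective on every nontrivial colour: the morphisms of \<open>FI \<times> FB\<^sup>r\<close>.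

  The matrix units come from the matrix coefficients of the irreducible representations and
  Schur orthogonality.  They add up to \<open>1\<close> because the difference is a central idempotent which acts
  as \<open>0\<close> on every irreducible representation, whereas a minimal nonzero subrepresentation of the
  space on which it acts as the identity would be irreducible.
\<close>


section \<open>Equivalences from fully faithful functors\<close>

definition fully_faithful ::
  "('o1, 'm1) cat \<Rightarrow> ('o2, 'm2) cat \<Rightarrow> ('o1, 'm1, 'o2, 'm2) ftor \<Rightarrow> bool" where
  "fully_faithful C D F \<longleftrightarrow>
     (\<forall>x \<in> Obj C. \<forall>y \<in> Obj C. bij_betw (FHom F x y) (Hom C x y) (Hom D (FObj F x) (FObj F y)))"

definition essentially_surjective ::
  "('o1, 'm1) cat \<Rightarrow> ('o2, 'm2) cat \<Rightarrow> ('o1, 'm1, 'o2, 'm2) ftor \<Rightarrow> bool" where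
  "essentially_surjective C D F \<longleftrightarrow> (\<forall>y \<in> Obj D. \<exists>x \<in> Obj C. \<exists>f. is_iso D (FObj F x) y f)"

context category
begin

lemma cancel_inverse_right:
  assumes "x \<in> Obj C" "y \<in> Obj C" "z \<in> Obj C" "k \<in> Hom C x z" "f \<in> Hom C y x" "g \<in> Hom C x y"
    and "Cmp C x y x f g = Idt C x"
  shows "Cmp C x y z (Cmp C y x z k f) g = k"
  using assms Cmp_assoc[of x y x z g f k] Cmp_Idt_right by simp

end

text \<open>
  A quasi-inverse sends an object to a chosen preimage up to isomorphism, and a morphism to the
  unique preimage of its conjugate by the chosen isomorphisms.
\<close>

lemma equivalent_categories_if_fully_faithful:
  assumes F: "is_functor C D F" and ff: "fully_faithful C D F"
    and es: "essentially_surjective C D F"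
  shows "equivalent_categories C D"
proof -
  interpret F: is_functor C D F by (rule F)
  note Dc = F.cod.Cmp_in_Hom F.cod.Idt_in_Hom
  have "\<exists>x f f'. x \<in> Obj C \<and> f \<in> Hom D (FObj F x) y \<and> f' \<in> Hom D y (FObj F x) \<and>
      Cmp D (FObj F x) y (FObj F x) f' f = Idt D (FObj F x) \<and> Cmp D y (FObj F x) y f f' = Idt D y"
    if "y \<in> Obj D" for y
    using es that unfolding essentially_surjective_def is_iso_def by blast
  then obtain g e e' where gee: "\<And>y. y \<in> Obj D \<Longrightarrow> g y \<in> Obj C \<and> e y \<in> Hom D (FObj F (g y)) y
      \<and> e' y \<in> Hom D y (FObj F (g y)) \<and>
      Cmp D (FObj F (g y)) y (FObj F (g y)) (e' y) (e y) = Idt D (FObj F (g y)) \<and>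
      Cmp D y (FObj F (g y)) y (e y) (e' y) = Idt D y"
    by metis
  then have g: "\<And>y. y \<in> Obj D \<Longrightarrow> g y \<in> Obj C"
    and e: "\<And>y. y \<in> Obj D \<Longrightarrow> e y \<in> Hom D (FObj F (g y)) y"
    and e': "\<And>y. y \<in> Obj D \<Longrightarrow> e' y \<in> Hom D y (FObj F (g y))"
    and e'e: "\<And>y. y \<in> Obj D \<Longrightarrow> Cmp D (FObj F (g y)) y (FObj F (g y)) (e' y) (e y) = Idt D (FObj F (g y))"
    and ee': "\<And>y. y \<in> Obj D \<Longrightarrow> Cmp D y (FObj F (g y)) y (e y) (e' y) = Idt D y"
    by blast+
  define L where "L x y = inv_into (Hom C x y) (FHom F x y)" for x y
  have L: "L x y k \<in> Hom C x y" and FL: "FHom F x y (L x y k) = k"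
    if "x \<in> Obj C" "y \<in> Obj C" "k \<in> Hom D (FObj F x) (FObj F y)" for x y k
    using ff that unfolding fully_faithful_def bij_betw_def L_def
    by (auto intro!: inv_into_into f_inv_into_f)
  have LF: "L x y (FHom F x y f) = f" if "x \<in> Obj C" "y \<in> Obj C" "f \<in> Hom C x y" for x y f
    using ff that unfolding fully_faithful_def bij_betw_def L_def by auto
  have Feq: "f = f'" if "FHom F x y f = FHom F x y f'" "x \<in> Obj C" "y \<in> Obj C" "f \<in> Hom C x y"
    "f' \<in> Hom C x y" for f f' x y
    using LF that by metis
  define t where "t y y' k =
    Cmp D (FObj F (g y)) y (FObj F (g y')) (Cmp D y y' (FObj F (g y')) (e' y') k) (e y)" for y y' k
  have t: "t y y' k \<in> Hom D (FObj F (g y)) (FObj F (g y'))"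
    if "y \<in> Obj D" "y' \<in> Obj D" "k \<in> Hom D y y'" for y y' k
    unfolding t_def using that g e e' F.FObj_in_Obj by (intro Dc) auto
  define H where "H = \<lparr>FObj = g, FHom = (\<lambda>y y' k. L (g y) (g y') (t y y' k))\<rparr>"
  have H: "is_functor D C H"
  proof
    fix x assume x: "x \<in> Obj D"
    show "FObj H x \<in> Obj C" using g x by (simp add: H_def)
    have "t x x (Idt D x) = Idt D (FObj F (g x))"
      unfolding t_def using x g e e' e'e F.FObj_in_Obj by (simp add: F.cod.Cmp_Idt_right)
    then have "FHom H x x (Idt D x) = L (g x) (g x) (FHom F (g x) (g x) (Idt C (g x)))"
      using x g by (simp add: H_def F.FHom_Idt)
    then show "FHom H x x (Idt D x) = Idt C (FObj H x)"
      using LF x g F.dom.Idt_in_Hom by (simp add: H_def)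
  next
    fix x y f assume "x \<in> Obj D" "y \<in> Obj D" "f \<in> Hom D x y"
    then show "FHom H x y f \<in> Hom C (FObj H x) (FObj H y)"
      using L g t by (simp add: H_def)
  next
    fix x y z f h assume a: "x \<in> Obj D" "y \<in> Obj D" "z \<in> Obj D" "f \<in> Hom D x y" "h \<in> Hom D y z"
    have "t x z (Cmp D x y z h f) = Cmp D (FObj F (g x)) (FObj F (g y)) (FObj F (g z)) (t y z h) (t x y f)"
      using a g e e' ee' F.FObj_in_Obj
      by (simp add: t_def Dc F.cod.Cmp_assoc F.cod.cancel_inverse_right)
    also have "\<dots> = FHom F (g x) (g z) (Cmp C (g x) (g y) (g z) (L (g y) (g z) (t y z h)) (L (g x) (g y) (t x y f)))"
      using a g L FL t by (simp add: F.FHom_Cmp)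
    finally show "FHom H x z (Cmp D x y z h f) =
      Cmp C (FObj H x) (FObj H y) (FObj H z) (FHom H y z h) (FHom H x y f)"
      using LF a g L t by (simp add: H_def F.dom.Cmp_in_Hom)
  qed
  have "naturally_isomorphic D D (comp_ftor F H) id_ftor"
  proof -
    define h where "h = restrict e (Obj D)"
    have "h \<in> nat_trans D D (comp_ftor F H) id_ftor"
      using g e e' ee' F.FObj_in_Obj t FL
      by (auto simp: nat_trans_def h_def comp_ftor_def id_ftor_def H_def t_def Dc
           F.cod.Cmp_assoc F.cod.Cmp_Idt_left)
    moreover have "is_iso D (FObj (comp_ftor F H) x) (FObj id_ftor x) (h x)" if "x \<in> Obj D" for x
      using that e e' ee' e'e
      by (auto simp: is_iso_def h_def comp_ftor_def id_ftor_def H_def intro!: bexI[of _ "e' x"])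
    ultimately show ?thesis unfolding naturally_isomorphic_def by blast
  qed
  moreover have "naturally_isomorphic C C (comp_ftor H F) id_ftor"
  proof -
    define h where "h = (\<lambda>x \<in> Obj C. L (g (FObj F x)) x (e (FObj F x)))"
    have h: "h x \<in> Hom C (g (FObj F x)) x" "FHom F (g (FObj F x)) x (h x) = e (FObj F x)"
      if "x \<in> Obj C" for x
      using L FL g e that F.FObj_in_Obj by (auto simp: h_def)
    have "Cmp C (g (FObj F x)) (g (FObj F y)) y (h y) (L (g (FObj F x)) (g (FObj F y)) (t (FObj F x) (FObj F y) (FHom F x y f))) =
        Cmp C (g (FObj F x)) x y f (h x)" if "x \<in> Obj C" "y \<in> Obj C" "f \<in> Hom C x y" for x y f
      apply (rule Feq[of "g (FObj F x)" y])
      using that h g e e' ee' F.FObj_in_Obj t F.FHom_in_Hom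
      by (simp_all add: F.FHom_Cmp L FL F.dom.Cmp_in_Hom)
        (simp add: t_def Dc F.cod.Cmp_assoc F.cod.Cmp_Idt_left)
    then have "h \<in> nat_trans C C (comp_ftor H F) id_ftor"
      using h by (auto simp: nat_trans_def h_def comp_ftor_def id_ftor_def H_def)
    moreover have "is_iso C (FObj (comp_ftor H F) x) (FObj id_ftor x) (h x)" if x: "x \<in> Obj C" for x
    proof -
      define k where "k = L x (g (FObj F x)) (e' (FObj F x))"
      have k: "k \<in> Hom C x (g (FObj F x))" "FHom F x (g (FObj F x)) k = e' (FObj F x)"
        using L FL g e' x F.FObj_in_Obj by (auto simp: k_def)
      have "Cmp C x (g (FObj F x)) x (h x) k = Idt C x"
        by (rule Feq[of x x]) (use x g h k ee' F.FObj_in_Obj F.dom.Cmp_in_Hom F.dom.Idt_in_Hom in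
            \<open>simp_all add: F.FHom_Cmp F.FHom_Idt\<close>)
      moreover have "Cmp C (g (FObj F x)) x (g (FObj F x)) k (h x) = Idt C (g (FObj F x))"
        by (rule Feq[of "g (FObj F x)" "g (FObj F x)"]) (use x g h k e'e F.FObj_in_Obj F.dom.Cmp_in_Hom F.dom.Idt_in_Hom in
            \<open>simp_all add: F.FHom_Cmp F.FHom_Idt\<close>)
      ultimately show ?thesis using h k x by (auto simp: is_iso_def comp_ftor_def id_ftor_def H_def)
    qed
    ultimately show ?thesis unfolding naturally_isomorphic_def by blast
  qed
  ultimately show ?thesis unfolding equivalent_categories_def using F H by blast
qed

text \<open>
  The inverses of the components are natural: conjugate the naturality square by the components.
\<close>

lemma is_iso_functor_cat:
  assumes CD: "category C" "category D" and F: "is_functor C D F" and G: "is_functor C D G"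
    and h: "h \<in> nat_trans C D F G" and iso: "\<And>x. x \<in> Obj C \<Longrightarrow> is_iso D (FObj F x) (FObj G x) (h x)"
  shows "is_iso (functor_cat C D) F G h"
proof -
  interpret D: category D by (rule CD)
  interpret F: is_functor C D F by (rule F)
  interpret G: is_functor C D G by (rule G)
  from iso have "\<exists>k. \<forall>x \<in> Obj C. k x \<in> Hom D (FObj G x) (FObj F x) \<and>
      Cmp D (FObj F x) (FObj G x) (FObj F x) (k x) (h x) = Idt D (FObj F x) \<and>
      Cmp D (FObj G x) (FObj F x) (FObj G x) (h x) (k x) = Idt D (FObj G x)"
    unfolding is_iso_def by metis
  then obtain k0 where k0: "\<forall>x \<in> Obj C. k0 x \<in> Hom D (FObj G x) (FObj F x) \<and>
      Cmp D (FObj F x) (FObj G x) (FObj F x) (k0 x) (h x) = Idt D (FObj F x) \<and>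
      Cmp D (FObj G x) (FObj F x) (FObj G x) (h x) (k0 x) = Idt D (FObj G x)" ..
  define k where "k = restrict k0 (Obj C)"
  have k: "\<And>x. x \<in> Obj C \<Longrightarrow> k x \<in> Hom D (FObj G x) (FObj F x)"
    "\<And>x. x \<in> Obj C \<Longrightarrow> Cmp D (FObj F x) (FObj G x) (FObj F x) (k x) (h x) = Idt D (FObj F x)"
    "\<And>x. x \<in> Obj C \<Longrightarrow> Cmp D (FObj G x) (FObj F x) (FObj G x) (h x) (k x) = Idt D (FObj G x)"
    using k0 by (auto simp: k_def)
  have h1: "\<And>x. x \<in> Obj C \<Longrightarrow> h x \<in> Hom D (FObj F x) (FObj G x)"
    and h2: "\<And>x y f. x \<in> Obj C \<Longrightarrow> y \<in> Obj C \<Longrightarrow> f \<in> Hom C x y \<Longrightarrow>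
      Cmp D (FObj F x) (FObj F y) (FObj G y) (h y) (FHom F x y f) =
          Cmp D (FObj F x) (FObj G x) (FObj G y) (FHom G x y f) (h x)"
    using h by (auto simp: nat_trans_def)
  have "Cmp D (FObj G x) (FObj G y) (FObj F y) (k y) (FHom G x y f) =
        Cmp D (FObj G x) (FObj F x) (FObj F y) (FHom F x y f) (k x)"
    if a: "x \<in> Obj C" "y \<in> Obj C" "f \<in> Hom C x y" for x y f
  proof -
    note b = a k(1) h1 F.FObj_in_Obj G.FObj_in_Obj F.FHom_in_Hom G.FHom_in_Hom D.Cmp_in_Hom
    have "Cmp D (FObj G x) (FObj F x) (FObj F y) (FHom F x y f) (k x) =
      Cmp D (FObj G x) (FObj F x) (FObj F y) (Cmp D (FObj F x) (FObj F y) (FObj F y)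
         (Cmp D (FObj F y) (FObj G y) (FObj F y) (k y) (h y)) (FHom F x y f)) (k x)"
      using b k(2) by (simp add: D.Cmp_Idt_left)
    also have "\<dots> = Cmp D (FObj G x) (FObj F x) (FObj F y) (Cmp D (FObj F x) (FObj G y) (FObj F y)
         (k y) (Cmp D (FObj F x) (FObj G x) (FObj G y) (FHom G x y f) (h x))) (k x)"
      using b by (simp flip: h2 add: D.Cmp_assoc)
    also have "\<dots> = Cmp D (FObj G x) (FObj G y) (FObj F y) (k y) (FHom G x y f)"
      using b k(3) by (simp add: D.Cmp_assoc D.cancel_inverse_right)
    finally show ?thesis by simp
  qed
  then have "k \<in> nat_trans C D G F"
    using k by (auto simp: nat_trans_def k_def)
  then show ?thesis using h k unfolding is_iso_def
    by (auto simp: functor_cat_def fun_eq_iff intro!: bexI[of _ k])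
qed


section \<open>Vector spaces\<close>

text \<open>
  The scalars form a type, so the carrier conditions on them can be discharged once and for all.
\<close>

locale vec_obj =
  fixes V :: "('k::field, 'v) module"
  assumes in_Vec: "V \<in> Obj Vec"
begin

sublocale mod: Module.module ring_of_type_algebra V
  using in_Vec by (simp add: Vec_def)

lemma zero_in [simp, intro]: "\<zero>\<^bsub>V\<^esub> \<in> carrier V"
  by simp

lemma add_in [simp, intro]: "x \<in> carrier V \<Longrightarrow> y \<in> carrier V \<Longrightarrow> x \<oplus>\<^bsub>V\<^esub> y \<in> carrier V"
  by simp

lemma smult_in [simp, intro]: "x \<in> carrier V \<Longrightarrow> c \<odot>\<^bsub>V\<^esub> x \<in> carrier V"
  using mod.smult_closed[of c x] by (simp add: ring_of_type_algebra_def)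

lemma smult_add_left: "x \<in> carrier V \<Longrightarrow> (a + b) \<odot>\<^bsub>V\<^esub> x = a \<odot>\<^bsub>V\<^esub> x \<oplus>\<^bsub>V\<^esub> b \<odot>\<^bsub>V\<^esub> x"
  using mod.smult_l_distr[of a b x] by (simp add: ring_of_type_algebra_def)

lemma smult_add_right:
  "x \<in> carrier V \<Longrightarrow> y \<in> carrier V \<Longrightarrow> a \<odot>\<^bsub>V\<^esub> (x \<oplus>\<^bsub>V\<^esub> y) = a \<odot>\<^bsub>V\<^esub> x \<oplus>\<^bsub>V\<^esub> a \<odot>\<^bsub>V\<^esub> y"
  using mod.smult_r_distr[of a x y] by (simp add: ring_of_type_algebra_def)

lemma smult_smult: "x \<in> carrier V \<Longrightarrow> a \<odot>\<^bsub>V\<^esub> (b \<odot>\<^bsub>V\<^esub> x) = (a * b) \<odot>\<^bsub>V\<^esub> x"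
  using mod.smult_assoc1[of a b x] by (simp add: ring_of_type_algebra_def)

lemma smult_one [simp]: "x \<in> carrier V \<Longrightarrow> 1 \<odot>\<^bsub>V\<^esub> x = x"
  using mod.smult_one[of x] by (simp add: ring_of_type_algebra_def)

lemma smult_zero [simp]: "x \<in> carrier V \<Longrightarrow> 0 \<odot>\<^bsub>V\<^esub> x = \<zero>\<^bsub>V\<^esub>"
  using mod.smult_l_null[of x] by (simp add: ring_of_type_algebra_def)

lemma smult_zero_right [simp]: "c \<odot>\<^bsub>V\<^esub> \<zero>\<^bsub>V\<^esub> = \<zero>\<^bsub>V\<^esub>"
  using mod.smult_r_null[of c] by (simp add: ring_of_type_algebra_def)

lemma sum_in [simp, intro]: "(\<And>i. i \<in> I \<Longrightarrow> f i \<in> carrier V) \<Longrightarrow> finsum V f I \<in> carrier V"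
  by (rule mod.M.finsum_closed) auto

lemma sum_cong:
  "(\<And>i. i \<in> I \<Longrightarrow> f i = g i) \<Longrightarrow> (\<And>i. i \<in> I \<Longrightarrow> g i \<in> carrier V) \<Longrightarrow> finsum V f I = finsum V g I"
  by (rule mod.M.finsum_cong') auto

lemma smult_sum:
  "(\<And>i. i \<in> I \<Longrightarrow> f i \<in> carrier V) \<Longrightarrow> c \<odot>\<^bsub>V\<^esub> finsum V f I = finsum V (\<lambda>i. c \<odot>\<^bsub>V\<^esub> f i) I"
proof (induction I rule: infinite_finite_induct)
  case (insert i I)
  then show ?case by (simp add: smult_add_right Pi_def)
qed auto

lemma sum_smult:
  "finite I \<Longrightarrow> x \<in> carrier V \<Longrightarrow> (\<Sum>i\<in>I. c i) \<odot>\<^bsub>V\<^esub> x = finsum V (\<lambda>i. c i \<odot>\<^bsub>V\<^esub> x) I"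
proof (induction I rule: finite_induct)
  case (insert i I)
  then show ?case by (simp add: smult_add_left Pi_def)
qed auto

lemma sum_swap:
  assumes "finite J" "\<And>i j. i \<in> I \<Longrightarrow> j \<in> J \<Longrightarrow> f i j \<in> carrier V"
  shows "finsum V (\<lambda>i. finsum V (f i) J) I = finsum V (\<lambda>j. finsum V (\<lambda>i. f i j) I) J"
  using assms
proof (induction J rule: finite_induct)
  case empty
  then show ?case by simp
next
  case (insert j J)
  have "finsum V (\<lambda>i. finsum V (f i) (insert j J)) I =
    finsum V (\<lambda>i. f i j \<oplus>\<^bsub>V\<^esub> finsum V (f i) J) I"
    using insert by (intro sum_cong) (auto simp: Pi_def)
  also have "\<dots> = finsum V (\<lambda>i. f i j) I \<oplus>\<^bsub>V\<^esub> finsum V (\<lambda>i. finsum V (f i) J) I"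
    using insert by (intro mod.M.finsum_addf) (auto simp: Pi_def)
  finally show ?case using insert by (simp add: Pi_def)
qed

lemma sum_delta:
  assumes "finite I" "\<And>j. j \<in> I \<Longrightarrow> f j \<in> carrier V"
  shows "finsum V (\<lambda>j. (if j = i then c else 0) \<odot>\<^bsub>V\<^esub> f j) I = (if i \<in> I then c \<odot>\<^bsub>V\<^esub> f i else \<zero>\<^bsub>V\<^esub>)"
  using assms by (induction I rule: finite_induct) (auto simp: Pi_def)

lemma subspace_in_Vec:
  assumes "A \<subseteq> carrier V" "\<zero>\<^bsub>V\<^esub> \<in> A" "\<And>x y. x \<in> A \<Longrightarrow> y \<in> A \<Longrightarrow> x \<oplus>\<^bsub>V\<^esub> y \<in> A"
    "\<And>c x. x \<in> A \<Longrightarrow> c \<odot>\<^bsub>V\<^esub> x \<in> A"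
  shows "V\<lparr>carrier := A\<rparr> \<in> Obj Vec"
proof -
  have neg: "\<ominus>\<^bsub>V\<^esub> x \<in> A" if "x \<in> A" for x
  proof -
    have "(- 1) \<odot>\<^bsub>V\<^esub> x \<oplus>\<^bsub>V\<^esub> x = (- 1 + 1) \<odot>\<^bsub>V\<^esub> x"
      using that assms(1) smult_add_left[of x "-1" 1] by auto
    then have "\<ominus>\<^bsub>V\<^esub> x = (- 1) \<odot>\<^bsub>V\<^esub> x"
      using that assms(1) mod.M.minus_equality[of "(- 1) \<odot>\<^bsub>V\<^esub> x" x] by auto
    then show ?thesis using that assms(4) by simp
  qed
  have "submodule A ring_of_type_algebra V"
    by (rule mod.submoduleI) (use assms neg in \<open>auto simp: ring_of_type_algebra_def\<close>)
  then show ?thesis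
    using submodule.submodule_is_module mod.module_axioms by (auto simp: Vec_def)
qed

end

lemma Vec_HomD:
  assumes "T \<in> Hom Vec V W"
  shows "x \<in> carrier V \<Longrightarrow> T x \<in> carrier W"
    and "x \<in> carrier V \<Longrightarrow> y \<in> carrier V \<Longrightarrow> T (x \<oplus>\<^bsub>V\<^esub> y) = T x \<oplus>\<^bsub>W\<^esub> T y"
    and "x \<in> carrier V \<Longrightarrow> T (c \<odot>\<^bsub>V\<^esub> x) = c \<odot>\<^bsub>W\<^esub> T x"
  using assms by (auto simp: Vec_def)

lemma Vec_Cmp: "x \<in> carrier U \<Longrightarrow> Cmp Vec U V W g f x = g (f x)"
  by (simp add: Vec_def compose_def)

lemma Vec_Idt: "x \<in> carrier U \<Longrightarrow> Idt Vec U x = x"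
  by (simp add: Vec_def)

lemma Vec_Hom_restrictI:
  assumes "\<And>x. x \<in> carrier V \<Longrightarrow> T x \<in> carrier W"
    and "\<And>x y. x \<in> carrier V \<Longrightarrow> y \<in> carrier V \<Longrightarrow> T (x \<oplus>\<^bsub>V\<^esub> y) = T x \<oplus>\<^bsub>W\<^esub> T y"
    and "\<And>c x. x \<in> carrier V \<Longrightarrow> T (c \<odot>\<^bsub>V\<^esub> x) = c \<odot>\<^bsub>W\<^esub> T x"
    and "V \<in> Obj Vec"
  shows "restrict T (carrier V) \<in> Hom Vec V W"
proof -
  interpret vec_obj V by unfold_locales fact
  show ?thesis using assms(1-3) by (simp add: Vec_def)
qed

lemma Vec_Hom_eqI:
  assumes "S \<in> Hom Vec V W" "T \<in> Hom Vec V W" "\<And>x. x \<in> carrier V \<Longrightarrow> S x = T x"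
  shows "S = T"
  using assms by (auto simp: Vec_def intro: extensionalityI PiE_ext)

lemma Vec_Hom_sum:
  assumes "V \<in> Obj Vec" "W \<in> Obj Vec" "T \<in> Hom Vec V W" "\<And>i. i \<in> I \<Longrightarrow> f i \<in> carrier V"
  shows "T (finsum V f I) = finsum W (\<lambda>i. T (f i)) I"
proof -
  interpret V: vec_obj V by unfold_locales fact
  interpret W: vec_obj W by unfold_locales fact
  note T = Vec_HomD[OF assms(3)]
  have T0: "T \<zero>\<^bsub>V\<^esub> = \<zero>\<^bsub>W\<^esub>"
    using T(3)[of "\<zero>\<^bsub>V\<^esub>" 0] T(1)[of "\<zero>\<^bsub>V\<^esub>"] by simp
  show ?thesis using assms(4)
  proof (induction I rule: infinite_finite_induct)
    case (insert i I)
    then show ?case using T by (simp add: Pi_def)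
  qed (auto simp: T0)
qed

lemma is_iso_VecI:
  assumes "V \<in> Obj Vec" "W \<in> Obj Vec" "T \<in> Hom Vec V W" "bij_betw T (carrier V) (carrier W)"
  shows "is_iso Vec V W T"
proof -
  interpret V: vec_obj V by unfold_locales fact
  interpret W: vec_obj W by unfold_locales fact
  note T = Vec_HomD[OF assms(3)]
  define S where "S = the_inv_into (carrier V) T"
  have S: "S y \<in> carrier V" "T (S y) = y" if "y \<in> carrier W" for y
    using assms(4) that by (auto simp: S_def bij_betw_def the_inv_into_into f_the_inv_into_f)
  have ST: "S (T x) = x" if "x \<in> carrier V" for x
    using assms(4) that by (auto simp: S_def bij_betw_def the_inv_into_f_f)
  have "restrict S (carrier W) \<in> Hom Vec W V"
  proof (rule Vec_Hom_restrictI)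
    show "S (x \<oplus>\<^bsub>W\<^esub> y) = S x \<oplus>\<^bsub>V\<^esub> S y" if "x \<in> carrier W" "y \<in> carrier W" for x y
      using that S ST[of "S x \<oplus>\<^bsub>V\<^esub> S y"] T by simp
    show "S (c \<odot>\<^bsub>W\<^esub> x) = c \<odot>\<^bsub>V\<^esub> S x" if "x \<in> carrier W" for c x
      using that S ST[of "c \<odot>\<^bsub>V\<^esub> S x"] T by simp
  qed (use S assms in auto)
  then show ?thesis
    using assms(3) S ST T(1) unfolding is_iso_def
    by (intro conjI bexI[of _ "restrict S (carrier W)"]) (auto simp: Vec_def compose_def fun_eq_iff)
qed

text \<open>
  An infinite type is in bijection with its square, so tuples of its elements can be coded by its
  elements.  This is what makes the universe of vector spaces closed under finite products.
\<close>

lemma inj_on_finite_tuples: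
  assumes "finite I"
  shows "\<exists>h :: ('i \<Rightarrow> 'v::infinite) \<Rightarrow> 'v. inj_on h (extensional I)"
  using assms
proof (induction I rule: finite_induct)
  case empty
  show ?case by (rule exI[of _ "\<lambda>_. undefined"]) (auto simp: inj_on_def)
next
  case (insert i I)
  then obtain h :: "('i \<Rightarrow> 'v) \<Rightarrow> 'v" where h: "inj_on h (extensional I)" by blast
  have inf: "infinite (UNIV :: 'v set)" by (rule infinite_UNIV)
  obtain k where k: "bij_betw k ((UNIV :: 'v set) \<times> (UNIV :: 'v set)) (UNIV :: 'v set)"
    using card_of_ordIso[THEN iffD2, OF card_of_Times_same_infinite[OF inf]] by blast
  have "inj_on (\<lambda>f. k (f i, h (restrict f I))) (extensional (insert i I))"
  proof (rule inj_onI)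
    fix f g :: "'i \<Rightarrow> 'v"
    assume fg: "f \<in> extensional (insert i I)" "g \<in> extensional (insert i I)"
      and eq: "k (f i, h (restrict f I)) = k (g i, h (restrict g I))"
    have "(f i, h (restrict f I)) = (g i, h (restrict g I))"
      by (rule inj_onD[OF bij_betw_imp_inj_on[OF k] eq]) simp_all
    moreover from this have "restrict f I = restrict g I"
      by (intro inj_onD[OF h]) simp_all
    ultimately have "f x = g x" if "x \<in> insert i I" for x
      using that by (metis insertE prod.inject restrict_apply')
    then show "f = g" by (rule extensionalityI[OF fg])
  qed
  then show ?case by blast
qed

text \<open>
  The carrier of the product is the set of codes of tuples under an injection from tuples to
  elements.  Only the projections and the two halves of the universal property on elements are
  kept, so that later arguments do not depend on the coding.
\<close>

lemma Vec_finite_product: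
  fixes V :: "'i \<Rightarrow> ('k::field, 'v::infinite) module"
  assumes "finite I" and V: "\<And>i. i \<in> I \<Longrightarrow> V i \<in> Obj Vec"
  shows "\<exists>W \<in> Obj Vec. \<exists>\<pi>. (\<forall>i \<in> I. \<pi> i \<in> Hom Vec W (V i)) \<and>
    (\<forall>x \<in> (\<Pi>\<^sub>E i \<in> I. carrier (V i)). \<exists>w \<in> carrier W. \<forall>i \<in> I. \<pi> i w = x i) \<and>
    (\<forall>w \<in> carrier W. \<forall>w' \<in> carrier W. (\<forall>i \<in> I. \<pi> i w = \<pi> i w') \<longrightarrow> w = w')"
proof -
  obtain h :: "('i \<Rightarrow> 'v) \<Rightarrow> 'v" where h: "inj_on h (extensional I)"
    using inj_on_finite_tuples[OF assms(1)] by blast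
  define Q where "Q = (\<Pi>\<^sub>E i \<in> I. carrier (V i))"
  define dec where "dec = the_inv_into (extensional I) h"
  have dec: "dec (h x) = x" if "x \<in> Q" for x
    unfolding dec_def by (rule the_inv_into_f_f[OF h]) (use that in \<open>auto simp: Q_def PiE_def\<close>)
  have vo: "vec_obj (V i)" if "i \<in> I" for i using V[OF that] by unfold_locales
  define W :: "('k, 'v) module" where "W = \<lparr>carrier = h ` Q, mult = (\<lambda>_ _. undefined), one = undefined,
     zero = h (\<lambda>i \<in> I. \<zero>\<^bsub>V i\<^esub>), add = (\<lambda>x y. h (\<lambda>i \<in> I. dec x i \<oplus>\<^bsub>V i\<^esub> dec y i)),
     module.smult = (\<lambda>c x. h (\<lambda>i \<in> I. c \<odot>\<^bsub>V i\<^esub> dec x i))\<rparr>"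
  have Qi: "x i \<in> carrier (V i)" if "x \<in> Q" "i \<in> I" for x i
    using that by (auto simp: Q_def)
  have Q0: "(\<lambda>i \<in> I. \<zero>\<^bsub>V i\<^esub>) \<in> Q" using vo by (auto simp: Q_def vec_obj.zero_in)
  have Qa: "(\<lambda>i \<in> I. x i \<oplus>\<^bsub>V i\<^esub> y i) \<in> Q" if "x \<in> Q" "y \<in> Q" for x y
    unfolding Q_def
    by (intro restrict_PiE_iff[THEN iffD2] ballI vec_obj.add_in vo Qi[OF that(1)] Qi[OF that(2)])
  have Qs: "(\<lambda>i \<in> I. c \<odot>\<^bsub>V i\<^esub> x i) \<in> Q" if "x \<in> Q" for x c
    unfolding Q_def
    by (intro restrict_PiE_iff[THEN iffD2] ballI vec_obj.smult_in vo Qi[OF that])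
  have Qeq: "(\<lambda>i \<in> I. f i) = x" if "\<And>i. i \<in> I \<Longrightarrow> f i = x i" "x \<in> Q" for f x
    using that by (auto simp: Q_def fun_eq_iff)
  have add: "h x \<oplus>\<^bsub>W\<^esub> h y = h (\<lambda>i \<in> I. x i \<oplus>\<^bsub>V i\<^esub> y i)" if "x \<in> Q" "y \<in> Q" for x y
    using that by (simp add: W_def dec)
  have smult: "c \<odot>\<^bsub>W\<^esub> h x = h (\<lambda>i \<in> I. c \<odot>\<^bsub>V i\<^esub> x i)" if "x \<in> Q" for c x
    using that by (simp add: W_def dec)
  have cW: "carrier W = h ` Q" and zW: "\<zero>\<^bsub>W\<^esub> = h (\<lambda>i \<in> I. \<zero>\<^bsub>V i\<^esub>)" by (simp_all add: W_def)
  note mod = vec_obj.in_Vec[OF vo, unfolded Vec_def, simplified]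
  have ag: "abelian_group (V i)" if "i \<in> I" for i
    using mod[OF that] by (simp add: Module.module_def)
  have "abelian_group W"
  proof (rule abelian_groupI)
    fix x assume "x \<in> carrier W"
    then obtain x0 where x0: "x = h x0" "x0 \<in> Q" by (auto simp: cW)
    have "(\<lambda>i \<in> I. (- 1) \<odot>\<^bsub>V i\<^esub> x0 i \<oplus>\<^bsub>V i\<^esub> x0 i) = (\<lambda>i \<in> I. \<zero>\<^bsub>V i\<^esub>)"
    proof (rule restrict_ext)
      fix i assume i: "i \<in> I"
      then interpret vec_obj "V i" by (rule vo)
      show "(- 1) \<odot>\<^bsub>V i\<^esub> x0 i \<oplus>\<^bsub>V i\<^esub> x0 i = \<zero>\<^bsub>V i\<^esub>"
        using smult_add_left[of "x0 i" "-1" 1] Qi[OF x0(2) i] by simp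
    qed
    then show "\<exists>y\<in>carrier W. y \<oplus>\<^bsub>W\<^esub> x = \<zero>\<^bsub>W\<^esub>"
      using Qs[OF x0(2), of "-1"] x0
      by (intro bexI[of _ "h (\<lambda>i \<in> I. (- 1) \<odot>\<^bsub>V i\<^esub> x0 i)"]) (auto simp: add zW cW cong: restrict_cong)
  next
    fix x y assume "x \<in> carrier W" "y \<in> carrier W"
    then obtain x0 y0 where xy: "x = h x0" "x0 \<in> Q" "y = h y0" "y0 \<in> Q" by (auto simp: cW)
    then show "x \<oplus>\<^bsub>W\<^esub> y \<in> carrier W" by (simp add: add cW Qa)
    have "(\<lambda>i \<in> I. x0 i \<oplus>\<^bsub>V i\<^esub> y0 i) = (\<lambda>i \<in> I. y0 i \<oplus>\<^bsub>V i\<^esub> x0 i)"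
      using xy Qi by (intro restrict_ext abelian_monoid.a_comm abelian_group.axioms ag) auto
    with xy show "x \<oplus>\<^bsub>W\<^esub> y = y \<oplus>\<^bsub>W\<^esub> x" by (simp add: add)
    fix z assume "z \<in> carrier W"
    then obtain z0 where z: "z = h z0" "z0 \<in> Q" by (auto simp: cW)
    have "(\<lambda>i \<in> I. x0 i \<oplus>\<^bsub>V i\<^esub> y0 i \<oplus>\<^bsub>V i\<^esub> z0 i) = (\<lambda>i \<in> I. x0 i \<oplus>\<^bsub>V i\<^esub> (y0 i \<oplus>\<^bsub>V i\<^esub> z0 i))"
      using xy z Qi by (intro restrict_ext abelian_monoid.a_assoc abelian_group.axioms ag) auto
    with xy z show "x \<oplus>\<^bsub>W\<^esub> y \<oplus>\<^bsub>W\<^esub> z = x \<oplus>\<^bsub>W\<^esub> (y \<oplus>\<^bsub>W\<^esub> z)"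
      by (simp add: add Qa cong: restrict_cong)
  next
    show "\<zero>\<^bsub>W\<^esub> \<in> carrier W" using Q0 by (simp add: zW cW)
    fix x assume "x \<in> carrier W"
    then obtain x0 where x: "x = h x0" "x0 \<in> Q" by (auto simp: cW)
    have "(\<lambda>i \<in> I. \<zero>\<^bsub>V i\<^esub> \<oplus>\<^bsub>V i\<^esub> x0 i) = x0"
      using x Qi by (intro Qeq abelian_monoid.l_zero abelian_group.axioms ag) auto
    with x show "\<zero>\<^bsub>W\<^esub> \<oplus>\<^bsub>W\<^esub> x = x" by (simp add: add zW Q0 cong: restrict_cong)
  qed
  moreover have "cring (ring_of_type_algebra :: 'k ring)" by (rule cring_from_type_algebra)
  ultimately have "Module.module ring_of_type_algebra W"
  proof (intro Module.moduleI)
    fix x and a b :: 'k assume "x \<in> carrier W"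
    then obtain x0 where x: "x = h x0" "x0 \<in> Q" by (auto simp: cW)
    note xi = Qi[OF x(2)]
    show "a \<odot>\<^bsub>W\<^esub> x \<in> carrier W" using x by (simp add: smult cW Qs)
    have "(\<lambda>i \<in> I. (a + b) \<odot>\<^bsub>V i\<^esub> x0 i) = (\<lambda>i \<in> I. a \<odot>\<^bsub>V i\<^esub> x0 i \<oplus>\<^bsub>V i\<^esub> b \<odot>\<^bsub>V i\<^esub> x0 i)"
      using xi vo by (intro restrict_ext vec_obj.smult_add_left) auto
    with x show "(a \<oplus>\<^bsub>ring_of_type_algebra\<^esub> b) \<odot>\<^bsub>W\<^esub> x = a \<odot>\<^bsub>W\<^esub> x \<oplus>\<^bsub>W\<^esub> b \<odot>\<^bsub>W\<^esub> x"
      by (simp add: smult add Qs ring_of_type_algebra_def cong: restrict_cong)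
    have "(\<lambda>i \<in> I. a \<odot>\<^bsub>V i\<^esub> (b \<odot>\<^bsub>V i\<^esub> x0 i)) = (\<lambda>i \<in> I. (a * b) \<odot>\<^bsub>V i\<^esub> x0 i)"
      using xi vo by (intro restrict_ext vec_obj.smult_smult) auto
    with x show "(a \<otimes>\<^bsub>ring_of_type_algebra\<^esub> b) \<odot>\<^bsub>W\<^esub> x = a \<odot>\<^bsub>W\<^esub> (b \<odot>\<^bsub>W\<^esub> x)"
      by (simp add: smult Qs ring_of_type_algebra_def cong: restrict_cong)
    have "(\<lambda>i \<in> I. 1 \<odot>\<^bsub>V i\<^esub> x0 i) = x0"
      using xi vo x by (intro Qeq vec_obj.smult_one) auto
    with x show "\<one>\<^bsub>ring_of_type_algebra\<^esub> \<odot>\<^bsub>W\<^esub> x = x"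
      by (simp add: smult ring_of_type_algebra_def)
    fix y assume "y \<in> carrier W"
    then obtain y0 where y: "y = h y0" "y0 \<in> Q" by (auto simp: cW)
    have "(\<lambda>i \<in> I. a \<odot>\<^bsub>V i\<^esub> (x0 i \<oplus>\<^bsub>V i\<^esub> y0 i)) = (\<lambda>i \<in> I. a \<odot>\<^bsub>V i\<^esub> x0 i \<oplus>\<^bsub>V i\<^esub> a \<odot>\<^bsub>V i\<^esub> y0 i)"
      using xi Qi[OF y(2)] vo by (intro restrict_ext vec_obj.smult_add_right) auto
    with x y show "a \<odot>\<^bsub>W\<^esub> (x \<oplus>\<^bsub>W\<^esub> y) = a \<odot>\<^bsub>W\<^esub> x \<oplus>\<^bsub>W\<^esub> a \<odot>\<^bsub>W\<^esub> y"
      by (simp add: smult add Qs Qa cong: restrict_cong)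
  qed
  then have W: "W \<in> Obj Vec" by (simp add: Vec_def)
  define \<pi> where "\<pi> i = (\<lambda>w \<in> carrier W. dec w i)" for i
  have "\<pi> i \<in> Hom Vec W (V i)" if "i \<in> I" for i
    unfolding \<pi>_def by (rule Vec_Hom_restrictI[OF _ _ _ W])
      (use that in \<open>auto simp: cW add smult dec Qa Qs Qi\<close>)
  moreover have "\<exists>w \<in> carrier W. \<forall>i \<in> I. \<pi> i w = x i" if "x \<in> Q" for x
    using that by (intro bexI[of _ "h x"]) (auto simp: \<pi>_def cW dec)
  moreover have "w = w'" if w: "w \<in> carrier W" "w' \<in> carrier W" "\<forall>i \<in> I. \<pi> i w = \<pi> i w'" for w w'
  proof -
    obtain x x' where x: "w = h x" "w' = h x'" "x \<in> Q" "x' \<in> Q" using w by (auto simp: cW)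
    have "x i = x' i" if "i \<in> I" for i
      using w(3) that x by (auto simp: \<pi>_def cW dec)
    then have "x = x'" using x(3,4) unfolding Q_def by (blast intro: PiE_ext)
    then show ?thesis using x by simp
  qed
  ultimately show ?thesis using W unfolding Q_def by blast
qed


section \<open>Linearised categories\<close>

text \<open>
  Morphisms of the linearisation are coefficient functions on the whole type of morphisms that
  vanish off the Hom-set; equality of morphisms is then equality of functions.
\<close>

definition lin_hom :: "('o, 'm) cat \<Rightarrow> 'o \<Rightarrow> 'o \<Rightarrow> ('m \<Rightarrow> 'k::field) set" where
  "lin_hom C S T = {a. \<forall>h. h \<notin> Hom C S T \<longrightarrow> a h = 0}"

definition lin_cmp ::
  "('o, 'm) cat \<Rightarrow> 'o \<Rightarrow> 'o \<Rightarrow> 'o \<Rightarrow> ('m \<Rightarrow> 'k::field) \<Rightarrow> ('m \<Rightarrow> 'k) \<Rightarrow> 'm \<Rightarrow> 'k" where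
  "lin_cmp C S T U b a =
     (\<lambda>k. \<Sum>g \<in> Hom C T U. \<Sum>f \<in> Hom C S T. b g * a f * of_bool (Cmp C S T U g f = k))"

definition dirac :: "'m \<Rightarrow> 'm \<Rightarrow> 'k::field" where
  "dirac h = (\<lambda>k. of_bool (h = k))"

text \<open>
  These rules would turn sums against Kronecker symbols into sums over intersections before
  \<open>sum_kronecker\<close> can evaluate them.
\<close>

declare sum_mult_of_bool_eq [simp del] sum_of_bool_mult_eq [simp del]

lemma sum_kronecker:
  fixes F :: "'a \<Rightarrow> 'k::field"
  assumes "finite A"
  shows "(\<Sum>k\<in>A. of_bool (x = k) * F k) = (if x \<in> A then F x else 0)"
    and "(\<Sum>k\<in>A. F k * of_bool (x = k)) = (if x \<in> A then F x else 0)"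
proof -
  have "(\<Sum>k\<in>A. of_bool (x = k) * F k) = (\<Sum>k\<in>A. if x = k then F k else 0)"
    by (rule sum.cong) auto
  then show *: "(\<Sum>k\<in>A. of_bool (x = k) * F k) = (if x \<in> A then F x else 0)"
    using assms by simp
  then show "(\<Sum>k\<in>A. F k * of_bool (x = k)) = (if x \<in> A then F x else 0)"
    by (simp add: mult.commute)
qed

locale hom_finite_category = category C for C :: "('o, 'm) cat" +
  assumes finite_Hom: "S \<in> Obj C \<Longrightarrow> T \<in> Obj C \<Longrightarrow> finite (Hom C S T)"
begin

lemma lin_cmp_in:
  assumes "S \<in> Obj C" "T \<in> Obj C" "U \<in> Obj C"
  shows "lin_cmp C S T U b a \<in> lin_hom C S U"
proof -
  have "lin_cmp C S T U b a k = 0" if "k \<notin> Hom C S U" for k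
    unfolding lin_cmp_def using that assms Cmp_in_Hom
    by (intro sum.neutral ballI) (auto simp: of_bool_def)
  then show ?thesis by (simp add: lin_hom_def)
qed

lemma dirac_in: "h \<in> Hom C S T \<Longrightarrow> dirac h \<in> lin_hom C S T"
  by (auto simp: lin_hom_def dirac_def)

text \<open>
  The composite is the image under composition of the product weight on pairs of morphisms, so a
  sum against it can be taken over pairs.  Associativity reduces to this by testing against
  Kronecker symbols.
\<close>

lemma sum_lin_cmp:
  fixes F :: "'m \<Rightarrow> 'k::field"
  assumes "S \<in> Obj C" "T \<in> Obj C" "U \<in> Obj C"
  shows "(\<Sum>k \<in> Hom C S U. lin_cmp C S T U b a k * F k) =
    (\<Sum>g \<in> Hom C T U. \<Sum>f \<in> Hom C S T. b g * a f * F (Cmp C S T U g f))"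
proof -
  have "(\<Sum>k \<in> Hom C S U. lin_cmp C S T U b a k * F k) =
    (\<Sum>k \<in> Hom C S U. \<Sum>g \<in> Hom C T U. \<Sum>f \<in> Hom C S T.
        of_bool (Cmp C S T U g f = k) * (b g * a f * F k))"
    unfolding lin_cmp_def sum_distrib_right by (intro sum.cong refl) simp
  also have "\<dots> = (\<Sum>g \<in> Hom C T U. \<Sum>f \<in> Hom C S T. \<Sum>k \<in> Hom C S U.
        of_bool (Cmp C S T U g f = k) * (b g * a f * F k))"
    by (subst sum.swap) (intro sum.cong refl sum.swap)
  also have "\<dots> = (\<Sum>g \<in> Hom C T U. \<Sum>f \<in> Hom C S T. b g * a f * F (Cmp C S T U g f))"
    using assms Cmp_in_Hom by (intro sum.cong refl) (simp add: sum_kronecker finite_Hom)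
  finally show ?thesis .
qed

lemma lin_cmp_assoc:
  assumes "S \<in> Obj C" "T \<in> Obj C" "U \<in> Obj C" "W \<in> Obj C"
  shows "lin_cmp C S U W c (lin_cmp C S T U b a) = lin_cmp C S T W (lin_cmp C T U W c b) a"
proof
  fix k
  have "lin_cmp C S U W c (lin_cmp C S T U b a) k =
    (\<Sum>h \<in> Hom C U W. c h * (\<Sum>l \<in> Hom C S U. lin_cmp C S T U b a l * of_bool (Cmp C S U W h l = k)))"
    by (subst lin_cmp_def) (simp add: sum_distrib_left mult.assoc)
  also have "\<dots> = (\<Sum>h \<in> Hom C U W. \<Sum>g \<in> Hom C T U. \<Sum>f \<in> Hom C S T. c h * b g * a f *
      of_bool (Cmp C S U W h (Cmp C S T U g f) = k))"
    using assms by (simp add: sum_lin_cmp sum_distrib_left mult.assoc)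
  also have "\<dots> = (\<Sum>h \<in> Hom C U W. \<Sum>g \<in> Hom C T U. \<Sum>f \<in> Hom C S T. c h * b g * a f *
      of_bool (Cmp C S T W (Cmp C T U W h g) f = k))"
    using assms by (intro sum.cong refl) (simp add: Cmp_assoc)
  also have "\<dots> = (\<Sum>l \<in> Hom C T W. lin_cmp C T U W c b l *
      (\<Sum>f \<in> Hom C S T. a f * of_bool (Cmp C S T W l f = k)))"
    using assms by (subst sum_lin_cmp) (simp_all add: sum_distrib_left mult.assoc)
  also have "\<dots> = lin_cmp C S T W (lin_cmp C T U W c b) a k"
    unfolding lin_cmp_def[of C S T W] by (simp add: sum_distrib_left mult.assoc)
  finally show "lin_cmp C S U W c (lin_cmp C S T U b a) k = lin_cmp C S T W (lin_cmp C T U W c b) a k" .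
qed

lemma lin_cmp_dirac_right:
  assumes "S \<in> Obj C" "T \<in> Obj C" "a \<in> lin_hom C S T"
  shows "lin_cmp C S S T a (dirac (Idt C S)) = a"
proof
  fix k
  have "lin_cmp C S S T a (dirac (Idt C S)) k =
    (\<Sum>g \<in> Hom C S T. a g * (\<Sum>f \<in> Hom C S S. of_bool (Idt C S = f) * of_bool (Cmp C S S T g f = k)))"
    by (simp add: lin_cmp_def dirac_def sum_distrib_left mult.assoc)
  also have "\<dots> = (\<Sum>g \<in> Hom C S T. a g * of_bool (Cmp C S S T g (Idt C S) = k))"
    using assms Idt_in_Hom by (simp add: sum_kronecker finite_Hom)
  also have "\<dots> = (\<Sum>g \<in> Hom C S T. a g * of_bool (k = g))"
    using assms by (intro sum.cong refl) (auto simp: Cmp_Idt_right)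
  also have "\<dots> = a k"
    using assms by (simp add: sum_kronecker finite_Hom lin_hom_def)
  finally show "lin_cmp C S S T a (dirac (Idt C S)) k = a k" .
qed

lemma lin_cmp_dirac_dirac:
  assumes "S \<in> Obj C" "T \<in> Obj C" "U \<in> Obj C" "g \<in> Hom C T U" "f \<in> Hom C S T"
  shows "lin_cmp C S T U (dirac g) (dirac f) = dirac (Cmp C S T U g f)"
proof
  fix k
  have "lin_cmp C S T U (dirac g) (dirac f) k =
    (\<Sum>g' \<in> Hom C T U. of_bool (g = g') * (\<Sum>f' \<in> Hom C S T. of_bool (f = f') * of_bool (Cmp C S T U g' f' = k)))"
    by (simp add: lin_cmp_def dirac_def sum_distrib_left mult.assoc)
  then show "lin_cmp C S T U (dirac g) (dirac f) k = dirac (Cmp C S T U g f) k"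
    using assms by (simp add: sum_kronecker finite_Hom dirac_def)
qed

lemma lin_hom_expand:
  assumes "S \<in> Obj C" "T \<in> Obj C" "a \<in> lin_hom C S T"
  shows "(\<lambda>k. \<Sum>h \<in> Hom C S T. a h * dirac h k) = a"
proof
  fix k
  have "(\<Sum>h \<in> Hom C S T. a h * dirac h k) = (\<Sum>h \<in> Hom C S T. a h * of_bool (k = h))"
    by (intro sum.cong) (auto simp: dirac_def)
  then show "(\<Sum>h \<in> Hom C S T. a h * dirac h k) = a k"
    using assms by (simp add: sum_kronecker finite_Hom lin_hom_def)
qed

end

lemma lin_cmp_sum_left:
  "lin_cmp C S T U (\<lambda>g. \<Sum>i\<in>I. c i * b i g) a = (\<lambda>k. \<Sum>i\<in>I. c i * lin_cmp C S T U (b i) a k)"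
proof
  fix k
  have "lin_cmp C S T U (\<lambda>g. \<Sum>i\<in>I. c i * b i g) a k =
    (\<Sum>g \<in> Hom C T U. \<Sum>f \<in> Hom C S T. \<Sum>i\<in>I. c i * (b i g * a f * of_bool (Cmp C S T U g f = k)))"
    by (simp add: lin_cmp_def sum_distrib_right mult.assoc)
  also have "\<dots> = (\<Sum>i\<in>I. \<Sum>g \<in> Hom C T U. \<Sum>f \<in> Hom C S T. c i * (b i g * a f * of_bool (Cmp C S T U g f = k)))"
    by (subst (2) sum.swap) (intro sum.cong refl sum.swap)
  finally show "lin_cmp C S T U (\<lambda>g. \<Sum>i\<in>I. c i * b i g) a k = (\<Sum>i\<in>I. c i * lin_cmp C S T U (b i) a k)"
    by (simp add: lin_cmp_def sum_distrib_left)
qed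

lemma lin_cmp_sum_right:
  "lin_cmp C S T U b (\<lambda>g. \<Sum>i\<in>I. c i * a i g) = (\<lambda>k. \<Sum>i\<in>I. c i * lin_cmp C S T U b (a i) k)"
proof
  fix k
  have "lin_cmp C S T U b (\<lambda>g. \<Sum>i\<in>I. c i * a i g) k =
    (\<Sum>g \<in> Hom C T U. \<Sum>f \<in> Hom C S T. \<Sum>i\<in>I. c i * (b g * a i f * of_bool (Cmp C S T U g f = k)))"
    by (simp add: lin_cmp_def sum_distrib_left sum_distrib_right ac_simps)
  also have "\<dots> = (\<Sum>i\<in>I. \<Sum>g \<in> Hom C T U. \<Sum>f \<in> Hom C S T. c i * (b g * a i f * of_bool (Cmp C S T U g f = k)))"
    by (subst (2) sum.swap) (intro sum.cong refl sum.swap)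
  finally show "lin_cmp C S T U b (\<lambda>g. \<Sum>i\<in>I. c i * a i g) k = (\<Sum>i\<in>I. c i * lin_cmp C S T U b (a i) k)"
    by (simp add: lin_cmp_def sum_distrib_left)
qed

lemma lin_hom_sum: "(\<And>i. i \<in> I \<Longrightarrow> a i \<in> lin_hom C S T) \<Longrightarrow> (\<lambda>h. \<Sum>i\<in>I. c i * a i h) \<in> lin_hom C S T"
  by (auto simp: lin_hom_def intro!: sum.neutral)

text \<open>
  The extension of a representation from morphisms to their linear combinations.
\<close>

definition lin_map ::
  "('o, 'm) cat \<Rightarrow> ('o, 'm, ('k::field, 'v) module, 'v \<Rightarrow> 'v) ftor \<Rightarrow> 'o \<Rightarrow> 'o \<Rightarrow> ('m \<Rightarrow> 'k) \<Rightarrow> 'v \<Rightarrow> 'v" where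
  "lin_map C M S T a x =
     (\<Oplus>\<^bsub>FObj M T\<^esub>h \<in> Hom C S T. a h \<odot>\<^bsub>FObj M T\<^esub> FHom M S T h x)"

locale linear_representation = hom_finite_category C + is_functor C Vec M
  for C :: "('o, 'm) cat" and M :: "('o, 'm, ('k::field, 'v) module, 'v \<Rightarrow> 'v) ftor"
begin

lemma vec_obj_at: "S \<in> Obj C \<Longrightarrow> vec_obj (FObj M S)"
  by unfold_locales (rule FObj_in_Obj)

lemma FHom_at:
  assumes "S \<in> Obj C" "T \<in> Obj C" "h \<in> Hom C S T"
  shows "x \<in> carrier (FObj M S) \<Longrightarrow> FHom M S T h x \<in> carrier (FObj M T)"
    and "x \<in> carrier (FObj M S) \<Longrightarrow> y \<in> carrier (FObj M S) \<Longrightarrow>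
      FHom M S T h (x \<oplus>\<^bsub>FObj M S\<^esub> y) = FHom M S T h x \<oplus>\<^bsub>FObj M T\<^esub> FHom M S T h y"
    and "x \<in> carrier (FObj M S) \<Longrightarrow> FHom M S T h (c \<odot>\<^bsub>FObj M S\<^esub> x) = c \<odot>\<^bsub>FObj M T\<^esub> FHom M S T h x"
  using Vec_HomD[OF FHom_in_Hom[OF assms]] by auto

lemma FHom_Cmp_at:
  assumes "S \<in> Obj C" "T \<in> Obj C" "U \<in> Obj C" "f \<in> Hom C S T" "g \<in> Hom C T U" "x \<in> carrier (FObj M S)"
  shows "FHom M T U g (FHom M S T f x) = FHom M S U (Cmp C S T U g f) x"
  using assms by (simp add: FHom_Cmp Vec_Cmp)

lemma lin_map_in:
  assumes "S \<in> Obj C" "T \<in> Obj C" "x \<in> carrier (FObj M S)"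
  shows "lin_map C M S T a x \<in> carrier (FObj M T)"
proof -
  interpret vec_obj "FObj M T" by (rule vec_obj_at) fact
  show ?thesis unfolding lin_map_def using assms FHom_at by (intro sum_in) auto
qed

lemma lin_map_add:
  assumes "S \<in> Obj C" "T \<in> Obj C" "x \<in> carrier (FObj M S)" "y \<in> carrier (FObj M S)"
  shows "lin_map C M S T a (x \<oplus>\<^bsub>FObj M S\<^esub> y) = lin_map C M S T a x \<oplus>\<^bsub>FObj M T\<^esub> lin_map C M S T a y"
proof -
  interpret S: vec_obj "FObj M S" by (rule vec_obj_at) fact
  interpret vec_obj "FObj M T" by (rule vec_obj_at) fact
  have "lin_map C M S T a (x \<oplus>\<^bsub>FObj M S\<^esub> y) = (\<Oplus>\<^bsub>FObj M T\<^esub>h \<in> Hom C S T.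
      a h \<odot>\<^bsub>FObj M T\<^esub> FHom M S T h x \<oplus>\<^bsub>FObj M T\<^esub> a h \<odot>\<^bsub>FObj M T\<^esub> FHom M S T h y)"
    unfolding lin_map_def using assms FHom_at by (intro sum_cong) (auto simp: smult_add_right)
  also have "\<dots> = lin_map C M S T a x \<oplus>\<^bsub>FObj M T\<^esub> lin_map C M S T a y"
    unfolding lin_map_def using assms FHom_at by (intro mod.M.finsum_addf) auto
  finally show ?thesis .
qed

lemma lin_map_smult:
  assumes "S \<in> Obj C" "T \<in> Obj C" "x \<in> carrier (FObj M S)"
  shows "lin_map C M S T a (c \<odot>\<^bsub>FObj M S\<^esub> x) = c \<odot>\<^bsub>FObj M T\<^esub> lin_map C M S T a x"
proof -
  interpret vec_obj "FObj M T" by (rule vec_obj_at) fact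
  show ?thesis unfolding lin_map_def using assms FHom_at
    by (subst smult_sum) (auto simp: smult_smult mult.commute intro!: sum_cong)
qed

lemma lin_map_Hom:
  assumes "S \<in> Obj C" "T \<in> Obj C"
  shows "restrict (lin_map C M S T a) (carrier (FObj M S)) \<in> Hom Vec (FObj M S) (FObj M T)"
  using assms by (intro Vec_Hom_restrictI) (simp_all add: lin_map_in lin_map_add lin_map_smult FObj_in_Obj)

lemma lin_map_sum:
  assumes "S \<in> Obj C" "T \<in> Obj C" "\<And>i. i \<in> I \<Longrightarrow> x i \<in> carrier (FObj M S)"
  shows "lin_map C M S T a (finsum (FObj M S) x I) = finsum (FObj M T) (\<lambda>i. lin_map C M S T a (x i)) I"
proof -
  interpret S: vec_obj "FObj M S" by (rule vec_obj_at) fact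
  interpret T: vec_obj "FObj M T" by (rule vec_obj_at) fact
  have "finsum (FObj M S) x I \<in> carrier (FObj M S)" using assms(3) by (rule S.sum_in)
  moreover have "finsum (FObj M T) (\<lambda>i. restrict (lin_map C M S T a) (carrier (FObj M S)) (x i)) I =
     finsum (FObj M T) (\<lambda>i. lin_map C M S T a (x i)) I"
    using assms by (intro T.sum_cong) (auto simp: lin_map_in)
  ultimately show ?thesis
    using Vec_Hom_sum[OF _ _ lin_map_Hom[OF assms(1,2), of a], of I x] assms FObj_in_Obj by simp
qed

lemma lin_map_coeff_sum:
  assumes "S \<in> Obj C" "T \<in> Obj C" "x \<in> carrier (FObj M S)" "finite I"
  shows "lin_map C M S T (\<lambda>h. \<Sum>i\<in>I. c i * a i h) x =
    finsum (FObj M T) (\<lambda>i. c i \<odot>\<^bsub>FObj M T\<^esub> lin_map C M S T (a i) x) I"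
proof -
  interpret vec_obj "FObj M T" by (rule vec_obj_at) fact
  have "lin_map C M S T (\<lambda>h. \<Sum>i\<in>I. c i * a i h) x =
     finsum (FObj M T) (\<lambda>h. finsum (FObj M T) (\<lambda>i. c i \<odot>\<^bsub>FObj M T\<^esub> (a i h \<odot>\<^bsub>FObj M T\<^esub> FHom M S T h x)) I) (Hom C S T)"
    unfolding lin_map_def using assms FHom_at
    by (intro sum_cong) (auto simp: sum_smult smult_smult intro!: sum_in)
  also have "\<dots> = finsum (FObj M T) (\<lambda>i. finsum (FObj M T) (\<lambda>h. c i \<odot>\<^bsub>FObj M T\<^esub> (a i h \<odot>\<^bsub>FObj M T\<^esub> FHom M S T h x)) (Hom C S T)) I"
    using assms FHom_at by (intro sum_swap) auto
  also have "\<dots> = finsum (FObj M T) (\<lambda>i. c i \<odot>\<^bsub>FObj M T\<^esub> lin_map C M S T (a i) x) I"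
    unfolding lin_map_def using assms FHom_at by (intro sum_cong smult_sum[symmetric] smult_in sum_in) auto
  finally show ?thesis .
qed

lemma lin_map_dirac:
  assumes "S \<in> Obj C" "T \<in> Obj C" "x \<in> carrier (FObj M S)" "h \<in> Hom C S T"
  shows "lin_map C M S T (dirac h) x = FHom M S T h x"
proof -
  interpret vec_obj "FObj M T" by (rule vec_obj_at) fact
  have *: "dirac h k = (if k = h then 1 else 0)" for k by (auto simp: dirac_def)
  show ?thesis unfolding lin_map_def * using assms FHom_at finite_Hom
    by (subst sum_delta) auto
qed

lemma lin_map_Idt:
  assumes "S \<in> Obj C" "x \<in> carrier (FObj M S)"
  shows "lin_map C M S S (dirac (Idt C S)) x = x"
  using assms Idt_in_Hom by (simp add: lin_map_dirac FHom_Idt Vec_Idt)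

text \<open>
  Functoriality of the linear extension; expanding both factors in morphisms reduces it to
  functoriality on \<open>C\<close>.
\<close>

lemma lin_map_lin_cmp:
  assumes "S \<in> Obj C" "T \<in> Obj C" "U \<in> Obj C" "x \<in> carrier (FObj M S)"
  shows "lin_map C M S U (lin_cmp C S T U b a) x = lin_map C M T U b (lin_map C M S T a x)"
proof -
  interpret T: vec_obj "FObj M T" by (rule vec_obj_at) fact
  interpret U: vec_obj "FObj M U" by (rule vec_obj_at) fact
  have 1: "lin_map C M S U (dirac (Cmp C S T U g f)) x = FHom M T U g (FHom M S T f x)"
    if "g \<in> Hom C T U" "f \<in> Hom C S T" for g f
    using that assms Cmp_in_Hom by (simp add: lin_map_dirac FHom_Cmp_at)
  have "lin_cmp C S T U b a = (\<lambda>k. \<Sum>gf \<in> Hom C T U \<times> Hom C S T.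
      (b (fst gf) * a (snd gf)) * dirac (Cmp C S T U (fst gf) (snd gf)) k)"
    by (simp add: lin_cmp_def dirac_def sum.cartesian_product case_prod_beta)
  then have "lin_cmp C S T U b a = (\<lambda>k. \<Sum>g \<in> Hom C T U. b g * (\<Sum>f \<in> Hom C S T.
      a f * dirac (Cmp C S T U g f) k))"
    by (simp add: sum.cartesian_product case_prod_beta sum_distrib_left mult.assoc)
  then have "lin_map C M S U (lin_cmp C S T U b a) x =
    finsum (FObj M U) (\<lambda>g. b g \<odot>\<^bsub>FObj M U\<^esub> lin_map C M S U (\<lambda>k. \<Sum>f \<in> Hom C S T.
      a f * dirac (Cmp C S T U g f) k) x) (Hom C T U)"
    using assms finite_Hom by (simp add: lin_map_coeff_sum)
  also have "\<dots> = finsum (FObj M U) (\<lambda>g. b g \<odot>\<^bsub>FObj M U\<^esub> FHom M T U g (lin_map C M S T a x)) (Hom C T U)"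
  proof (rule U.sum_cong)
    fix g assume g: "g \<in> Hom C T U"
    have "lin_map C M S U (\<lambda>k. \<Sum>f \<in> Hom C S T. a f * dirac (Cmp C S T U g f) k) x =
      finsum (FObj M U) (\<lambda>f. a f \<odot>\<^bsub>FObj M U\<^esub> FHom M T U g (FHom M S T f x)) (Hom C S T)"
      using assms g finite_Hom FHom_at by (subst lin_map_coeff_sum) (auto simp: 1 intro!: U.sum_cong)
    also have "\<dots> = finsum (FObj M U) (\<lambda>f. FHom M T U g (a f \<odot>\<^bsub>FObj M T\<^esub> FHom M S T f x)) (Hom C S T)"
      using assms g FHom_at by (intro U.sum_cong) auto
    also have "\<dots> = FHom M T U g (lin_map C M S T a x)"
      unfolding lin_map_def using assms g FHom_at
      by (intro Vec_Hom_sum[symmetric] FObj_in_Obj FHom_in_Hom) auto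
    finally show "b g \<odot>\<^bsub>FObj M U\<^esub> lin_map C M S U (\<lambda>k. \<Sum>f \<in> Hom C S T. a f * dirac (Cmp C S T U g f) k) x =
      b g \<odot>\<^bsub>FObj M U\<^esub> FHom M T U g (lin_map C M S T a x)" by simp
  next
    show "b g \<odot>\<^bsub>FObj M U\<^esub> FHom M T U g (lin_map C M S T a x) \<in> carrier (FObj M U)"
      if "g \<in> Hom C T U" for g
      using that assms lin_map_in FHom_at by auto
  qed
  also have "\<dots> = lin_map C M T U b (lin_map C M S T a x)"
    by (simp add: lin_map_def)
  finally show ?thesis .
qed

end

lemma nat_transD:
  assumes "\<eta> \<in> nat_trans C Vec M M'" "S \<in> Obj C"
  shows "\<eta> S \<in> Hom Vec (FObj M S) (FObj M' S)"
    and "T \<in> Obj C \<Longrightarrow> h \<in> Hom C S T \<Longrightarrow> x \<in> carrier (FObj M S) \<Longrightarrow>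
      \<eta> T (FHom M S T h x) = FHom M' S T h (\<eta> S x)"
proof -
  show "\<eta> S \<in> Hom Vec (FObj M S) (FObj M' S)" using assms by (auto simp: nat_trans_def)
  assume a: "T \<in> Obj C" "h \<in> Hom C S T" "x \<in> carrier (FObj M S)"
  then have "Cmp Vec (FObj M S) (FObj M T) (FObj M' T) (\<eta> T) (FHom M S T h) x =
          Cmp Vec (FObj M S) (FObj M' S) (FObj M' T) (FHom M' S T h) (\<eta> S) x"
    using assms by (simp add: nat_trans_def)
  then show "\<eta> T (FHom M S T h x) = FHom M' S T h (\<eta> S x)"
    using a by (simp add: Vec_Cmp)
qed

lemma nat_transI:
  assumes "category C" "is_functor C Vec M" "is_functor C Vec M'"
    and "\<And>S. S \<in> Obj C \<Longrightarrow> \<eta> S \<in> Hom Vec (FObj M S) (FObj M' S)"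
    and "\<And>S T h x. S \<in> Obj C \<Longrightarrow> T \<in> Obj C \<Longrightarrow> h \<in> Hom C S T \<Longrightarrow> x \<in> carrier (FObj M S) \<Longrightarrow>
      \<eta> T (FHom M S T h x) = FHom M' S T h (\<eta> S x)"
    and "\<eta> \<in> extensional (Obj C)"
  shows "\<eta> \<in> nat_trans C Vec M M'"
proof -
  interpret M: is_functor C Vec M by fact
  interpret M': is_functor C Vec M' by fact
  have "Cmp Vec (FObj M S) (FObj M T) (FObj M' T) (\<eta> T) (FHom M S T h) =
          Cmp Vec (FObj M S) (FObj M' S) (FObj M' T) (FHom M' S T h) (\<eta> S)"
    if "S \<in> Obj C" "T \<in> Obj C" "h \<in> Hom C S T" for S T h
    using that assms(5) by (auto simp: Vec_def compose_def intro!: restrict_ext)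
  then show ?thesis using assms(4,6) by (auto simp: nat_trans_def PiE_def)
qed

lemma nat_trans_lin_map:
  assumes "linear_representation C M" "linear_representation C M'" "\<eta> \<in> nat_trans C Vec M M'"
    and "S \<in> Obj C" "T \<in> Obj C" "x \<in> carrier (FObj M S)"
  shows "\<eta> T (lin_map C M S T a x) = lin_map C M' S T a (\<eta> S x)"
proof -
  interpret M: linear_representation C M by fact
  interpret M': linear_representation C M' by fact
  interpret T: vec_obj "FObj M T" by (rule M.vec_obj_at) fact
  interpret T': vec_obj "FObj M' T" by (rule M'.vec_obj_at) fact
  note \<eta> = nat_transD[OF assms(3)]
  have "\<eta> T (lin_map C M S T a x) =
      finsum (FObj M' T) (\<lambda>h. \<eta> T (a h \<odot>\<^bsub>FObj M T\<^esub> FHom M S T h x)) (Hom C S T)"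
    unfolding lin_map_def using assms \<eta> M.FHom_at
    by (intro Vec_Hom_sum M.FObj_in_Obj M'.FObj_in_Obj) auto
  also have "\<dots> = lin_map C M' S T a (\<eta> S x)"
    unfolding lin_map_def using assms \<eta> M.FHom_at M'.FHom_at Vec_HomD[OF \<eta>(1)]
    by (intro T'.sum_cong) auto
  finally show ?thesis .
qed


section \<open>A Morita criterion\<close>

lemma Vec_subspace_sum:
  assumes "V \<in> Obj Vec" "V\<lparr>carrier := A\<rparr> \<in> Obj Vec" "A \<subseteq> carrier V" "\<And>i. i \<in> I \<Longrightarrow> f i \<in> A"
  shows "finsum (V\<lparr>carrier := A\<rparr>) f I = finsum V f I"
proof -
  interpret V: vec_obj V by unfold_locales fact
  interpret A: vec_obj "V\<lparr>carrier := A\<rparr>" by unfold_locales fact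
  have T: "restrict (\<lambda>x. x) (carrier (V\<lparr>carrier := A\<rparr>)) \<in> Hom Vec (V\<lparr>carrier := A\<rparr>) V"
    using assms by (intro Vec_Hom_restrictI) auto
  have "finsum (V\<lparr>carrier := A\<rparr>) f I \<in> carrier (V\<lparr>carrier := A\<rparr>)"
    using assms by (intro A.sum_in) auto
  moreover have "finsum V (\<lambda>i. restrict (\<lambda>x. x) (carrier (V\<lparr>carrier := A\<rparr>)) (f i)) I = finsum V f I"
    using assms by (intro V.sum_cong) auto
  ultimately show ?thesis
    using Vec_Hom_sum[OF assms(2,1) T, of I f] assms(4) by simp
qed

text \<open>
  Each \<open>j A A (Idt D A)\<close> is an idempotent endomorphism of \<open>u A\<close> in \<open>kC\<close>, hence an object of the
  idempotent completion, and \<open>j\<close> is a functor from \<open>D\<close> to that completion.  By \<open>j_full\<close> and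
  \<open>j_faithful\<close> its linear extension is fully faithful.  The remaining assumptions say that
  \<open>S\<close> is the direct sum, over \<open>p \<in> P S\<close>, of the objects that \<open>j\<close> assigns to \<open>d S p\<close>, with
  projections \<open>\<alpha> S p\<close> and inclusions \<open>\<beta> S p\<close>.
\<close>

locale morita_data =
  C: hom_finite_category C + D: hom_finite_category D
  for C :: "('o1, 'm1) cat" and D :: "('o2, 'm2) cat" +
  fixes u :: "'o2 \<Rightarrow> 'o1" and j :: "'o2 \<Rightarrow> 'o2 \<Rightarrow> 'm2 \<Rightarrow> 'm1 \<Rightarrow> 'k::field"
    and P :: "'o1 \<Rightarrow> 'p set" and d :: "'o1 \<Rightarrow> 'p \<Rightarrow> 'o2"
    and \<alpha> \<beta> :: "'o1 \<Rightarrow> 'p \<Rightarrow> 'm1 \<Rightarrow> 'k"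
  assumes u_in: "A \<in> Obj D \<Longrightarrow> u A \<in> Obj C"
    and j_in: "A \<in> Obj D \<Longrightarrow> B \<in> Obj D \<Longrightarrow> \<phi> \<in> Hom D A B \<Longrightarrow> j A B \<phi> \<in> lin_hom C (u A) (u B)"
    and j_Cmp: "A \<in> Obj D \<Longrightarrow> B \<in> Obj D \<Longrightarrow> E \<in> Obj D \<Longrightarrow> \<phi> \<in> Hom D A B \<Longrightarrow> \<psi> \<in> Hom D B E \<Longrightarrow>
      j A E (Cmp D A B E \<psi> \<phi>) = lin_cmp C (u A) (u B) (u E) (j B E \<psi>) (j A B \<phi>)"
    and j_full: "A \<in> Obj D \<Longrightarrow> B \<in> Obj D \<Longrightarrow> h \<in> Hom C (u A) (u B) \<Longrightarrow>
      \<exists>c. lin_cmp C (u A) (u B) (u B) (j B B (Idt D B))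
            (lin_cmp C (u A) (u A) (u B) (dirac h) (j A A (Idt D A)))
          = (\<lambda>k. \<Sum>\<phi> \<in> Hom D A B. c \<phi> * j A B \<phi> k)"
    and j_faithful: "A \<in> Obj D \<Longrightarrow> B \<in> Obj D \<Longrightarrow> (\<lambda>k. \<Sum>\<phi> \<in> Hom D A B. c \<phi> * j A B \<phi> k) = (\<lambda>k. 0) \<Longrightarrow>
      \<phi> \<in> Hom D A B \<Longrightarrow> c \<phi> = 0"
    and finite_P: "S \<in> Obj C \<Longrightarrow> finite (P S)"
    and d_in: "S \<in> Obj C \<Longrightarrow> p \<in> P S \<Longrightarrow> d S p \<in> Obj D"
    and \<alpha>_in: "S \<in> Obj C \<Longrightarrow> p \<in> P S \<Longrightarrow> \<alpha> S p \<in> lin_hom C S (u (d S p))"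
    and \<beta>_in: "S \<in> Obj C \<Longrightarrow> p \<in> P S \<Longrightarrow> \<beta> S p \<in> lin_hom C (u (d S p)) S"
    and e_\<alpha>: "S \<in> Obj C \<Longrightarrow> p \<in> P S \<Longrightarrow>
      lin_cmp C S (u (d S p)) (u (d S p)) (j (d S p) (d S p) (Idt D (d S p))) (\<alpha> S p) = \<alpha> S p"
    and \<beta>_e: "S \<in> Obj C \<Longrightarrow> p \<in> P S \<Longrightarrow>
      lin_cmp C (u (d S p)) (u (d S p)) S (\<beta> S p) (j (d S p) (d S p) (Idt D (d S p))) = \<beta> S p"
    and \<alpha>_\<beta>_same: "S \<in> Obj C \<Longrightarrow> p \<in> P S \<Longrightarrow>
      lin_cmp C (u (d S p)) S (u (d S p)) (\<alpha> S p) (\<beta> S p) = j (d S p) (d S p) (Idt D (d S p))"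
    and \<alpha>_\<beta>_diff: "S \<in> Obj C \<Longrightarrow> p \<in> P S \<Longrightarrow> q \<in> P S \<Longrightarrow> p \<noteq> q \<Longrightarrow>
      lin_cmp C (u (d S p)) S (u (d S q)) (\<alpha> S q) (\<beta> S p) = (\<lambda>k. 0)"
    and \<beta>_\<alpha>: "S \<in> Obj C \<Longrightarrow>
      (\<lambda>k. \<Sum>p\<in>P S. lin_cmp C S (u (d S p)) S (\<beta> S p) (\<alpha> S p) k) = dirac (Idt C S)"
begin

abbreviation e :: "'o2 \<Rightarrow> 'm1 \<Rightarrow> 'k" where
  "e A \<equiv> j A A (Idt D A)"

text \<open>
  The Hom-sets of the idempotent completion.
\<close>

definition corner :: "'o2 \<Rightarrow> 'o2 \<Rightarrow> ('m1 \<Rightarrow> 'k) set" where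
  "corner A B = {a \<in> lin_hom C (u A) (u B).
     lin_cmp C (u A) (u B) (u B) (e B) a = a \<and> lin_cmp C (u A) (u A) (u B) a (e A) = a}"

text \<open>
  The linear extension of \<open>j\<close> and, on corners, its inverse \<open>\<Gamma>\<close>.
\<close>

definition J :: "'o2 \<Rightarrow> 'o2 \<Rightarrow> ('m2 \<Rightarrow> 'k) \<Rightarrow> 'm1 \<Rightarrow> 'k" where
  "J A B c = (\<lambda>k. \<Sum>\<phi> \<in> Hom D A B. c \<phi> * j A B \<phi> k)"

definition \<Gamma> :: "'o2 \<Rightarrow> 'o2 \<Rightarrow> ('m1 \<Rightarrow> 'k) \<Rightarrow> 'm2 \<Rightarrow> 'k" where
  "\<Gamma> A B a = (THE c. c \<in> lin_hom D A B \<and> J A B c = a)"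

lemma e_in: "A \<in> Obj D \<Longrightarrow> e A \<in> lin_hom C (u A) (u A)"
  by (simp add: j_in D.Idt_in_Hom)

lemma e_idem: "A \<in> Obj D \<Longrightarrow> lin_cmp C (u A) (u A) (u A) (e A) (e A) = e A"
  using j_Cmp[of A A A "Idt D A" "Idt D A"] by (simp add: D.Idt_in_Hom D.Cmp_Idt_left)

lemma j_e:
  assumes "A \<in> Obj D" "B \<in> Obj D" "\<phi> \<in> Hom D A B"
  shows "lin_cmp C (u A) (u B) (u B) (e B) (j A B \<phi>) = j A B \<phi>"
    and "lin_cmp C (u A) (u A) (u B) (j A B \<phi>) (e A) = j A B \<phi>"
  using assms j_Cmp[of A B B \<phi> "Idt D B"] j_Cmp[of A A B "Idt D A" \<phi>]
  by (simp_all add: D.Idt_in_Hom D.Cmp_Idt_left D.Cmp_Idt_right)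

lemma j_corner: "A \<in> Obj D \<Longrightarrow> B \<in> Obj D \<Longrightarrow> \<phi> \<in> Hom D A B \<Longrightarrow> j A B \<phi> \<in> corner A B"
  by (simp add: corner_def j_in j_e)

lemma cornerI:
  assumes "A \<in> Obj D" "B \<in> Obj D" "S \<in> Obj C"
    and "lin_cmp C S (u B) (u B) (e B) b = b" "lin_cmp C (u A) (u A) S a (e A) = a"
  shows "lin_cmp C (u A) S (u B) b a \<in> corner A B"
  using assms u_in by (simp add: corner_def C.lin_cmp_in C.lin_cmp_assoc)
    (simp flip: C.lin_cmp_assoc)

lemma corner_sum:
  assumes "\<And>i. i \<in> I \<Longrightarrow> a i \<in> corner A B"
  shows "(\<lambda>k. \<Sum>i\<in>I. c i * a i k) \<in> corner A B"
  using assms by (auto simp: corner_def lin_cmp_sum_left lin_cmp_sum_right intro!: lin_hom_sum)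

lemma J_corner: "A \<in> Obj D \<Longrightarrow> B \<in> Obj D \<Longrightarrow> J A B c \<in> corner A B"
  unfolding J_def by (intro corner_sum j_corner)

lemma J_inj:
  assumes "A \<in> Obj D" "B \<in> Obj D" "c \<in> lin_hom D A B" "c' \<in> lin_hom D A B" "J A B c = J A B c'"
  shows "c = c'"
proof
  fix \<phi>
  have "(\<lambda>k. \<Sum>\<phi> \<in> Hom D A B. (c \<phi> - c' \<phi>) * j A B \<phi> k) = (\<lambda>k. 0)"
    using assms(5) by (simp add: J_def left_diff_distrib sum_subtractf fun_eq_iff)
  then show "c \<phi> = c' \<phi>"
    using j_faithful[of A B "\<lambda>\<phi>. c \<phi> - c' \<phi>" \<phi>] assms by (cases "\<phi> \<in> Hom D A B") (auto simp: lin_hom_def)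
qed

text \<open>
  Since \<open>a = e a e\<close>, expanding the inner \<open>a\<close> in morphisms of \<open>C\<close> writes \<open>a\<close> as a combination of
  sandwiched morphisms, to which fullness applies.
\<close>

lemma J_surj:
  assumes A: "A \<in> Obj D" "B \<in> Obj D" "a \<in> corner A B"
  shows "\<exists>c \<in> lin_hom D A B. J A B c = a"
proof -
  have "\<forall>h \<in> Hom C (u A) (u B). \<exists>c. lin_cmp C (u A) (u B) (u B) (e B) (lin_cmp C (u A) (u A) (u B) (dirac h) (e A))
      = (\<lambda>k. \<Sum>\<phi> \<in> Hom D A B. c \<phi> * j A B \<phi> k)"
    using j_full A by blast
  then obtain c where c: "\<And>h. h \<in> Hom C (u A) (u B) \<Longrightarrow>
      lin_cmp C (u A) (u B) (u B) (e B) (lin_cmp C (u A) (u A) (u B) (dirac h) (e A))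
      = (\<lambda>k. \<Sum>\<phi> \<in> Hom D A B. c h \<phi> * j A B \<phi> k)"
    unfolding bchoice_iff by blast
  define c' where "c' \<phi> = (if \<phi> \<in> Hom D A B then \<Sum>h \<in> Hom C (u A) (u B). a h * c h \<phi> else 0)" for \<phi>
  have a: "(\<lambda>k. \<Sum>h \<in> Hom C (u A) (u B). a h * dirac h k) = a"
    using A u_in by (intro C.lin_hom_expand) (auto simp: corner_def)
  have "a = lin_cmp C (u A) (u B) (u B) (e B) (lin_cmp C (u A) (u A) (u B) a (e A))"
    using A by (simp add: corner_def)
  also have "\<dots> = (\<lambda>k. \<Sum>h \<in> Hom C (u A) (u B). a h *
      lin_cmp C (u A) (u B) (u B) (e B) (lin_cmp C (u A) (u A) (u B) (dirac h) (e A)) k)"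
    by (subst a[symmetric]) (simp only: lin_cmp_sum_left lin_cmp_sum_right)
  also have "\<dots> = (\<lambda>k. \<Sum>h \<in> Hom C (u A) (u B). a h * (\<Sum>\<phi> \<in> Hom D A B. c h \<phi> * j A B \<phi> k))"
    by (intro ext sum.cong refl) (simp add: c)
  also have "\<dots> = (\<lambda>k. \<Sum>\<phi> \<in> Hom D A B. c' \<phi> * j A B \<phi> k)"
    by (intro ext, simp add: c'_def sum_distrib_left sum_distrib_right mult.assoc, rule sum.swap)
  finally have "J A B c' = a" by (simp add: J_def)
  moreover have "c' \<in> lin_hom D A B" by (simp add: lin_hom_def c'_def)
  ultimately show ?thesis by blast
qed

lemma \<Gamma>:
  assumes "A \<in> Obj D" "B \<in> Obj D" "a \<in> corner A B"
  shows "\<Gamma> A B a \<in> lin_hom D A B" "J A B (\<Gamma> A B a) = a"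
proof -
  have "\<exists>!c. c \<in> lin_hom D A B \<and> J A B c = a"
    using J_surj[OF assms] J_inj[OF assms(1,2)] by blast
  from theI'[OF this] show "\<Gamma> A B a \<in> lin_hom D A B" "J A B (\<Gamma> A B a) = a"
    unfolding \<Gamma>_def by blast+
qed

lemma \<Gamma>_eqI:
  assumes "A \<in> Obj D" "B \<in> Obj D" "c \<in> lin_hom D A B" "J A B c = a"
  shows "\<Gamma> A B a = c"
  using assms \<Gamma>[of A B a] J_corner[of A B c] J_inj by blast

lemma \<Gamma>_j:
  assumes "A \<in> Obj D" "B \<in> Obj D" "\<phi> \<in> Hom D A B"
  shows "\<Gamma> A B (j A B \<phi>) = dirac \<phi>"
  using assms D.finite_Hom
  by (intro \<Gamma>_eqI D.dirac_in) (auto simp: J_def dirac_def sum_kronecker)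

lemma \<Gamma>_sum:
  assumes "A \<in> Obj D" "B \<in> Obj D" "\<And>i. i \<in> I \<Longrightarrow> a i \<in> corner A B"
  shows "\<Gamma> A B (\<lambda>k. \<Sum>i\<in>I. c i * a i k) = (\<lambda>k. \<Sum>i\<in>I. c i * \<Gamma> A B (a i) k)"
proof (rule \<Gamma>_eqI)
  have "J A B (\<lambda>k. \<Sum>i\<in>I. c i * \<Gamma> A B (a i) k) = (\<lambda>k. \<Sum>i\<in>I. c i * J A B (\<Gamma> A B (a i)) k)"
    unfolding J_def by (intro ext, simp add: sum_distrib_left sum_distrib_right mult.assoc, rule sum.swap)
  also have "\<dots> = (\<lambda>k. \<Sum>i\<in>I. c i * a i k)"
    using assms by (intro ext sum.cong refl) (simp add: \<Gamma>)
  finally show "J A B (\<lambda>k. \<Sum>i\<in>I. c i * \<Gamma> A B (a i) k) = (\<lambda>k. \<Sum>i\<in>I. c i * a i k)" .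
qed (use assms \<Gamma> in \<open>auto intro!: lin_hom_sum\<close>)

lemma J_cmp:
  assumes "A \<in> Obj D" "B \<in> Obj D" "E \<in> Obj D"
  shows "J A E (lin_cmp D A B E c' c) = lin_cmp C (u A) (u B) (u E) (J B E c') (J A B c)"
proof
  fix k
  have "J A E (lin_cmp D A B E c' c) k =
    (\<Sum>\<psi> \<in> Hom D B E. \<Sum>\<phi> \<in> Hom D A B. c' \<psi> * c \<phi> * j A E (Cmp D A B E \<psi> \<phi>) k)"
    using assms by (simp add: J_def D.sum_lin_cmp)
  also have "\<dots> = (\<Sum>\<psi> \<in> Hom D B E. \<Sum>\<phi> \<in> Hom D A B. c' \<psi> * (c \<phi> *
      lin_cmp C (u A) (u B) (u E) (j B E \<psi>) (j A B \<phi>) k))"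
    using assms by (intro sum.cong refl) (simp add: j_Cmp)
  also have "\<dots> = lin_cmp C (u A) (u B) (u E) (J B E c') (J A B c) k"
    by (simp add: J_def lin_cmp_sum_left lin_cmp_sum_right sum_distrib_left)
  finally show "J A E (lin_cmp D A B E c' c) k = lin_cmp C (u A) (u B) (u E) (J B E c') (J A B c) k" .
qed

lemma corner_cmp:
  assumes "A \<in> Obj D" "B \<in> Obj D" "E \<in> Obj D" "a \<in> corner A B" "b \<in> corner B E"
  shows "lin_cmp C (u A) (u B) (u E) b a \<in> corner A E"
  using assms u_in by (intro cornerI) (auto simp: corner_def)

lemma \<Gamma>_cmp:
  assumes "A \<in> Obj D" "B \<in> Obj D" "E \<in> Obj D" "a \<in> corner A B" "b \<in> corner B E"
  shows "\<Gamma> A E (lin_cmp C (u A) (u B) (u E) b a) = lin_cmp D A B E (\<Gamma> B E b) (\<Gamma> A B a)"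
  using assms by (intro \<Gamma>_eqI) (simp_all add: J_cmp \<Gamma> D.lin_cmp_in)

text \<open>
  A composite through \<open>S\<close> is a matrix product over the summands of \<open>S\<close>, because the identity of \<open>S\<close>
  may be inserted in the form \<open>\<beta>_\<alpha>\<close>.
\<close>

lemma insert_identity:
  assumes "R \<in> Obj C" "S \<in> Obj C" "T \<in> Obj C" "a \<in> lin_hom C S T"
  shows "(\<lambda>k. \<Sum>p\<in>P S. lin_cmp C R (u (d S p)) T (lin_cmp C (u (d S p)) S T a (\<beta> S p))
      (lin_cmp C R S (u (d S p)) (\<alpha> S p) b) k) = lin_cmp C R S T a b"
proof -
  have "lin_cmp C R S T a b = lin_cmp C R S T (lin_cmp C S S T a (dirac (Idt C S))) b"
    using assms by (simp add: C.lin_cmp_dirac_right)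
  also have "\<dots> = lin_cmp C R S T (lin_cmp C S S T a
      (\<lambda>k. \<Sum>p\<in>P S. 1 * lin_cmp C S (u (d S p)) S (\<beta> S p) (\<alpha> S p) k)) b"
    using assms by (simp add: \<beta>_\<alpha>)
  also have "\<dots> = (\<lambda>k. \<Sum>p\<in>P S. 1 * lin_cmp C R S T (lin_cmp C S S T a
      (lin_cmp C S (u (d S p)) S (\<beta> S p) (\<alpha> S p))) b k)"
    by (simp only: lin_cmp_sum_left lin_cmp_sum_right)
  also have "\<dots> = (\<lambda>k. \<Sum>p\<in>P S. lin_cmp C R (u (d S p)) T (lin_cmp C (u (d S p)) S T a (\<beta> S p))
      (lin_cmp C R S (u (d S p)) (\<alpha> S p) b) k)"
    using assms u_in d_in by (intro ext sum.cong refl) (simp add: C.lin_cmp_assoc)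
  finally show ?thesis by simp
qed

end

section \<open>The corner functor\<close>

locale morita_rep = morita_data C D u j P d \<alpha> \<beta> + M: linear_representation C M
  for C :: "('o1, 'm1) cat" and D :: "('o2, 'm2) cat"
    and u :: "'o2 \<Rightarrow> 'o1" and j :: "'o2 \<Rightarrow> 'o2 \<Rightarrow> 'm2 \<Rightarrow> 'm1 \<Rightarrow> 'k::field"
    and P :: "'o1 \<Rightarrow> 'p set" and d :: "'o1 \<Rightarrow> 'p \<Rightarrow> 'o2"
    and \<alpha> \<beta> :: "'o1 \<Rightarrow> 'p \<Rightarrow> 'm1 \<Rightarrow> 'k" and M :: "('o1, 'm1, ('k, 'v) module, 'v \<Rightarrow> 'v) ftor"

context morita_data
begin

text \<open>
  The projections and inclusions of the summands of a representation evaluated at \<open>S\<close>.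
\<close>

abbreviation to_part :: "('o1, 'm1, ('k, 'v) module, 'v \<Rightarrow> 'v) ftor \<Rightarrow> 'o1 \<Rightarrow> 'p \<Rightarrow> 'v \<Rightarrow> 'v" where
  "to_part M S p \<equiv> lin_map C M S (u (d S p)) (\<alpha> S p)"

abbreviation of_part :: "('o1, 'm1, ('k, 'v) module, 'v \<Rightarrow> 'v) ftor \<Rightarrow> 'o1 \<Rightarrow> 'p \<Rightarrow> 'v \<Rightarrow> 'v" where
  "of_part M S p \<equiv> lin_map C M (u (d S p)) S (\<beta> S p)"

text \<open>
  The image of an idempotent is its set of fixed points.
\<close>

definition fixed :: "('o1, 'm1, ('k, 'v) module, 'v \<Rightarrow> 'v) ftor \<Rightarrow> 'o2 \<Rightarrow> 'v set" where
  "fixed M A = {x \<in> carrier (FObj M (u A)). lin_map C M (u A) (u A) (e A) x = x}"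

definition corner_rep ::
  "('o1, 'm1, ('k, 'v) module, 'v \<Rightarrow> 'v) ftor \<Rightarrow> ('o2, 'm2, ('k, 'v) module, 'v \<Rightarrow> 'v) ftor" where
  "corner_rep M = \<lparr>FObj = (\<lambda>A. (FObj M (u A))\<lparr>carrier := fixed M A\<rparr>),
     FHom = (\<lambda>A B \<phi>. restrict (lin_map C M (u A) (u B) (j A B \<phi>)) (fixed M A))\<rparr>"

definition corner_ftor where
  "corner_ftor = \<lparr>FObj = corner_rep,
     FHom = (\<lambda>M M' \<eta>. \<lambda>A \<in> Obj D. restrict (\<eta> (u A)) (fixed M A))\<rparr>"

lemma morita_repI: "is_functor C Vec M \<Longrightarrow> morita_rep C D u j P d \<alpha> \<beta> M"
  by (intro morita_rep.intro linear_representation.intro morita_data_axioms C.hom_finite_category_axioms)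

end

context morita_rep
begin

lemma fixed_subset: "fixed M A \<subseteq> carrier (FObj M (u A))"
  by (auto simp: fixed_def)

lemma fixed_in: "x \<in> fixed M A \<Longrightarrow> x \<in> carrier (FObj M (u A))"
  by (simp add: fixed_def)

lemma lin_map_fixed:
  assumes "S \<in> Obj C" "B \<in> Obj D" "x \<in> carrier (FObj M S)" "lin_cmp C S (u B) (u B) (e B) b = b"
  shows "lin_map C M S (u B) b x \<in> fixed M B"
  using assms M.lin_map_lin_cmp[of S "u B" "u B" x "e B" b] u_in by (simp add: fixed_def M.lin_map_in)

lemma corner_Obj:
  assumes "A \<in> Obj D"
  shows "FObj (corner_rep M) A \<in> Obj Vec"
proof -
  interpret V: vec_obj "FObj M (u A)" using u_in assms by (intro M.vec_obj_at)
  have "lin_map C M (u A) (u A) (e A) \<zero>\<^bsub>FObj M (u A)\<^esub> = \<zero>\<^bsub>FObj M (u A)\<^esub>"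
    using M.lin_map_smult[of "u A" "u A" "\<zero>\<^bsub>FObj M (u A)\<^esub>" "e A" 0] assms u_in
    by (simp add: M.lin_map_in)
  then show ?thesis
    using assms u_in unfolding corner_rep_def fixed_def
    by (simp, intro V.subspace_in_Vec) (auto simp: M.lin_map_add M.lin_map_smult)
qed

lemma corner_carrier [simp]: "carrier (FObj (corner_rep M) A) = fixed M A"
  by (simp add: corner_rep_def)

lemma corner_add [simp]: "x \<oplus>\<^bsub>FObj (corner_rep M) A\<^esub> y = x \<oplus>\<^bsub>FObj M (u A)\<^esub> y"
  by (simp add: corner_rep_def)

lemma corner_smult [simp]: "c \<odot>\<^bsub>FObj (corner_rep M) A\<^esub> y = c \<odot>\<^bsub>FObj M (u A)\<^esub> y"
  by (simp add: corner_rep_def)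

lemma corner_finsum:
  "A \<in> Obj D \<Longrightarrow> (\<And>i. i \<in> I \<Longrightarrow> f i \<in> fixed M A) \<Longrightarrow>
    finsum (FObj (corner_rep M) A) f I = finsum (FObj M (u A)) f I"
  using corner_Obj[of A] fixed_subset u_in M.FObj_in_Obj unfolding corner_rep_def
  by (simp, intro Vec_subspace_sum) auto

lemma corner_FHom:
  "x \<in> fixed M A \<Longrightarrow> FHom (corner_rep M) A B \<phi> x = lin_map C M (u A) (u B) (j A B \<phi>) x"
  by (simp add: corner_rep_def)

lemma is_functor_corner: "is_functor D Vec (corner_rep M)"
proof
  show "FObj (corner_rep M) A \<in> Obj Vec" if "A \<in> Obj D" for A
    using that by (rule corner_Obj)
  show FH: "FHom (corner_rep M) A B \<phi> \<in> Hom Vec (FObj (corner_rep M) A) (FObj (corner_rep M) B)"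
    if a: "A \<in> Obj D" "B \<in> Obj D" "\<phi> \<in> Hom D A B" for A B \<phi>
  proof -
    have "FHom (corner_rep M) A B \<phi> = restrict (lin_map C M (u A) (u B) (j A B \<phi>)) (carrier (FObj (corner_rep M) A))"
      by (simp add: corner_rep_def)
    also have "\<dots> \<in> Hom Vec (FObj (corner_rep M) A) (FObj (corner_rep M) B)"
      using a u_in
      by (intro Vec_Hom_restrictI corner_Obj)
        (auto simp: fixed_in M.lin_map_add M.lin_map_smult j_e intro!: lin_map_fixed)
    finally show ?thesis .
  qed
  show "FHom (corner_rep M) A A (Idt D A) = Idt Vec (FObj (corner_rep M) A)" if "A \<in> Obj D" for A
    by (rule Vec_Hom_eqI[OF FH M.cod.Idt_in_Hom])
      (use that corner_Obj D.Idt_in_Hom in \<open>auto simp: corner_FHom Vec_Idt fixed_def\<close>)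
  show "FHom (corner_rep M) A E (Cmp D A B E \<psi> \<phi>) =
            Cmp Vec (FObj (corner_rep M) A) (FObj (corner_rep M) B) (FObj (corner_rep M) E)
              (FHom (corner_rep M) B E \<psi>) (FHom (corner_rep M) A B \<phi>)"
    if a: "A \<in> Obj D" "B \<in> Obj D" "E \<in> Obj D" "\<phi> \<in> Hom D A B" "\<psi> \<in> Hom D B E" for A B E \<phi> \<psi>
  proof (rule Vec_Hom_eqI[OF FH M.cod.Cmp_in_Hom])
    fix x assume "x \<in> carrier (FObj (corner_rep M) A)"
    then have x: "x \<in> fixed M A" by simp
    have "lin_map C M (u A) (u B) (j A B \<phi>) x \<in> fixed M B"
      using a x u_in by (intro lin_map_fixed) (auto simp: j_e fixed_in)
    then show "FHom (corner_rep M) A E (Cmp D A B E \<psi> \<phi>) x =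
            Cmp Vec (FObj (corner_rep M) A) (FObj (corner_rep M) B) (FObj (corner_rep M) E)
              (FHom (corner_rep M) B E \<psi>) (FHom (corner_rep M) A B \<phi>) x"
      using a x u_in by (simp add: Vec_Cmp corner_FHom j_Cmp M.lin_map_lin_cmp fixed_in)
  qed (use a corner_Obj FH D.Cmp_in_Hom in auto)
qed

lemma decompose:
  assumes "S \<in> Obj C" "x \<in> carrier (FObj M S)"
  shows "finsum (FObj M S) (\<lambda>p. of_part M S p
      (to_part M S p x)) (P S) = x"
proof -
  interpret vec_obj "FObj M S" using assms by (intro M.vec_obj_at)
  have "x = lin_map C M S S (\<lambda>k. \<Sum>p\<in>P S. 1 * lin_cmp C S (u (d S p)) S (\<beta> S p) (\<alpha> S p) k) x"
    using assms by (simp add: \<beta>_\<alpha> M.lin_map_Idt)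
  also have "\<dots> = finsum (FObj M S) (\<lambda>p. of_part M S p
      (to_part M S p x)) (P S)"
    using assms finite_P u_in d_in
    by (subst M.lin_map_coeff_sum) (auto simp: M.lin_map_lin_cmp M.lin_map_in intro!: sum_cong)
  finally show ?thesis by simp
qed

end


context morita_data
begin

lemma is_functor_corner_ftor:
  "is_functor (functor_cat C Vec) (functor_cat D Vec)
     (corner_ftor :: (('o1, 'm1, ('k, 'v) module, 'v \<Rightarrow> 'v) ftor, _, _, _) ftor)"
proof (intro is_functor.intro is_functor_axioms.intro category_functor_cat category_Vec
    C.category_axioms D.category_axioms)
  fix M :: "('o1, 'm1, ('k, 'v) module, 'v \<Rightarrow> 'v) ftor"
  assume "M \<in> Obj (functor_cat C Vec)"
  then interpret M: morita_rep C D u j P d \<alpha> \<beta> M by (intro morita_repI) (simp add: functor_cat_def)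
  show "FObj corner_ftor M \<in> Obj (functor_cat D Vec)"
    by (simp add: functor_cat_def corner_ftor_def M.is_functor_corner)
  show "FHom corner_ftor M M (Idt (functor_cat C Vec) M) = Idt (functor_cat D Vec) (FObj corner_ftor M)"
    using u_in by (auto simp: corner_ftor_def functor_cat_def Vec_def fixed_def fun_eq_iff corner_rep_def)
  fix M' :: "('o1, 'm1, ('k, 'v) module, 'v \<Rightarrow> 'v) ftor"
  assume "M' \<in> Obj (functor_cat C Vec)"
  then interpret M': morita_rep C D u j P d \<alpha> \<beta> M' by (intro morita_repI) (simp add: functor_cat_def)
  have nat_fixed: "\<eta> (u A) x \<in> fixed M' A" if "\<eta> \<in> nat_trans C Vec M M'" "A \<in> Obj D" "x \<in> fixed M A" for \<eta> A x
    using that u_in nat_transD(1)[OF that(1), THEN Vec_HomD(1)]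
      nat_trans_lin_map[OF M.M.linear_representation_axioms M'.M.linear_representation_axioms that(1), of "u A" "u A" x "e A"]
    by (auto simp: fixed_def)
  fix \<eta> assume "\<eta> \<in> Hom (functor_cat C Vec) M M'"
  then have \<eta>: "\<eta> \<in> nat_trans C Vec M M'" by (simp add: functor_cat_def)
  have "FHom corner_ftor M M' \<eta> \<in> nat_trans D Vec (corner_rep M) (corner_rep M')"
  proof (rule nat_transI[OF D.category_axioms M.is_functor_corner M'.is_functor_corner])
    show "FHom corner_ftor M M' \<eta> A \<in> Hom Vec (FObj (corner_rep M) A) (FObj (corner_rep M') A)"
      if A: "A \<in> Obj D" for A
      using A Vec_Hom_restrictI[of "FObj (corner_rep M) A" "\<eta> (u A)" "FObj (corner_rep M') A"]
        nat_fixed[OF \<eta> A] Vec_HomD[OF nat_transD(1)[OF \<eta> u_in[OF A]]] M.corner_Obj[OF A]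
      by (simp add: corner_ftor_def M.fixed_in)
    show "FHom corner_ftor M M' \<eta> B (FHom (corner_rep M) A B \<phi> x) =
        FHom (corner_rep M') A B \<phi> (FHom corner_ftor M M' \<eta> A x)"
      if "A \<in> Obj D" "B \<in> Obj D" "\<phi> \<in> Hom D A B" "x \<in> carrier (FObj (corner_rep M) A)" for A B \<phi> x
      using that u_in nat_fixed[OF \<eta>] M.lin_map_fixed
        nat_trans_lin_map[OF M.M.linear_representation_axioms M'.M.linear_representation_axioms \<eta>]
      by (simp add: corner_ftor_def M.corner_FHom M'.corner_FHom M.fixed_in j_e)
  qed (simp add: corner_ftor_def)
  then show "FHom corner_ftor M M' \<eta> \<in>
      Hom (functor_cat D Vec) (FObj corner_ftor M) (FObj corner_ftor M')"
    by (simp add: functor_cat_def corner_ftor_def)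
  fix M'' :: "('o1, 'm1, ('k, 'v) module, 'v \<Rightarrow> 'v) ftor"
  fix \<eta>' assume "\<eta>' \<in> Hom (functor_cat C Vec) M' M''"
  then have \<eta>': "\<eta>' \<in> nat_trans C Vec M' M''" by (simp add: functor_cat_def)
  show "FHom corner_ftor M M'' (Cmp (functor_cat C Vec) M M' M'' \<eta>' \<eta>) =
    Cmp (functor_cat D Vec) (FObj corner_ftor M) (FObj corner_ftor M') (FObj corner_ftor M'')
      (FHom corner_ftor M' M'' \<eta>') (FHom corner_ftor M M' \<eta>)"
    using u_in nat_fixed[OF \<eta>]
    by (auto simp: corner_ftor_def functor_cat_def corner_rep_def Vec_def compose_def fun_eq_iff M.fixed_in)
qed

text \<open>
  The elements \<open>j A B \<phi>\<close> span the corner, so naturality with respect to the morphisms of \<open>D\<close> extends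
  to all of it by linearity.
\<close>

lemma nat_trans_corner:
  assumes "morita_rep C D u j P d \<alpha> \<beta> M" "morita_rep C D u j P d \<alpha> \<beta> M'"
    and \<theta>: "\<theta> \<in> nat_trans D Vec (corner_rep M) (corner_rep M')"
    and A: "A \<in> Obj D" "B \<in> Obj D" "a \<in> corner A B" "x \<in> fixed M A"
  shows "\<theta> B (lin_map C M (u A) (u B) a x) = lin_map C M' (u A) (u B) a (\<theta> A x)"
proof -
  interpret M: morita_rep C D u j P d \<alpha> \<beta> M by fact
  interpret M': morita_rep C D u j P d \<alpha> \<beta> M' by fact
  interpret V: vec_obj "FObj M (u B)" using u_in A by (intro M.M.vec_obj_at)
  interpret V': vec_obj "FObj M' (u B)" using u_in A by (intro M'.M.vec_obj_at)
  define c where "c = \<Gamma> A B a"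
  have a: "a = (\<lambda>k. \<Sum>\<phi> \<in> Hom D A B. c \<phi> * j A B \<phi> k)"
    using \<Gamma>(2)[OF A(1-3)] by (simp add: c_def J_def)
  note th = nat_transD[OF \<theta>]
  have \<theta>x: "\<theta> A x \<in> fixed M' A" using Vec_HomD(1)[OF th(1)[OF A(1)]] A(4) by simp
  have jx: "lin_map C M (u A) (u B) (j A B \<phi>) x \<in> fixed M B" if "\<phi> \<in> Hom D A B" for \<phi>
    using A that u_in by (intro M.lin_map_fixed) (auto simp: j_e M.fixed_in)
  have jx': "c \<phi> \<odot>\<^bsub>FObj M (u B)\<^esub> lin_map C M (u A) (u B) (j A B \<phi>) x \<in> fixed M B" if "\<phi> \<in> Hom D A B" for \<phi>
  proof -
    interpret W: vec_obj "FObj (corner_rep M) B" by unfold_locales (use A M.corner_Obj in auto)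
    show ?thesis using W.smult_in[of _ "c \<phi>"] jx[OF that] by simp
  qed
  have "\<theta> B (lin_map C M (u A) (u B) a x) =
      \<theta> B (finsum (FObj (corner_rep M) B) (\<lambda>\<phi>. c \<phi> \<odot>\<^bsub>FObj M (u B)\<^esub> lin_map C M (u A) (u B) (j A B \<phi>) x) (Hom D A B))"
    unfolding a using A u_in jx' D.finite_Hom
    by (subst M.M.lin_map_coeff_sum) (auto simp: M.fixed_in M.corner_finsum)
  also have "\<dots> = finsum (FObj (corner_rep M') B) (\<lambda>\<phi>. \<theta> B (c \<phi> \<odot>\<^bsub>FObj M (u B)\<^esub> lin_map C M (u A) (u B) (j A B \<phi>) x)) (Hom D A B)"
    using A jx' by (intro Vec_Hom_sum[OF M.corner_Obj M'.corner_Obj th(1)]) auto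
  also have "\<dots> = finsum (FObj M' (u B)) (\<lambda>\<phi>. \<theta> B (c \<phi> \<odot>\<^bsub>FObj M (u B)\<^esub> lin_map C M (u A) (u B) (j A B \<phi>) x)) (Hom D A B)"
    using A jx' Vec_HomD(1)[OF th(1)[OF A(2)]] by (intro M'.corner_finsum) auto
  also have "\<dots> = finsum (FObj M' (u B)) (\<lambda>\<phi>. c \<phi> \<odot>\<^bsub>FObj M' (u B)\<^esub> lin_map C M' (u A) (u B) (j A B \<phi>) (\<theta> A x)) (Hom D A B)"
  proof (rule V'.sum_cong)
    fix \<phi> assume \<phi>: "\<phi> \<in> Hom D A B"
    have "\<theta> B (c \<phi> \<odot>\<^bsub>FObj M (u B)\<^esub> lin_map C M (u A) (u B) (j A B \<phi>) x) =
       c \<phi> \<odot>\<^bsub>FObj M' (u B)\<^esub> \<theta> B (FHom (corner_rep M) A B \<phi> x)"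
      using Vec_HomD(3)[OF th(1)[OF A(2)]] jx[OF \<phi>] A by (simp add: M.corner_FHom)
    also have "\<dots> = c \<phi> \<odot>\<^bsub>FObj M' (u B)\<^esub> FHom (corner_rep M') A B \<phi> (\<theta> A x)"
      using th(2)[OF A(1,2) \<phi>] A by simp
    finally show "\<theta> B (c \<phi> \<odot>\<^bsub>FObj M (u B)\<^esub> lin_map C M (u A) (u B) (j A B \<phi>) x) =
       c \<phi> \<odot>\<^bsub>FObj M' (u B)\<^esub> lin_map C M' (u A) (u B) (j A B \<phi>) (\<theta> A x)"
      using \<theta>x by (simp add: M'.corner_FHom)
    show "c \<phi> \<odot>\<^bsub>FObj M' (u B)\<^esub> lin_map C M' (u A) (u B) (j A B \<phi>) (\<theta> A x) \<in> carrier (FObj M' (u B))"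
      using A u_in \<theta>x by (intro V'.smult_in M'.M.lin_map_in) (auto simp: M'.fixed_in)
  qed
  also have "\<dots> = lin_map C M' (u A) (u B) a (\<theta> A x)"
    unfolding a using A u_in \<theta>x D.finite_Hom by (subst M'.M.lin_map_coeff_sum) (auto simp: M'.fixed_in)
  finally show ?thesis .
qed

text \<open>
  The only possible extension: at \<open>S\<close>, apply \<open>\<theta>\<close> on each direct summand.
\<close>

definition extend_nat ::
  "('o1, 'm1, ('k, 'v) module, 'v \<Rightarrow> 'v) ftor \<Rightarrow> ('o1, 'm1, ('k, 'v) module, 'v \<Rightarrow> 'v) ftor
     \<Rightarrow> ('o2 \<Rightarrow> 'v \<Rightarrow> 'v) \<Rightarrow> 'o1 \<Rightarrow> 'v \<Rightarrow> 'v" where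
  "extend_nat M M' \<theta> = (\<lambda>S \<in> Obj C. \<lambda>x \<in> carrier (FObj M S).
     finsum (FObj M' S) (\<lambda>p. of_part M' S p
       (\<theta> (d S p) (to_part M S p x))) (P S))"

text \<open>
  A natural transformation is determined by its components on the summands, since the identity is
  \<open>\<Sum> \<beta> \<alpha>\<close>.  Conversely the extension is natural because a morphism from \<open>S\<close> to \<open>T\<close> becomes a matrix
  with entries \<open>\<alpha> h \<beta>\<close> in the corners, and \<open>\<theta>\<close> commutes with these.
\<close>

lemma corner_bij:
  assumes "morita_rep C D u j P d \<alpha> \<beta> M" "morita_rep C D u j P d \<alpha> \<beta> M'"
  shows "bij_betw (FHom corner_ftor M M') (nat_trans C Vec M M')
    (nat_trans D Vec (corner_rep M) (corner_rep M'))"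
proof (rule bij_betw_byWitness[where f' = "extend_nat M M'"])
  interpret M: morita_rep C D u j P d \<alpha> \<beta> M by fact
  interpret M': morita_rep C D u j P d \<alpha> \<beta> M' by fact
  interpret Phi: is_functor "functor_cat C Vec" "functor_cat D Vec"
    "corner_ftor :: (('o1, 'm1, ('k, 'v) module, 'v \<Rightarrow> 'v) ftor, _, _, _) ftor"
    by (rule is_functor_corner_ftor)
  have \<alpha>x: "to_part M S p x \<in> fixed M (d S p)"
    if "S \<in> Obj C" "p \<in> P S" "x \<in> carrier (FObj M S)" for S p x
    using that by (intro M.lin_map_fixed d_in e_\<alpha>)
  show "FHom corner_ftor M M' ` nat_trans C Vec M M' \<subseteq> nat_trans D Vec (corner_rep M) (corner_rep M')"
    using Phi.FHom_in_Hom[of M M'] M.M.is_functor_axioms M'.M.is_functor_axioms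
    by (auto simp: functor_cat_def corner_ftor_def)
  show "\<forall>\<eta> \<in> nat_trans C Vec M M'. extend_nat M M' (FHom corner_ftor M M' \<eta>) = \<eta>"
  proof (intro ballI extensionalityI[of _ "Obj C"])
    fix \<eta> S assume \<eta>: "\<eta> \<in> nat_trans C Vec M M'" and S: "S \<in> Obj C"
    interpret V': vec_obj "FObj M' S" using S by (intro M'.M.vec_obj_at)
    have \<eta>x: "\<eta> T x \<in> carrier (FObj M' T)" if "T \<in> Obj C" "x \<in> carrier (FObj M T)" for T x
      using nat_transD(1)[OF \<eta>, THEN Vec_HomD(1)] that by blast
    show "extend_nat M M' (FHom corner_ftor M M' \<eta>) S = \<eta> S"
    proof (rule extensionalityI[of _ "carrier (FObj M S)"])
      fix x assume x: "x \<in> carrier (FObj M S)"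
      have "extend_nat M M' (FHom corner_ftor M M' \<eta>) S x = finsum (FObj M' S)
        (\<lambda>p. of_part M' S p (to_part M' S p (\<eta> S x))) (P S)"
        unfolding extend_nat_def using S x
      proof (simp, intro V'.sum_cong)
        fix p assume p: "p \<in> P S"
        have "FHom corner_ftor M M' \<eta> (d S p) (to_part M S p x) =
            \<eta> (u (d S p)) (to_part M S p x)"
          using p S x \<alpha>x d_in by (simp add: corner_ftor_def)
        also have "\<dots> = to_part M' S p (\<eta> S x)"
          using p S x d_in u_in
          by (intro nat_trans_lin_map[OF M.M.linear_representation_axioms M'.M.linear_representation_axioms \<eta>]) auto
        finally show "of_part M' S p
          (FHom corner_ftor M M' \<eta> (d S p) (to_part M S p x)) =
          of_part M' S p (to_part M' S p (\<eta> S x))" by simp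
        show "of_part M' S p (to_part M' S p (\<eta> S x)) \<in> carrier (FObj M' S)"
          using p S x d_in u_in \<eta>x by (intro M'.M.lin_map_in) auto
      qed
      then show "extend_nat M M' (FHom corner_ftor M M' \<eta>) S x = \<eta> S x"
        using M'.decompose[OF S \<eta>x[OF S x]] by simp
    next
      show "\<eta> S \<in> extensional (carrier (FObj M S))"
        using nat_transD(1)[OF \<eta> S] by (auto simp: Vec_def PiE_def)
    qed (use S in \<open>simp add: extend_nat_def\<close>)
  next
    show "\<eta> \<in> extensional (Obj C)" if "\<eta> \<in> nat_trans C Vec M M'" for \<eta>
      using that by (auto simp: nat_trans_def PiE_def)
  qed (simp add: extend_nat_def)
  have ext: "extend_nat M M' \<theta> \<in> nat_trans C Vec M M' \<and> FHom corner_ftor M M' (extend_nat M M' \<theta>) = \<theta>"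
    if \<theta>: "\<theta> \<in> nat_trans D Vec (corner_rep M) (corner_rep M')" for \<theta>
  proof -
    note th = nat_transD[OF \<theta>]
    define \<eta> where "\<eta> = extend_nat M M' \<theta>"
    have \<theta>x: "\<theta> A x \<in> fixed M' A" if "A \<in> Obj D" "x \<in> fixed M A" for A x
      using Vec_HomD(1)[OF th(1)[OF that(1)], of x] that by simp
    have \<theta>\<alpha>: "\<theta> (d S p) (to_part M S p x) \<in> carrier (FObj M' (u (d S p)))"
      if "S \<in> Obj C" "p \<in> P S" "x \<in> carrier (FObj M S)" for S p x
      using \<theta>x \<alpha>x that d_in by (auto intro: M'.fixed_in)
    have \<eta>_in: "\<eta> S x \<in> carrier (FObj M' S)" if S: "S \<in> Obj C" "x \<in> carrier (FObj M S)" for S x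
    proof -
      interpret V': vec_obj "FObj M' S" using S by (intro M'.M.vec_obj_at)
      show ?thesis using that d_in u_in \<theta>\<alpha>
        by (simp add: \<eta>_def extend_nat_def) (intro V'.sum_in M'.M.lin_map_in, auto)
    qed
    \<comment> \<open>Both the naturality of the extension and the fact that it extends
      \<open>\<theta>\<close> are instances of
      naturality with respect to maps \<open>b\<close> from an object of \<open>C\<close> into a corner.\<close>
    have key: "\<theta> B (lin_map C M S (u B) b x) = lin_map C M' S (u B) b (\<eta> S x)"
      if S: "S \<in> Obj C" and B: "B \<in> Obj D" and x: "x \<in> carrier (FObj M S)"
        and b: "b \<in> lin_hom C S (u B)" "lin_cmp C S (u B) (u B) (e B) b = b" for S B b x
    proof -
      interpret V': vec_obj "FObj M' (u B)" using B u_in by (intro M'.M.vec_obj_at)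
      interpret V: vec_obj "FObj M (u B)" using B u_in by (intro M.M.vec_obj_at)
      define b' where "b' p = lin_cmp C (u (d S p)) S (u B) b (\<beta> S p)" for p
      define y where "y p = to_part M S p x" for p
      have b': "b' p \<in> corner (d S p) B" if "p \<in> P S" for p
        unfolding b'_def using that S B b d_in \<beta>_e by (intro cornerI) auto
      have y: "y p \<in> fixed M (d S p)" if "p \<in> P S" for p
        using \<alpha>x that S x by (simp add: y_def)
      have fix_in: "lin_map C M (u (d S p)) (u B) (b' p) (y p) \<in> fixed M B" if "p \<in> P S" for p
        using that S B d_in u_in b' y by (intro M.lin_map_fixed) (auto simp: M.fixed_in corner_def)
      have "lin_map C M S (u B) b x = lin_map C M S (u B) (\<lambda>k. \<Sum>p\<in>P S. 1 *
          lin_cmp C S (u (d S p)) (u B) (b' p) (lin_cmp C S S (u (d S p)) (\<alpha> S p) (dirac (Idt C S))) k) x"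
        unfolding b'_def mult_1_left using S B u_in b \<alpha>_in
        by (subst insert_identity) (auto simp: C.lin_cmp_dirac_right)
      also have "\<dots> = lin_map C M S (u B) (\<lambda>k. \<Sum>p\<in>P S. 1 *
          lin_cmp C S (u (d S p)) (u B) (b' p) (\<alpha> S p) k) x"
        using S \<alpha>_in d_in u_in by (intro arg_cong2[of _ _ _ _ "lin_map C M S (u B)"] ext sum.cong refl)
          (simp add: C.lin_cmp_dirac_right)
      also have "\<dots> = finsum (FObj M (u B)) (\<lambda>p. lin_map C M (u (d S p)) (u B) (b' p) (y p)) (P S)"
        using S B x u_in d_in finite_P by (subst M.M.lin_map_coeff_sum)
          (auto simp: y_def M.M.lin_map_lin_cmp M.M.lin_map_in intro!: V.sum_cong)
      also have "\<dots> = finsum (FObj (corner_rep M) B) (\<lambda>p. lin_map C M (u (d S p)) (u B) (b' p) (y p)) (P S)"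
        using B fix_in by (simp add: M.corner_finsum)
      finally have eq: "lin_map C M S (u B) b x =
          finsum (FObj (corner_rep M) B) (\<lambda>p. lin_map C M (u (d S p)) (u B) (b' p) (y p)) (P S)" .
      have "\<theta> B (lin_map C M S (u B) b x) =
          finsum (FObj (corner_rep M') B) (\<lambda>p. \<theta> B (lin_map C M (u (d S p)) (u B) (b' p) (y p))) (P S)"
        unfolding eq using B fix_in by (intro Vec_Hom_sum[OF M.corner_Obj M'.corner_Obj th(1)]) auto
      also have "\<dots> = finsum (FObj M' (u B)) (\<lambda>p. \<theta> B (lin_map C M (u (d S p)) (u B) (b' p) (y p))) (P S)"
        using B fix_in \<theta>x by (simp add: M'.corner_finsum)
      also have "\<dots> = finsum (FObj M' (u B)) (\<lambda>p. lin_map C M' S (u B) b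
          (of_part M' S p (\<theta> (d S p) (y p)))) (P S)"
      proof (rule V'.sum_cong)
        fix p assume p: "p \<in> P S"
        have "\<theta> B (lin_map C M (u (d S p)) (u B) (b' p) (y p)) =
            lin_map C M' (u (d S p)) (u B) (b' p) (\<theta> (d S p) (y p))"
          using p S B d_in b' y by (intro nat_trans_corner[OF assms \<theta>]) auto
        then show "\<theta> B (lin_map C M (u (d S p)) (u B) (b' p) (y p)) = lin_map C M' S (u B) b
          (of_part M' S p (\<theta> (d S p) (y p)))"
          using p S B d_in u_in \<theta>x y unfolding b'_def by (simp add: M'.M.lin_map_lin_cmp M'.fixed_in)
        show "lin_map C M' S (u B) b (of_part M' S p (\<theta> (d S p) (y p)))
            \<in> carrier (FObj M' (u B))"
          using p S B d_in u_in \<theta>x y by (intro M'.M.lin_map_in) (auto simp: M'.fixed_in)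
      qed
      also have "\<dots> = lin_map C M' S (u B) b (\<eta> S x)"
        using S B x d_in u_in \<theta>x y unfolding \<eta>_def extend_nat_def
        by (simp add: y_def[symmetric]) (intro M'.M.lin_map_sum[symmetric] M'.M.lin_map_in, auto simp: M'.fixed_in)
      finally show ?thesis .
    qed
    have nat: "\<eta> \<in> nat_trans C Vec M M'"
    proof (rule nat_transI[OF C.category_axioms M.M.is_functor_axioms M'.M.is_functor_axioms])
      fix S assume S: "S \<in> Obj C"
      interpret V: vec_obj "FObj M S" using S by (intro M.M.vec_obj_at)
      interpret V': vec_obj "FObj M' S" using S by (intro M'.M.vec_obj_at)
      have dS: "d S p \<in> Obj D" "u (d S p) \<in> Obj C" if "p \<in> P S" for p using that S d_in u_in by auto
      have hom: "\<theta> (d S p) \<in> Hom Vec (FObj (corner_rep M) (d S p)) (FObj (corner_rep M') (d S p))"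
        if "p \<in> P S" for p using th(1) dS that by blast
      have "restrict (\<eta> S) (carrier (FObj M S)) \<in> Hom Vec (FObj M S) (FObj M' S)"
      proof (rule Vec_Hom_restrictI)
        show "\<eta> S x \<in> carrier (FObj M' S)" if "x \<in> carrier (FObj M S)" for x using \<eta>_in S that by blast
        show "FObj M S \<in> Obj Vec" by (rule V.in_Vec)
        fix x assume x: "x \<in> carrier (FObj M S)"
        show "\<eta> S (c \<odot>\<^bsub>FObj M S\<^esub> x) = c \<odot>\<^bsub>FObj M' S\<^esub> \<eta> S x" for c
        proof -
          have "\<eta> S (c \<odot>\<^bsub>FObj M S\<^esub> x) = finsum (FObj M' S) (\<lambda>p. c \<odot>\<^bsub>FObj M' S\<^esub> of_part M' S p
             (\<theta> (d S p) (to_part M S p x))) (P S)"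
            using S x dS \<theta>\<alpha> \<alpha>x Vec_HomD(3)[OF hom] unfolding \<eta>_def extend_nat_def
            by (simp, intro V'.sum_cong) (auto simp: M.M.lin_map_smult M'.M.lin_map_smult M'.M.lin_map_in)
          also have "\<dots> = c \<odot>\<^bsub>FObj M' S\<^esub> \<eta> S x"
            using S x dS \<theta>\<alpha> unfolding \<eta>_def extend_nat_def
            by (simp, intro V'.smult_sum[symmetric]) (auto simp: M'.M.lin_map_in)
          finally show ?thesis .
        qed
        fix y assume y: "y \<in> carrier (FObj M S)"
        show "\<eta> S (x \<oplus>\<^bsub>FObj M S\<^esub> y) = \<eta> S x \<oplus>\<^bsub>FObj M' S\<^esub> \<eta> S y"
        proof -
          have "\<eta> S (x \<oplus>\<^bsub>FObj M S\<^esub> y) = finsum (FObj M' S) (\<lambda>p. of_part M' S p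
             (\<theta> (d S p) (to_part M S p x)) \<oplus>\<^bsub>FObj M' S\<^esub> of_part M' S p
             (\<theta> (d S p) (to_part M S p y))) (P S)"
            using S x y dS \<theta>\<alpha> \<alpha>x Vec_HomD(2)[OF hom] unfolding \<eta>_def extend_nat_def
            by (simp, intro V'.sum_cong) (auto simp: M.M.lin_map_add M'.M.lin_map_add M'.M.lin_map_in)
          also have "\<dots> = \<eta> S x \<oplus>\<^bsub>FObj M' S\<^esub> \<eta> S y"
            using S x y dS \<theta>\<alpha> unfolding \<eta>_def extend_nat_def
            by (simp, intro V'.mod.M.finsum_addf) (auto simp: M'.M.lin_map_in)
          finally show ?thesis .
        qed
      qed
      then show "\<eta> S \<in> Hom Vec (FObj M S) (FObj M' S)"
        using S by (simp add: \<eta>_def extend_nat_def)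
    next
      fix S T h x assume a: "S \<in> Obj C" "T \<in> Obj C" "h \<in> Hom C S T" "x \<in> carrier (FObj M S)"
      interpret V': vec_obj "FObj M' T" using a by (intro M'.M.vec_obj_at)
      have "\<eta> T (FHom M S T h x) = finsum (FObj M' T) (\<lambda>p. of_part M' T p
             (to_part M' T p (FHom M' S T h (\<eta> S x)))) (P T)"
        unfolding \<eta>_def[THEN fun_cong, of T] extend_nat_def using a M.M.FHom_at
      proof (simp, intro V'.sum_cong)
        fix p assume p: "p \<in> P T"
        then have dT: "d T p \<in> Obj D" "u (d T p) \<in> Obj C" using a d_in u_in by auto
        let ?b = "lin_cmp C S T (u (d T p)) (\<alpha> T p) (dirac h)"
        have "\<theta> (d T p) (to_part M T p (FHom M S T h x)) = \<theta> (d T p) (lin_map C M S (u (d T p)) ?b x)"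
          using a dT by (simp add: M.M.lin_map_lin_cmp M.M.lin_map_dirac)
        also have "\<dots> = lin_map C M' S (u (d T p)) ?b (\<eta> S x)"
          using a p dT e_\<alpha> by (intro key) (auto simp: C.lin_cmp_in C.lin_cmp_assoc)
        also have "\<dots> = to_part M' T p (FHom M' S T h (\<eta> S x))"
          using a dT \<eta>_in by (simp add: M'.M.lin_map_lin_cmp M'.M.lin_map_dirac)
        finally show "of_part M' T p
             (\<theta> (d T p) (to_part M T p (FHom M S T h x))) =
          of_part M' T p
             (to_part M' T p (FHom M' S T h (\<eta> S x)))" by simp
        show "of_part M' T p
             (to_part M' T p (FHom M' S T h (\<eta> S x))) \<in> carrier (FObj M' T)"
          using a dT \<eta>_in M'.M.FHom_at by (intro M'.M.lin_map_in) auto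
      qed
      also have "\<dots> = FHom M' S T h (\<eta> S x)"
        using a \<eta>_in M'.M.FHom_at by (intro M'.decompose) auto
      finally show "\<eta> T (FHom M S T h x) = FHom M' S T h (\<eta> S x)" .
    qed (simp add: \<eta>_def extend_nat_def)
    moreover have "FHom corner_ftor M M' \<eta> = \<theta>"
    proof (rule extensionalityI[of _ "Obj D"])
      fix A assume A: "A \<in> Obj D"
      show "FHom corner_ftor M M' \<eta> A = \<theta> A"
      proof (rule extensionalityI[of _ "fixed M A"])
        fix x assume x: "x \<in> fixed M A"
        have "\<theta> A x = \<theta> A (lin_map C M (u A) (u A) (e A) x)" using x by (simp add: fixed_def)
        also have "\<dots> = lin_map C M' (u A) (u A) (e A) (\<eta> (u A) x)"
          using A x u_in e_in e_idem by (intro key) (auto simp: M.fixed_in)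
        also have "\<dots> = \<eta> (u A) (lin_map C M (u A) (u A) (e A) x)"
          using A x u_in nat
          by (intro nat_trans_lin_map[symmetric, OF M.M.linear_representation_axioms M'.M.linear_representation_axioms])
            (auto simp: M.fixed_in)
        also have "\<dots> = \<eta> (u A) x" using x by (simp add: fixed_def)
        finally show "FHom corner_ftor M M' \<eta> A x = \<theta> A x"
          using A x by (simp add: corner_ftor_def)
      next
        show "\<theta> A \<in> extensional (fixed M A)"
          using th(1)[OF A] by (auto simp: Vec_def PiE_def)
      qed (use A in \<open>simp add: corner_ftor_def\<close>)
    qed (use \<theta> in \<open>auto simp: corner_ftor_def nat_trans_def PiE_def\<close>)
    ultimately show ?thesis by (simp add: \<eta>_def)
  qed
  then show "\<forall>\<theta> \<in> nat_trans D Vec (corner_rep M) (corner_rep M'). FHom corner_ftor M M' (extend_nat M M' \<theta>) = \<theta>"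
    and "extend_nat M M' ` nat_trans D Vec (corner_rep M) (corner_rep M') \<subseteq> nat_trans C Vec M M'"
    by blast+
qed

lemma fully_faithful_corner:
  "fully_faithful (functor_cat C Vec) (functor_cat D Vec)
     (corner_ftor :: (('o1, 'm1, ('k, 'v) module, 'v \<Rightarrow> 'v) ftor, _, _, _) ftor)"
  unfolding fully_faithful_def
proof (intro ballI)
  fix M M' :: "('o1, 'm1, ('k, 'v) module, 'v \<Rightarrow> 'v) ftor"
  assume "M \<in> Obj (functor_cat C Vec)" "M' \<in> Obj (functor_cat C Vec)"
  then show "bij_betw (FHom corner_ftor M M') (Hom (functor_cat C Vec) M M')
      (Hom (functor_cat D Vec) (FObj corner_ftor M) (FObj corner_ftor M'))"
    using corner_bij[of M M'] morita_repI[of M] morita_repI[of M']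
    by (simp add: functor_cat_def corner_ftor_def)
qed

end


section \<open>Induced representations\<close>

text \<open>
  The object \<open>S\<close> behaves like the direct sum of the \<open>u (d S p)\<close> cut down by the \<open>e\<close>; an element of
  the linearised \<open>C\<close> thus becomes a matrix with entries in the corners.
\<close>

context morita_data
begin

abbreviation \<alpha>\<^sub>e :: "'o2 \<Rightarrow> 'p \<Rightarrow> 'm1 \<Rightarrow> 'k" where
  "\<alpha>\<^sub>e A p \<equiv> lin_cmp C (u A) (u A) (u (d (u A) p)) (\<alpha> (u A) p) (e A)"

abbreviation \<beta>\<^sub>e :: "'o2 \<Rightarrow> 'p \<Rightarrow> 'm1 \<Rightarrow> 'k" where
  "\<beta>\<^sub>e A p \<equiv> lin_cmp C (u (d (u A) p)) (u A) (u A) (e A) (\<beta> (u A) p)"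

definition entry :: "'o1 \<Rightarrow> 'o1 \<Rightarrow> ('m1 \<Rightarrow> 'k) \<Rightarrow> 'p \<Rightarrow> 'p \<Rightarrow> 'm1 \<Rightarrow> 'k" where
  "entry S T a q p = lin_cmp C (u (d S p)) S (u (d T q)) (lin_cmp C S T (u (d T q)) (\<alpha> T q) a) (\<beta> S p)"

lemma \<alpha>_left:
  assumes "S \<in> Obj C" "T \<in> Obj C" "q \<in> P T"
  shows "lin_cmp C S (u (d T q)) (u (d T q)) (e (d T q)) (lin_cmp C S T (u (d T q)) (\<alpha> T q) a) =
    lin_cmp C S T (u (d T q)) (\<alpha> T q) a"
  using assms d_in u_in by (simp add: C.lin_cmp_assoc e_\<alpha>)

lemma entry_corner:
  "S \<in> Obj C \<Longrightarrow> T \<in> Obj C \<Longrightarrow> p \<in> P S \<Longrightarrow> q \<in> P T \<Longrightarrow> entry S T a q p \<in> corner (d S p) (d T q)"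
  unfolding entry_def by (intro cornerI d_in \<alpha>_left \<beta>_e)

text \<open>
  Matrix multiplication, by inserting the identity of the middle object.
\<close>

lemma entry_cmp:
  assumes "S \<in> Obj C" "T \<in> Obj C" "U \<in> Obj C" "p \<in> P S" "r \<in> P U"
  shows "(\<lambda>k. \<Sum>q\<in>P T. lin_cmp C (u (d S p)) (u (d T q)) (u (d U r)) (entry T U b r q) (entry S T a q p) k) =
    entry S U (lin_cmp C S T U b a) r p"
proof -
  have "(\<lambda>k. \<Sum>q\<in>P T. lin_cmp C (u (d S p)) (u (d T q)) (u (d U r)) (entry T U b r q) (entry S T a q p) k) =
    (\<lambda>k. \<Sum>q\<in>P T. lin_cmp C (u (d S p)) (u (d T q)) (u (d U r))
      (lin_cmp C (u (d T q)) T (u (d U r)) (lin_cmp C T U (u (d U r)) (\<alpha> U r) b) (\<beta> T q))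
      (lin_cmp C (u (d S p)) T (u (d T q)) (\<alpha> T q) (lin_cmp C (u (d S p)) S T a (\<beta> S p))) k)"
    using assms d_in u_in by (intro ext sum.cong refl) (simp add: entry_def C.lin_cmp_assoc)
  also have "\<dots> = lin_cmp C (u (d S p)) T (u (d U r)) (lin_cmp C T U (u (d U r)) (\<alpha> U r) b)
      (lin_cmp C (u (d S p)) S T a (\<beta> S p))"
    using assms d_in u_in by (intro insert_identity C.lin_cmp_in) auto
  also have "\<dots> = entry S U (lin_cmp C S T U b a) r p"
    using assms d_in u_in by (simp add: entry_def C.lin_cmp_assoc)
  finally show ?thesis .
qed

lemma entry_Idt:
  assumes "S \<in> Obj C" "p \<in> P S" "q \<in> P S"
  shows "entry S S (dirac (Idt C S)) q p = (if p = q then e (d S p) else (\<lambda>k. 0))"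
  using assms d_in u_in \<alpha>_in by (simp add: entry_def C.lin_cmp_dirac_right \<alpha>_\<beta>_same \<alpha>_\<beta>_diff)

lemma entry_sum:
  assumes "S \<in> Obj C" "T \<in> Obj C" "a \<in> lin_hom C S T"
  shows "entry S T a q p = (\<lambda>k. \<Sum>h \<in> Hom C S T. a h * entry S T (dirac h) q p k)"
proof -
  have "entry S T a q p = entry S T (\<lambda>k. \<Sum>h \<in> Hom C S T. a h * dirac h k) q p"
    using assms by (simp add: C.lin_hom_expand)
  then show ?thesis unfolding entry_def by (simp only: lin_cmp_sum_left lin_cmp_sum_right)
qed

end

text \<open>
  \<open>W S\<close> is the product of the spaces \<open>N (d S p)\<close> with projections \<open>\<pi> S p\<close>; the elements of \<open>kC\<close> act on
  these products as matrices over the corners.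
\<close>

locale induced_rep = morita_data C D u j P d \<alpha> \<beta> + N: linear_representation D N
  for C :: "('o1, 'm1) cat" and D :: "('o2, 'm2) cat"
    and u :: "'o2 \<Rightarrow> 'o1" and j :: "'o2 \<Rightarrow> 'o2 \<Rightarrow> 'm2 \<Rightarrow> 'm1 \<Rightarrow> 'k::field"
    and P :: "'o1 \<Rightarrow> 'p set" and d :: "'o1 \<Rightarrow> 'p \<Rightarrow> 'o2"
    and \<alpha> \<beta> :: "'o1 \<Rightarrow> 'p \<Rightarrow> 'm1 \<Rightarrow> 'k" and N :: "('o2, 'm2, ('k, 'v) module, 'v \<Rightarrow> 'v) ftor" +
  fixes W :: "'o1 \<Rightarrow> ('k, 'v) module" and \<pi> :: "'o1 \<Rightarrow> 'p \<Rightarrow> 'v \<Rightarrow> 'v"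
  assumes W_in: "S \<in> Obj C \<Longrightarrow> W S \<in> Obj Vec"
    and \<pi>_Hom: "S \<in> Obj C \<Longrightarrow> p \<in> P S \<Longrightarrow> \<pi> S p \<in> Hom Vec (W S) (FObj N (d S p))"
    and tuple: "S \<in> Obj C \<Longrightarrow> x \<in> (\<Pi>\<^sub>E p \<in> P S. carrier (FObj N (d S p))) \<Longrightarrow>
      \<exists>w \<in> carrier (W S). \<forall>p \<in> P S. \<pi> S p w = x p"
    and \<pi>_inj: "S \<in> Obj C \<Longrightarrow> w \<in> carrier (W S) \<Longrightarrow> w' \<in> carrier (W S) \<Longrightarrow>
      (\<And>p. p \<in> P S \<Longrightarrow> \<pi> S p w = \<pi> S p w') \<Longrightarrow> w = w'"
begin

text \<open>Elements of the corners act on \<open>N\<close> through their preimages in \<open>kD\<close>.\<close>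

definition act :: "'o2 \<Rightarrow> 'o2 \<Rightarrow> ('m1 \<Rightarrow> 'k) \<Rightarrow> 'v \<Rightarrow> 'v" where
  "act A B a = lin_map D N A B (\<Gamma> A B a)"

lemma act_in: "A \<in> Obj D \<Longrightarrow> B \<in> Obj D \<Longrightarrow> x \<in> carrier (FObj N A) \<Longrightarrow> act A B a x \<in> carrier (FObj N B)"
  unfolding act_def by (rule N.lin_map_in)

lemma act_add: "A \<in> Obj D \<Longrightarrow> B \<in> Obj D \<Longrightarrow> x \<in> carrier (FObj N A) \<Longrightarrow> y \<in> carrier (FObj N A) \<Longrightarrow>
    act A B a (x \<oplus>\<^bsub>FObj N A\<^esub> y) = act A B a x \<oplus>\<^bsub>FObj N B\<^esub> act A B a y"
  unfolding act_def by (rule N.lin_map_add)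

lemma act_smult: "A \<in> Obj D \<Longrightarrow> B \<in> Obj D \<Longrightarrow> x \<in> carrier (FObj N A) \<Longrightarrow>
    act A B a (c \<odot>\<^bsub>FObj N A\<^esub> x) = c \<odot>\<^bsub>FObj N B\<^esub> act A B a x"
  unfolding act_def by (rule N.lin_map_smult)

lemma act_finsum: "A \<in> Obj D \<Longrightarrow> B \<in> Obj D \<Longrightarrow> (\<And>i. i \<in> I \<Longrightarrow> x i \<in> carrier (FObj N A)) \<Longrightarrow>
    act A B a (finsum (FObj N A) x I) = finsum (FObj N B) (\<lambda>i. act A B a (x i)) I"
  unfolding act_def by (rule N.lin_map_sum)

lemma act_j: "A \<in> Obj D \<Longrightarrow> B \<in> Obj D \<Longrightarrow> \<phi> \<in> Hom D A B \<Longrightarrow> x \<in> carrier (FObj N A) \<Longrightarrow>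
    act A B (j A B \<phi>) x = FHom N A B \<phi> x"
  by (simp add: act_def \<Gamma>_j N.lin_map_dirac)

lemma act_e: "A \<in> Obj D \<Longrightarrow> x \<in> carrier (FObj N A) \<Longrightarrow> act A A (e A) x = x"
  by (simp add: act_def \<Gamma>_j D.Idt_in_Hom N.lin_map_Idt)

lemma act_coeff_sum:
  assumes "A \<in> Obj D" "B \<in> Obj D" "x \<in> carrier (FObj N A)" "finite I" "\<And>i. i \<in> I \<Longrightarrow> a i \<in> corner A B"
  shows "act A B (\<lambda>k. \<Sum>i\<in>I. c i * a i k) x = finsum (FObj N B) (\<lambda>i. c i \<odot>\<^bsub>FObj N B\<^esub> act A B (a i) x) I"
  using assms unfolding act_def by (simp add: \<Gamma>_sum N.lin_map_coeff_sum)

lemma act_zero: "A \<in> Obj D \<Longrightarrow> B \<in> Obj D \<Longrightarrow> x \<in> carrier (FObj N A) \<Longrightarrow> act A B (\<lambda>k. 0) x = \<zero>\<^bsub>FObj N B\<^esub>"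
  using act_coeff_sum[of A B x "{}"] N.vec_obj_at[of B]
  by (simp add: abelian_monoid.finsum_empty[OF abelian_group.axioms(1)] Vec_def vec_obj_def Module.module_def)

lemma act_act_sum:
  assumes "A \<in> Obj D" "E \<in> Obj D" "x \<in> carrier (FObj N A)" "finite I"
    and "\<And>i. i \<in> I \<Longrightarrow> B i \<in> Obj D" "\<And>i. i \<in> I \<Longrightarrow> a i \<in> corner A (B i)" "\<And>i. i \<in> I \<Longrightarrow> b i \<in> corner (B i) E"
    and eq: "(\<lambda>k. \<Sum>i\<in>I. lin_cmp C (u A) (u (B i)) (u E) (b i) (a i) k) = c"
  shows "finsum (FObj N E) (\<lambda>i. act (B i) E (b i) (act A (B i) (a i) x)) I = act A E c x"
proof -
  interpret vec_obj "FObj N E" by (rule N.vec_obj_at) fact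
  have "act A E c x = act A E (\<lambda>k. \<Sum>i\<in>I. 1 * lin_cmp C (u A) (u (B i)) (u E) (b i) (a i) k) x"
    using eq by simp
  also have "\<dots> = finsum (FObj N E) (\<lambda>i. act (B i) E (b i) (act A (B i) (a i) x)) I"
    using assms by (subst act_coeff_sum)
      (auto simp: corner_cmp act_def \<Gamma>_cmp N.lin_map_lin_cmp N.lin_map_in intro!: sum_cong)
  finally show ?thesis by simp
qed

lemma act_act:
  assumes "A \<in> Obj D" "B \<in> Obj D" "E \<in> Obj D" "x \<in> carrier (FObj N A)" "a \<in> corner A B" "b \<in> corner B E"
  shows "act B E b (act A B a x) = act A E (lin_cmp C (u A) (u B) (u E) b a) x"
  using assms by (simp add: act_def \<Gamma>_cmp N.lin_map_lin_cmp)

lemma W_vec: "S \<in> Obj C \<Longrightarrow> vec_obj (W S)"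
  by unfold_locales (rule W_in)

lemma N_vec: "S \<in> Obj C \<Longrightarrow> p \<in> P S \<Longrightarrow> vec_obj (FObj N (d S p))"
  by (intro N.vec_obj_at d_in)

lemmas \<pi>_in = \<pi>_Hom[THEN Vec_HomD(1)]
  and \<pi>_add = \<pi>_Hom[THEN Vec_HomD(2)]
  and \<pi>_smult = \<pi>_Hom[THEN Vec_HomD(3)]

text \<open>The \<open>q\<close>-th component of the product of the matrix of \<open>a\<close> with the vector \<open>w\<close>.\<close>

definition component :: "'o1 \<Rightarrow> 'o1 \<Rightarrow> ('m1 \<Rightarrow> 'k) \<Rightarrow> 'p \<Rightarrow> 'v \<Rightarrow> 'v" where
  "component S T a q w = finsum (FObj N (d T q)) (\<lambda>p. act (d S p) (d T q) (entry S T a q p) (\<pi> S p w)) (P S)"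

lemma component_in:
  assumes "S \<in> Obj C" "T \<in> Obj C" "q \<in> P T" "w \<in> carrier (W S)"
  shows "component S T a q w \<in> carrier (FObj N (d T q))"
proof -
  interpret vec_obj "FObj N (d T q)" using assms by (intro N_vec)
  show ?thesis unfolding component_def using assms d_in \<pi>_in by (intro sum_in act_in) auto
qed

lemma component_add:
  assumes "S \<in> Obj C" "T \<in> Obj C" "q \<in> P T" "w \<in> carrier (W S)" "w' \<in> carrier (W S)"
  shows "component S T a q (w \<oplus>\<^bsub>W S\<^esub> w') = component S T a q w \<oplus>\<^bsub>FObj N (d T q)\<^esub> component S T a q w'"
proof -
  interpret vec_obj "FObj N (d T q)" using assms by (intro N_vec)
  have "component S T a q (w \<oplus>\<^bsub>W S\<^esub> w') = finsum (FObj N (d T q))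
    (\<lambda>p. act (d S p) (d T q) (entry S T a q p) (\<pi> S p w) \<oplus>\<^bsub>FObj N (d T q)\<^esub> act (d S p) (d T q) (entry S T a q p) (\<pi> S p w')) (P S)"
    unfolding component_def using assms d_in \<pi>_in
    by (intro sum_cong) (auto simp: \<pi>_add act_add act_in)
  also have "\<dots> = component S T a q w \<oplus>\<^bsub>FObj N (d T q)\<^esub> component S T a q w'"
    unfolding component_def using assms d_in \<pi>_in by (intro mod.M.finsum_addf) (auto simp: act_in)
  finally show ?thesis .
qed

lemma component_smult:
  assumes "S \<in> Obj C" "T \<in> Obj C" "q \<in> P T" "w \<in> carrier (W S)"
  shows "component S T a q (c \<odot>\<^bsub>W S\<^esub> w) = c \<odot>\<^bsub>FObj N (d T q)\<^esub> component S T a q w"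
proof -
  interpret vec_obj "FObj N (d T q)" using assms by (intro N_vec)
  show ?thesis unfolding component_def using assms d_in \<pi>_in
    by (subst smult_sum) (auto simp: \<pi>_smult act_smult act_in intro!: sum_cong)
qed

lemma component_coeff_sum:
  assumes "S \<in> Obj C" "T \<in> Obj C" "q \<in> P T" "w \<in> carrier (W S)" "a \<in> lin_hom C S T"
  shows "component S T a q w = finsum (FObj N (d T q)) (\<lambda>h. a h \<odot>\<^bsub>FObj N (d T q)\<^esub> component S T (dirac h) q w) (Hom C S T)"
proof -
  interpret vec_obj "FObj N (d T q)" using assms by (intro N_vec)
  have "component S T a q w = finsum (FObj N (d T q)) (\<lambda>p. finsum (FObj N (d T q))
      (\<lambda>h. a h \<odot>\<^bsub>FObj N (d T q)\<^esub> act (d S p) (d T q) (entry S T (dirac h) q p) (\<pi> S p w)) (Hom C S T)) (P S)"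
    unfolding component_def entry_sum[OF assms(1,2,5)] using assms d_in \<pi>_in entry_corner C.finite_Hom
    by (intro sum_cong act_coeff_sum) (auto intro!: sum_in act_in)
  also have "\<dots> = finsum (FObj N (d T q)) (\<lambda>h. finsum (FObj N (d T q))
      (\<lambda>p. a h \<odot>\<^bsub>FObj N (d T q)\<^esub> act (d S p) (d T q) (entry S T (dirac h) q p) (\<pi> S p w)) (P S)) (Hom C S T)"
    using assms d_in \<pi>_in C.finite_Hom by (intro sum_swap) (auto intro!: act_in)
  also have "\<dots> = finsum (FObj N (d T q)) (\<lambda>h. a h \<odot>\<^bsub>FObj N (d T q)\<^esub> component S T (dirac h) q w) (Hom C S T)"
    unfolding component_def using assms d_in \<pi>_in
    by (intro sum_cong smult_sum[symmetric] smult_in sum_in act_in) auto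
  finally show ?thesis .
qed

definition apply_matrix :: "'o1 \<Rightarrow> 'o1 \<Rightarrow> ('m1 \<Rightarrow> 'k) \<Rightarrow> 'v \<Rightarrow> 'v" where
  "apply_matrix S T a w = (THE w'. w' \<in> carrier (W T) \<and> (\<forall>q \<in> P T. \<pi> T q w' = component S T a q w))"

lemma apply_matrix:
  assumes "S \<in> Obj C" "T \<in> Obj C" "w \<in> carrier (W S)"
  shows "apply_matrix S T a w \<in> carrier (W T)" "q \<in> P T \<Longrightarrow> \<pi> T q (apply_matrix S T a w) = component S T a q w"
proof -
  have "(\<lambda>q \<in> P T. component S T a q w) \<in> (\<Pi>\<^sub>E q \<in> P T. carrier (FObj N (d T q)))"
    using assms component_in by auto
  from tuple[OF assms(2) this] obtain w' where
    "w' \<in> carrier (W T) \<and> (\<forall>q \<in> P T. \<pi> T q w' = component S T a q w)" by auto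
  moreover have "w'' = w'" if "w'' \<in> carrier (W T) \<and> (\<forall>q \<in> P T. \<pi> T q w'' = component S T a q w)"
    "w' \<in> carrier (W T) \<and> (\<forall>q \<in> P T. \<pi> T q w' = component S T a q w)" for w' w''
    by (rule \<pi>_inj[OF assms(2)]) (use that in auto)
  ultimately have "\<exists>!w'. w' \<in> carrier (W T) \<and> (\<forall>q \<in> P T. \<pi> T q w' = component S T a q w)" by blast
  from theI'[OF this, folded apply_matrix_def]
  show "apply_matrix S T a w \<in> carrier (W T)" "q \<in> P T \<Longrightarrow> \<pi> T q (apply_matrix S T a w) = component S T a q w" by auto
qed

definition ind :: "('o1, 'm1, ('k, 'v) module, 'v \<Rightarrow> 'v) ftor" where
  "ind = \<lparr>FObj = W, FHom = (\<lambda>S T h. restrict (apply_matrix S T (dirac h)) (carrier (W S)))\<rparr>"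

lemma FObj_ind [simp]: "FObj ind S = W S"
  by (simp add: ind_def)

lemma is_functor_ind: "is_functor C Vec ind"
proof (intro is_functor.intro is_functor_axioms.intro category_Vec C.category_axioms)
  show "FObj ind S \<in> Obj Vec" if "S \<in> Obj C" for S using that W_in by (simp add: ind_def)
  show FH: "FHom ind S T h \<in> Hom Vec (FObj ind S) (FObj ind T)"
    if S: "S \<in> Obj C" "T \<in> Obj C" "h \<in> Hom C S T" for S T h
  proof -
    interpret S: vec_obj "W S" using S by (intro W_vec)
    interpret T: vec_obj "W T" using S by (intro W_vec)
    have "restrict (apply_matrix S T (dirac h)) (carrier (W S)) \<in> Hom Vec (W S) (W T)"
    proof (rule Vec_Hom_restrictI)
      show "apply_matrix S T (dirac h) (x \<oplus>\<^bsub>W S\<^esub> y) = apply_matrix S T (dirac h) x \<oplus>\<^bsub>W T\<^esub> apply_matrix S T (dirac h) y"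
        if "x \<in> carrier (W S)" "y \<in> carrier (W S)" for x y
        by (rule \<pi>_inj[of T]) (use S that in \<open>auto simp: apply_matrix component_add \<pi>_add\<close>)
      show "apply_matrix S T (dirac h) (c \<odot>\<^bsub>W S\<^esub> x) = c \<odot>\<^bsub>W T\<^esub> apply_matrix S T (dirac h) x"
        if "x \<in> carrier (W S)" for x c
        by (rule \<pi>_inj[of T]) (use S that in \<open>auto simp: apply_matrix component_smult \<pi>_smult\<close>)
    qed (use S apply_matrix W_in in auto)
    then show ?thesis by (simp add: ind_def)
  qed
  show "FHom ind S S (Idt C S) = Idt Vec (FObj ind S)" if S: "S \<in> Obj C" for S
  proof -
    have "apply_matrix S S (dirac (Idt C S)) w = w" if w: "w \<in> carrier (W S)" for w
    proof (rule \<pi>_inj[OF S apply_matrix(1)[OF S S w] w])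
      fix q assume q: "q \<in> P S"
      interpret vec_obj "FObj N (d S q)" using S q by (intro N_vec)
      have "component S S (dirac (Idt C S)) q w =
        finsum (FObj N (d S q)) (\<lambda>p. (if p = q then 1 else 0) \<odot>\<^bsub>FObj N (d S q)\<^esub>
           (if p = q then \<pi> S q w else \<zero>\<^bsub>FObj N (d S q)\<^esub>)) (P S)"
        unfolding component_def using S q w \<pi>_in d_in
        by (intro sum_cong) (auto simp: entry_Idt act_e act_zero)
      also have "\<dots> = \<pi> S q w"
        using S q w \<pi>_in finite_P by (subst sum_delta) auto
      finally show "\<pi> S q (apply_matrix S S (dirac (Idt C S)) w) = \<pi> S q w"
        using apply_matrix(2)[OF S S w q] by simp
    qed
    then show ?thesis by (auto simp: ind_def Vec_def)
  qed
  show "FHom ind S U (Cmp C S T U g f) =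
        Cmp Vec (FObj ind S) (FObj ind T) (FObj ind U) (FHom ind T U g) (FHom ind S T f)"
    if S: "S \<in> Obj C" "T \<in> Obj C" "U \<in> Obj C" "f \<in> Hom C S T" "g \<in> Hom C T U" for S T U f g
  proof -
    have "apply_matrix S U (dirac (Cmp C S T U g f)) w = apply_matrix T U (dirac g) (apply_matrix S T (dirac f) w)"
      if w: "w \<in> carrier (W S)" for w
    proof (rule \<pi>_inj[OF S(3)])
      show "apply_matrix S U (dirac (Cmp C S T U g f)) w \<in> carrier (W U)"
        "apply_matrix T U (dirac g) (apply_matrix S T (dirac f) w) \<in> carrier (W U)"
        using S w apply_matrix by auto
      fix r assume r: "r \<in> P U"
      interpret U: vec_obj "FObj N (d U r)" using S r by (intro N_vec)
      note S' = S finite_P d_in u_in \<pi>_in entry_corner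
      have "component T U (dirac g) r (apply_matrix S T (dirac f) w) = finsum (FObj N (d U r)) (\<lambda>q. finsum (FObj N (d U r)) (\<lambda>p.
          act (d T q) (d U r) (entry T U (dirac g) r q) (act (d S p) (d T q) (entry S T (dirac f) q p) (\<pi> S p w))) (P S)) (P T)"
        unfolding component_def[of T U] using S' w r apply_matrix[OF S(1,2) w]
        by (intro U.sum_cong) (auto simp: component_def act_finsum act_in intro!: U.sum_in act_in)
      also have "\<dots> = finsum (FObj N (d U r)) (\<lambda>p. finsum (FObj N (d U r)) (\<lambda>q.
          act (d T q) (d U r) (entry T U (dirac g) r q) (act (d S p) (d T q) (entry S T (dirac f) q p) (\<pi> S p w))) (P T)) (P S)"
        using S' w r by (intro U.sum_swap) (auto intro!: act_in)
      also have "\<dots> = component S U (dirac (Cmp C S T U g f)) r w"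
        unfolding component_def using S' w r
        by (intro U.sum_cong act_act_sum) (auto simp: entry_cmp C.lin_cmp_dirac_dirac intro!: act_in)
      finally show "\<pi> U r (apply_matrix S U (dirac (Cmp C S T U g f)) w) = \<pi> U r (apply_matrix T U (dirac g) (apply_matrix S T (dirac f) w))"
        using S w r apply_matrix by simp
    qed
    then show ?thesis using S apply_matrix by (auto simp: ind_def Vec_def compose_def fun_eq_iff)
  qed
qed

sublocale ind: morita_rep C D u j P d \<alpha> \<beta> ind
  by (rule morita_repI[OF is_functor_ind])

text \<open>
  The matrix description of the action persists for linear combinations of morphisms.
\<close>

lemma \<pi>_lin_map:
  assumes S: "S \<in> Obj C" "T \<in> Obj C" "q \<in> P T" "w \<in> carrier (W S)" "a \<in> lin_hom C S T"
  shows "\<pi> T q (lin_map C ind S T a w) = component S T a q w"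
proof -
  interpret vec_obj "FObj N (d T q)" using S by (intro N_vec)
  interpret T: vec_obj "W T" using S by (intro W_vec)
  have "\<pi> T q (lin_map C ind S T a w) = finsum (FObj N (d T q))
      (\<lambda>h. \<pi> T q (a h \<odot>\<^bsub>W T\<^esub> apply_matrix S T (dirac h) w)) (Hom C S T)"
    using S apply_matrix \<pi>_Hom N.FObj_in_Obj d_in unfolding lin_map_def
    by (simp add: ind_def, intro Vec_Hom_sum) (auto intro!: W_in)
  also have "\<dots> = component S T a q w"
    using S apply_matrix component_in by (subst component_coeff_sum) (auto simp: \<pi>_smult intro!: sum_cong)
  finally show ?thesis .
qed

text \<open>
  Restricting the induced representation to the corners gives \<open>N\<close> back.  At \<open>u A\<close> the map is the row
  vector with entries \<open>e \<beta>\<close>, and its inverse is the column vector with entries \<open>\<alpha> e\<close>: multiplied in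
  one order they give \<open>\<Sum> e \<beta> \<alpha> e = e\<close>, and in the other the matrix of \<open>e\<close>, which is the identity
  on its fixed points.
\<close>

definition unit_map :: "'o2 \<Rightarrow> 'v \<Rightarrow> 'v" where
  "unit_map A x = finsum (FObj N A) (\<lambda>p. act (d (u A) p) A
     (\<beta>\<^sub>e A p) (\<pi> (u A) p x)) (P (u A))"

lemma fixed_W: "x \<in> fixed ind A \<Longrightarrow> x \<in> carrier (W (u A))"
  by (simp add: fixed_def ind_def)

context
  fixes A assumes A: "A \<in> Obj D"
begin

interpretation V: vec_obj "FObj N A" by (rule N.vec_obj_at[OF A])

lemma e_\<beta>_corner: "p \<in> P (u A) \<Longrightarrow>
    \<beta>\<^sub>e A p \<in> corner (d (u A) p) A"
  using A u_in d_in by (intro cornerI) (auto simp: e_idem \<beta>_e)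

lemma \<alpha>_e_corner: "p \<in> P (u A) \<Longrightarrow>
    \<alpha>\<^sub>e A p \<in> corner A (d (u A) p)"
  using A u_in d_in by (intro cornerI) (auto simp: e_idem e_\<alpha>)

lemma unit_map_in: "x \<in> carrier (W (u A)) \<Longrightarrow> unit_map A x \<in> carrier (FObj N A)"
  unfolding unit_map_def using A u_in d_in \<pi>_in by (intro V.sum_in act_in) auto

lemma unit_map_Hom:
  "restrict (unit_map A) (fixed ind A) \<in> Hom Vec (FObj (corner_rep ind) A) (FObj N A)"
proof -
  have dA: "u A \<in> Obj C" "p \<in> P (u A) \<Longrightarrow> d (u A) p \<in> Obj D" for p using A u_in d_in by auto
  have "restrict (unit_map A) (carrier (FObj (corner_rep ind) A)) \<in> Hom Vec (FObj (corner_rep ind) A) (FObj N A)"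
  proof (rule Vec_Hom_restrictI)
    fix x assume "x \<in> carrier (FObj (corner_rep ind) A)"
    then have x: "x \<in> carrier (W (u A))" by (simp add: fixed_W)
    show "unit_map A x \<in> carrier (FObj N A)" using x by (rule unit_map_in)
    have "unit_map A (c \<odot>\<^bsub>W (u A)\<^esub> x) = c \<odot>\<^bsub>FObj N A\<^esub> unit_map A x" for c
      unfolding unit_map_def using A dA x \<pi>_in
      by (subst V.smult_sum) (auto simp: \<pi>_smult act_smult act_in intro!: V.sum_cong)
    then show "unit_map A (c \<odot>\<^bsub>FObj (corner_rep ind) A\<^esub> x) = c \<odot>\<^bsub>FObj N A\<^esub> unit_map A x" for c
      by simp
    fix y assume "y \<in> carrier (FObj (corner_rep ind) A)"
    then have y: "y \<in> carrier (W (u A))" by (simp add: fixed_W)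
    have "unit_map A (x \<oplus>\<^bsub>W (u A)\<^esub> y) = finsum (FObj N A) (\<lambda>p. act (d (u A) p) A
     (\<beta>\<^sub>e A p) (\<pi> (u A) p x) \<oplus>\<^bsub>FObj N A\<^esub> act (d (u A) p) A
     (\<beta>\<^sub>e A p) (\<pi> (u A) p y)) (P (u A))"
      unfolding unit_map_def using A dA x y \<pi>_in
      by (intro V.sum_cong) (auto simp: \<pi>_add act_add act_in)
    also have "\<dots> = unit_map A x \<oplus>\<^bsub>FObj N A\<^esub> unit_map A y"
      unfolding unit_map_def using A dA x y \<pi>_in
      by (intro V.mod.M.finsum_addf) (auto simp: act_in)
    finally show "unit_map A (x \<oplus>\<^bsub>FObj (corner_rep ind) A\<^esub> y) = unit_map A x \<oplus>\<^bsub>FObj N A\<^esub> unit_map A y"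
      by simp
  qed (rule ind.corner_Obj[OF A])
  then show ?thesis by simp
qed

lemma unit_map_bij: "bij_betw (unit_map A) (fixed ind A) (carrier (FObj N A))"
proof -
  have dA: "u A \<in> Obj C" "\<And>p. p \<in> P (u A) \<Longrightarrow> d (u A) p \<in> Obj D" using A u_in d_in by auto
  have "\<exists>w \<in> carrier (W (u A)). \<forall>p \<in> P (u A). \<pi> (u A) p w =
      (\<lambda>p \<in> P (u A). act A (d (u A) p) (\<alpha>\<^sub>e A p) y) p"
    if "y \<in> carrier (FObj N A)" for y
    using that A dA by (intro tuple) (auto intro!: act_in)
  then have "\<forall>y \<in> carrier (FObj N A). \<exists>w. w \<in> carrier (W (u A)) \<and> (\<forall>p \<in> P (u A). \<pi> (u A) p w =
      act A (d (u A) p) (\<alpha>\<^sub>e A p) y)"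
    by fastforce
  then obtain s where s_in: "\<And>y. y \<in> carrier (FObj N A) \<Longrightarrow> s y \<in> carrier (W (u A))"
    and s: "\<And>y p. y \<in> carrier (FObj N A) \<Longrightarrow> p \<in> P (u A) \<Longrightarrow> \<pi> (u A) p (s y) =
      act A (d (u A) p) (\<alpha>\<^sub>e A p) y"
    unfolding bchoice_iff by blast
  have e_in_lin: "e A \<in> lin_hom C (u A) (u A)" by (rule e_in[OF A])
  show ?thesis
  proof (rule bij_betw_byWitness[where f' = s])
    show "\<forall>y \<in> carrier (FObj N A). unit_map A (s y) = y"
    proof
      fix y assume y: "y \<in> carrier (FObj N A)"
      have "(\<lambda>k. \<Sum>p\<in>P (u A). lin_cmp C (u A) (u (d (u A) p)) (u A)
          (\<beta>\<^sub>e A p)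
          (\<alpha>\<^sub>e A p) k) = e A"
        using A dA e_in_lin by (simp add: insert_identity e_idem)
      then have "finsum (FObj N A) (\<lambda>p. act (d (u A) p) A
          (\<beta>\<^sub>e A p) (act A (d (u A) p)
          (\<alpha>\<^sub>e A p) y)) (P (u A)) = act A A (e A) y"
        using y A dA finite_P \<alpha>_e_corner e_\<beta>_corner by (intro act_act_sum) auto
      moreover have "unit_map A (s y) = finsum (FObj N A) (\<lambda>p. act (d (u A) p) A
          (\<beta>\<^sub>e A p) (act A (d (u A) p)
          (\<alpha>\<^sub>e A p) y)) (P (u A))"
        unfolding unit_map_def using y A dA by (intro V.sum_cong) (auto simp: s intro!: act_in)
      ultimately have "unit_map A (s y) = act A A (e A) y" by simp
      then show "unit_map A (s y) = y" using A y by (simp add: act_e)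
    qed
    show "\<forall>x \<in> fixed ind A. s (unit_map A x) = x"
    proof
      fix x assume x': "x \<in> fixed ind A"
      then have x: "x \<in> carrier (W (u A))" "lin_map C ind (u A) (u A) (e A) x = x"
        using fixed_W[OF x'] by (simp_all add: fixed_def)
      show "s (unit_map A x) = x"
      proof (rule \<pi>_inj[OF dA(1) s_in[OF unit_map_in[OF x(1)]] x(1)])
        fix q assume q: "q \<in> P (u A)"
        interpret Q: vec_obj "FObj N (d (u A) q)" using dA q by (intro N_vec)
        have "\<pi> (u A) q (s (unit_map A x)) = finsum (FObj N (d (u A) q)) (\<lambda>p. act A (d (u A) q)
            (\<alpha>\<^sub>e A q) (act (d (u A) p) A
            (\<beta>\<^sub>e A p) (\<pi> (u A) p x))) (P (u A))"
          unfolding s[OF unit_map_in[OF x(1)] q] unfolding unit_map_def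
          by (rule act_finsum[OF A dA(2)[OF q]]) (rule act_in[OF dA(2) A \<pi>_in[OF dA(1) _ x(1)]])
        also have "\<dots> = component (u A) (u A) (e A) q x"
          unfolding component_def
        proof (rule Q.sum_cong)
          fix p assume p: "p \<in> P (u A)"
          have "lin_cmp C (u (d (u A) p)) (u A) (u (d (u A) q))
              (\<alpha>\<^sub>e A q)
              (\<beta>\<^sub>e A p) = entry (u A) (u A) (e A) q p"
            using A dA p q u_in by (simp add: entry_def C.lin_cmp_assoc)
              (simp flip: C.lin_cmp_assoc add: e_idem)
          then show "act A (d (u A) q)
            (\<alpha>\<^sub>e A q) (act (d (u A) p) A
            (\<beta>\<^sub>e A p) (\<pi> (u A) p x)) =
            act (d (u A) p) (d (u A) q) (entry (u A) (u A) (e A) q p) (\<pi> (u A) p x)"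
            using A dA p q x \<pi>_in \<alpha>_e_corner e_\<beta>_corner by (subst act_act) auto
          show "act (d (u A) p) (d (u A) q) (entry (u A) (u A) (e A) q p) (\<pi> (u A) p x)
            \<in> carrier (FObj N (d (u A) q))"
            using A dA p q x \<pi>_in by (intro act_in) auto
        qed
        also have "\<dots> = \<pi> (u A) q x"
          using \<pi>_lin_map[OF dA(1,1) q x(1) e_in_lin] x(2) by simp
        finally show "\<pi> (u A) q (s (unit_map A x)) = \<pi> (u A) q x" .
      qed
    qed
    show "unit_map A ` fixed ind A \<subseteq> carrier (FObj N A)"
      using unit_map_in fixed_W by auto
    show "s ` carrier (FObj N A) \<subseteq> fixed ind A"
    proof (intro image_subsetI)
      fix y assume y: "y \<in> carrier (FObj N A)"
      have "lin_map C ind (u A) (u A) (e A) (s y) = s y"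
      proof (rule \<pi>_inj[OF dA(1) _ s_in[OF y]])
        show "lin_map C ind (u A) (u A) (e A) (s y) \<in> carrier (W (u A))"
          using ind.M.lin_map_in[OF dA(1,1), of "s y" "e A"] s_in[OF y] by (simp add: ind_def)
        fix q assume q: "q \<in> P (u A)"
        have "\<alpha>\<^sub>e A q =
            lin_cmp C (u A) (u A) (u (d (u A) q)) (\<alpha>\<^sub>e A q) (e A)"
          using A dA q u_in by (simp flip: C.lin_cmp_assoc add: e_idem)
        also have "\<dots> = (\<lambda>k. \<Sum>p\<in>P (u A). lin_cmp C (u A) (u (d (u A) p)) (u (d (u A) q))
           (entry (u A) (u A) (e A) q p)
           (\<alpha>\<^sub>e A p) k)"
          unfolding entry_def using A dA q u_in by (intro insert_identity[symmetric] C.lin_cmp_in) auto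
        finally have eq: "(\<lambda>k. \<Sum>p\<in>P (u A). lin_cmp C (u A) (u (d (u A) p)) (u (d (u A) q))
           (entry (u A) (u A) (e A) q p)
           (\<alpha>\<^sub>e A p) k) =
           \<alpha>\<^sub>e A q" by (rule sym)
        interpret Q: vec_obj "FObj N (d (u A) q)" using dA q by (intro N_vec)
        have "component (u A) (u A) (e A) q (s y) = finsum (FObj N (d (u A) q)) (\<lambda>p. act (d (u A) p) (d (u A) q)
            (entry (u A) (u A) (e A) q p) (act A (d (u A) p)
            (\<alpha>\<^sub>e A p) y)) (P (u A))"
          unfolding component_def using A dA q y by (intro Q.sum_cong) (auto simp: s intro!: act_in)
        also have "\<dots> = act A (d (u A) q) (\<alpha>\<^sub>e A q) y"
          using A dA q y finite_P \<alpha>_e_corner entry_corner by (intro act_act_sum eq) auto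
        finally show "\<pi> (u A) q (lin_map C ind (u A) (u A) (e A) (s y)) = \<pi> (u A) q (s y)"
          using \<pi>_lin_map[OF dA(1,1) q s_in[OF y] e_in_lin] s[OF y q] by simp
      qed
      then show "s y \<in> fixed ind A"
        using s_in[OF y] by (simp add: fixed_def ind_def)
    qed
  qed
qed

end

lemma unit_map_nat:
  assumes A: "A \<in> Obj D" "B \<in> Obj D" "\<phi> \<in> Hom D A B" and x: "x \<in> fixed ind A"
  shows "unit_map B (lin_map C ind (u A) (u B) (j A B \<phi>) x) = FHom N A B \<phi> (unit_map A x)"
proof -
  interpret V: vec_obj "FObj N B" by (rule N.vec_obj_at[OF A(2)])
  have dA: "u A \<in> Obj C" "\<And>p. p \<in> P (u A) \<Longrightarrow> d (u A) p \<in> Obj D"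
    "u B \<in> Obj C" "\<And>p. p \<in> P (u B) \<Longrightarrow> d (u B) p \<in> Obj D" using A u_in d_in by auto
  have xW: "x \<in> carrier (W (u A))" using x by (rule fixed_W)
  note facts = A(1,2) dA xW \<pi>_in finite_P entry_corner e_\<beta>_corner j_in[OF A] j_corner[OF A] u_in
  have "unit_map B (lin_map C ind (u A) (u B) (j A B \<phi>) x) =
    finsum (FObj N B) (\<lambda>q. finsum (FObj N B) (\<lambda>p. act (d (u B) q) B
      (\<beta>\<^sub>e B q)
      (act (d (u A) p) (d (u B) q) (entry (u A) (u B) (j A B \<phi>) q p) (\<pi> (u A) p x))) (P (u A))) (P (u B))"
    unfolding unit_map_def using facts
    by (intro V.sum_cong) (auto simp: \<pi>_lin_map component_def act_finsum act_in intro!: V.sum_in act_in)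
  also have "\<dots> = finsum (FObj N B) (\<lambda>p. finsum (FObj N B) (\<lambda>q. act (d (u B) q) B
      (\<beta>\<^sub>e B q)
      (act (d (u A) p) (d (u B) q) (entry (u A) (u B) (j A B \<phi>) q p) (\<pi> (u A) p x))) (P (u B))) (P (u A))"
    using facts by (intro V.sum_swap) (auto intro!: act_in)
  also have "\<dots> = finsum (FObj N B) (\<lambda>p. act A B (j A B \<phi>)
      (act (d (u A) p) A (\<beta>\<^sub>e A p) (\<pi> (u A) p x))) (P (u A))"
  proof (rule V.sum_cong)
    fix p assume p: "p \<in> P (u A)"
    have "(\<lambda>k. \<Sum>q\<in>P (u B). lin_cmp C (u (d (u A) p)) (u (d (u B) q)) (u B)
        (\<beta>\<^sub>e B q) (entry (u A) (u B) (j A B \<phi>) q p) k) =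
        (\<lambda>k. \<Sum>q\<in>P (u B). lin_cmp C (u (d (u A) p)) (u (d (u B) q)) (u B)
        (\<beta>\<^sub>e B q)
        (lin_cmp C (u (d (u A) p)) (u B) (u (d (u B) q)) (\<alpha> (u B) q) (lin_cmp C (u (d (u A) p)) (u A) (u B) (j A B \<phi>) (\<beta> (u A) p))) k)"
      using facts p by (intro ext sum.cong refl) (simp add: entry_def C.lin_cmp_assoc)
    also have "\<dots> = lin_cmp C (u (d (u A) p)) (u B) (u B) (e B) (lin_cmp C (u (d (u A) p)) (u A) (u B) (j A B \<phi>) (\<beta> (u A) p))"
      using facts p e_in by (intro insert_identity) auto
    also have "\<dots> = lin_cmp C (u (d (u A) p)) (u A) (u B) (j A B \<phi>) (\<beta> (u A) p)"
      using facts p by (simp add: C.lin_cmp_assoc j_e[OF A])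
    also have "\<dots> = lin_cmp C (u (d (u A) p)) (u A) (u B) (j A B \<phi>)
        (\<beta>\<^sub>e A p)"
      using facts p by (simp add: C.lin_cmp_assoc j_e[OF A])
    finally have eq: "(\<lambda>k. \<Sum>q\<in>P (u B). lin_cmp C (u (d (u A) p)) (u (d (u B) q)) (u B)
        (\<beta>\<^sub>e B q) (entry (u A) (u B) (j A B \<phi>) q p) k) =
        lin_cmp C (u (d (u A) p)) (u A) (u B) (j A B \<phi>)
        (\<beta>\<^sub>e A p)" .
    show "finsum (FObj N B) (\<lambda>q. act (d (u B) q) B
      (\<beta>\<^sub>e B q)
      (act (d (u A) p) (d (u B) q) (entry (u A) (u B) (j A B \<phi>) q p) (\<pi> (u A) p x))) (P (u B)) =
      act A B (j A B \<phi>) (act (d (u A) p) A (\<beta>\<^sub>e A p) (\<pi> (u A) p x))"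
      using facts p by (subst act_act) (auto intro!: act_act_sum eq)
    show "act A B (j A B \<phi>) (act (d (u A) p) A (\<beta>\<^sub>e A p) (\<pi> (u A) p x))
      \<in> carrier (FObj N B)"
      using facts p by (intro act_in) auto
  qed
  also have "\<dots> = act A B (j A B \<phi>) (unit_map A x)"
    unfolding unit_map_def using facts by (intro act_finsum[symmetric] act_in) auto
  also have "\<dots> = FHom N A B \<phi> (unit_map A x)"
    using A xW by (intro act_j unit_map_in)
  finally show ?thesis .
qed

lemma corner_ind_iso: "\<exists>\<eta>. is_iso (functor_cat D Vec) (corner_rep ind) N \<eta>"
proof -
  define \<eta> where "\<eta> = (\<lambda>A \<in> Obj D. restrict (unit_map A) (fixed ind A))"
  have hom: "\<eta> A \<in> Hom Vec (FObj (corner_rep ind) A) (FObj N A)" if "A \<in> Obj D" for A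
    using unit_map_Hom[OF that] that by (simp add: \<eta>_def)
  have "\<eta> \<in> nat_trans D Vec (corner_rep ind) N"
  proof (rule nat_transI[OF D.category_axioms ind.is_functor_corner N.is_functor_axioms hom])
    show "\<eta> B (FHom (corner_rep ind) A B \<phi> x) = FHom N A B \<phi> (\<eta> A x)"
      if a: "A \<in> Obj D" "B \<in> Obj D" "\<phi> \<in> Hom D A B" "x \<in> carrier (FObj (corner_rep ind) A)" for A B \<phi> x
    proof -
      have x: "x \<in> fixed ind A" using a by simp
      have "lin_map C ind (u A) (u B) (j A B \<phi>) x \<in> fixed ind B"
        using a x u_in by (intro ind.lin_map_fixed) (auto simp: j_e fixed_W)
      then show ?thesis using a x by (simp add: \<eta>_def ind.corner_FHom unit_map_nat)
    qed
  qed (auto simp: \<eta>_def extensional_def)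
  moreover have "is_iso Vec (FObj (corner_rep ind) A) (FObj N A) (\<eta> A)" if A: "A \<in> Obj D" for A
  proof (rule is_iso_VecI[OF ind.corner_Obj[OF A] N.FObj_in_Obj[OF A] hom[OF A]])
    show "bij_betw (\<eta> A) (carrier (FObj (corner_rep ind) A)) (carrier (FObj N A))"
      using unit_map_bij[OF A] A bij_betw_cong[of "fixed ind A" "\<eta> A" "unit_map A"]
      by (auto simp: \<eta>_def)
  qed
  ultimately show ?thesis
    using is_iso_functor_cat[OF D.category_axioms category_Vec ind.is_functor_corner N.is_functor_axioms]
    by blast
qed

end

context morita_data
begin

lemma essentially_surjective_corner:
  "essentially_surjective (functor_cat C Vec) (functor_cat D Vec)
     (corner_ftor :: (('o1, 'm1, ('k, 'v::infinite) module, 'v \<Rightarrow> 'v) ftor, _, _, _) ftor)"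
  unfolding essentially_surjective_def
proof
  fix N :: "('o2, 'm2, ('k, 'v) module, 'v \<Rightarrow> 'v) ftor"
  assume "N \<in> Obj (functor_cat D Vec)"
  then interpret N: is_functor D Vec N by (simp add: functor_cat_def)
  have "\<forall>S \<in> Obj C. \<exists>W\<pi>. fst W\<pi> \<in> Obj Vec \<and> (\<forall>p \<in> P S. snd W\<pi> p \<in> Hom Vec (fst W\<pi>) (FObj N (d S p))) \<and>
    (\<forall>x \<in> (\<Pi>\<^sub>E p \<in> P S. carrier (FObj N (d S p))). \<exists>w \<in> carrier (fst W\<pi>). \<forall>p \<in> P S. snd W\<pi> p w = x p) \<and>
    (\<forall>w \<in> carrier (fst W\<pi>). \<forall>w' \<in> carrier (fst W\<pi>). (\<forall>p \<in> P S. snd W\<pi> p w = snd W\<pi> p w') \<longrightarrow> w = w')"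
  proof
    fix S assume S: "S \<in> Obj C"
    show "\<exists>W\<pi>. fst W\<pi> \<in> Obj Vec \<and> (\<forall>p \<in> P S. snd W\<pi> p \<in> Hom Vec (fst W\<pi>) (FObj N (d S p))) \<and>
    (\<forall>x \<in> (\<Pi>\<^sub>E p \<in> P S. carrier (FObj N (d S p))). \<exists>w \<in> carrier (fst W\<pi>). \<forall>p \<in> P S. snd W\<pi> p w = x p) \<and>
    (\<forall>w \<in> carrier (fst W\<pi>). \<forall>w' \<in> carrier (fst W\<pi>). (\<forall>p \<in> P S. snd W\<pi> p w = snd W\<pi> p w') \<longrightarrow> w = w')"
      using Vec_finite_product[OF finite_P[OF S], of "\<lambda>p. FObj N (d S p)"] N.FObj_in_Obj d_in[OF S] by auto
  qed
  then obtain W\<pi> where W\<pi>: "\<forall>S \<in> Obj C. fst (W\<pi> S) \<in> Obj Vec \<and>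
    (\<forall>p \<in> P S. snd (W\<pi> S) p \<in> Hom Vec (fst (W\<pi> S)) (FObj N (d S p))) \<and>
    (\<forall>x \<in> (\<Pi>\<^sub>E p \<in> P S. carrier (FObj N (d S p))). \<exists>w \<in> carrier (fst (W\<pi> S)). \<forall>p \<in> P S. snd (W\<pi> S) p w = x p) \<and>
    (\<forall>w \<in> carrier (fst (W\<pi> S)). \<forall>w' \<in> carrier (fst (W\<pi> S)). (\<forall>p \<in> P S. snd (W\<pi> S) p w = snd (W\<pi> S) p w') \<longrightarrow> w = w')"
    unfolding bchoice_iff by blast
  interpret I: induced_rep C D u j P d \<alpha> \<beta> N "\<lambda>S. fst (W\<pi> S)" "\<lambda>S. snd (W\<pi> S)"
  proof (intro induced_rep.intro induced_rep_axioms.intro linear_representation.intro morita_data_axioms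
      D.hom_finite_category_axioms N.is_functor_axioms)
    fix S assume S: "S \<in> Obj C"
    show "fst (W\<pi> S) \<in> Obj Vec" using W\<pi> S by blast
    show "snd (W\<pi> S) p \<in> Hom Vec (fst (W\<pi> S)) (FObj N (d S p))" if "p \<in> P S" for p
      using W\<pi> S that by blast
    show "\<exists>w \<in> carrier (fst (W\<pi> S)). \<forall>p \<in> P S. snd (W\<pi> S) p w = x p"
      if "x \<in> (\<Pi>\<^sub>E p \<in> P S. carrier (FObj N (d S p)))" for x
      using W\<pi> S that by blast
    show "w = w'" if "w \<in> carrier (fst (W\<pi> S))" "w' \<in> carrier (fst (W\<pi> S))"
      "\<And>p. p \<in> P S \<Longrightarrow> snd (W\<pi> S) p w = snd (W\<pi> S) p w'" for w w'
      using W\<pi> S that by blast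
  qed
  show "\<exists>M \<in> Obj (functor_cat C Vec). \<exists>f. is_iso (functor_cat D Vec) (FObj corner_ftor M) N f"
    using I.corner_ind_iso I.is_functor_ind
    by (intro bexI[of _ I.ind]) (auto simp: functor_cat_def corner_ftor_def)
qed

theorem morita_equivalence:
  "equivalent_categories (Rep TYPE('k) TYPE('v::infinite) C) (Rep TYPE('k) TYPE('v) D)"
  unfolding Rep_def
  by (rule equivalent_categories_if_fully_faithful
      [OF is_functor_corner_ftor fully_faithful_corner essentially_surjective_corner])

end


section \<open>Pure tensors in the linearised category\<close>

text \<open>
  The product of the group algebra.
\<close>

definition group_conv :: "('g, 'b) monoid_scheme \<Rightarrow> ('g \<Rightarrow> 'k::field) \<Rightarrow> ('g \<Rightarrow> 'k) \<Rightarrow> 'g \<Rightarrow> 'k" where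
  "group_conv G x y g = (\<Sum>h \<in> carrier G. x h * y (inv\<^bsub>G\<^esub> h \<otimes>\<^bsub>G\<^esub> g))"

text \<open>
  The element of the linearised category supported on the morphisms with underlying map \<open>f\<close> whose
  coefficients are the pure tensor of the \<open>a s\<close> in the tensor power of the group algebra.
\<close>

definition tensor :: "('g, 'b) monoid_scheme \<Rightarrow> 's set \<Rightarrow> ('s \<Rightarrow> 's) \<Rightarrow> ('s \<Rightarrow> 'g \<Rightarrow> 'k::field)
    \<Rightarrow> ('s \<Rightarrow> 's) \<times> ('s \<Rightarrow> 'g) \<Rightarrow> 'k" where
  "tensor G S f a = (\<lambda>(f', \<rho>). if f' = f \<and> \<rho> \<in> S \<rightarrow>\<^sub>E carrier G then \<Prod>s\<in>S. a s (\<rho> s) else 0)"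

locale finite_group = group G for G :: "('g, 'b) monoid_scheme" (structure) +
  assumes finite_G: "finite (carrier G)"
begin

definition inj_maps :: "'s set \<Rightarrow> 's set \<Rightarrow> ('s \<Rightarrow> 's) set" where
  "inj_maps S T = {f \<in> S \<rightarrow>\<^sub>E T. inj_on f S}"

lemma Hom_FI_G: "Hom (FI\<^sub>G G) S T = inj_maps S T \<times> (S \<rightarrow>\<^sub>E carrier G)"
  by (simp add: FI\<^sub>G_def inj_maps_def)

lemma Cmp_FI_G:
  "Cmp (FI\<^sub>G G) S T U (g, \<sigma>) (f, \<rho>) = (compose S g f, \<lambda>s \<in> S. \<sigma> (f s) \<otimes> \<rho> s)"
  by (simp add: FI\<^sub>G_def)

lemma finite_inj_maps: "finite S \<Longrightarrow> finite T \<Longrightarrow> finite (inj_maps S T)"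
  unfolding inj_maps_def by (rule finite_subset[OF _ finite_PiE[of S "\<lambda>_. T"]]) auto

lemma hom_finite_FI_G: "hom_finite_category (FI\<^sub>G G)"
  using finite_G
  by (intro hom_finite_category.intro hom_finite_category_axioms.intro category_FI_G is_group)
    (auto simp: Hom_FI_G finite_inj_maps FI\<^sub>G_def intro!: finite_cartesian_product finite_PiE)

lemma sum_tensor:
  assumes "finite S" "finite T" "f \<in> inj_maps S T"
  shows "(\<Sum>h \<in> Hom (FI\<^sub>G G) S T. tensor G S f a h * F h) =
    (\<Sum>\<rho> \<in> S \<rightarrow>\<^sub>E carrier G. (\<Prod>s\<in>S. a s (\<rho> s)) * F (f, \<rho>))"
proof -
  have "(\<Sum>h \<in> Hom (FI\<^sub>G G) S T. tensor G S f a h * F h) =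
    (\<Sum>f' \<in> inj_maps S T. if f' = f then (\<Sum>\<rho> \<in> S \<rightarrow>\<^sub>E carrier G. (\<Prod>s\<in>S. a s (\<rho> s)) * F (f, \<rho>)) else 0)"
    unfolding Hom_FI_G sum.cartesian_product' by (intro sum.cong refl) (auto simp: tensor_def)
  then show ?thesis using assms finite_inj_maps[of S T] by simp
qed

lemma tensor_in: "f \<in> inj_maps S T \<Longrightarrow> tensor G S f a \<in> lin_hom (FI\<^sub>G G) S T"
  by (auto simp: lin_hom_def tensor_def Hom_FI_G)

lemma tensor_cong:
  "f = f' \<Longrightarrow> (\<And>s g. s \<in> S \<Longrightarrow> g \<in> carrier G \<Longrightarrow> a s g = b s g) \<Longrightarrow> tensor G S f a = tensor G S f' b"
  unfolding tensor_def by (auto intro!: prod.cong simp: PiE_iff fun_eq_iff)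

lemma tensor_zero:
  assumes "finite S" "s \<in> S" "\<And>g. g \<in> carrier G \<Longrightarrow> a s g = 0"
  shows "tensor G S f a = (\<lambda>k. 0)"
  unfolding tensor_def using assms by (auto simp: fun_eq_iff PiE_iff intro!: prod_zero)

lemma tensor_scale: "tensor G S f (\<lambda>s g. c s * a s g) = (\<lambda>k. (\<Prod>s\<in>S. c s) * tensor G S f a k)"
  by (auto simp: tensor_def prod.distrib)

lemma tensor_dirac:
  fixes S :: "'s set"
  assumes "finite S" "\<rho> \<in> S \<rightarrow>\<^sub>E carrier G"
  shows "(dirac (f, \<rho>) :: _ \<Rightarrow> 'k::field) = tensor G S f (\<lambda>s g. of_bool (\<rho> s = g))"
proof
  fix k :: "('s \<Rightarrow> 's) \<times> ('s \<Rightarrow> 'g)"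
  obtain f' \<rho>' where k: "k = (f', \<rho>')" by (cases k)
  have "(\<Prod>s\<in>S. of_bool (\<rho> s = \<rho>' s) :: 'k) = of_bool (\<rho> = \<rho>')" if \<rho>': "\<rho>' \<in> S \<rightarrow>\<^sub>E carrier G"
  proof (cases "\<rho> = \<rho>'")
    case False
    then obtain s where "s \<in> S" "\<rho> s \<noteq> \<rho>' s" using PiE_ext[OF assms(2) \<rho>'] by blast
    then show ?thesis using False assms(1) by (auto intro!: prod_zero)
  qed simp
  then show "dirac (f, \<rho>) k = tensor G S f (\<lambda>s g. of_bool (\<rho> s = g)) k"
    using assms unfolding k dirac_def tensor_def by auto
qed

lemma tensor_sum:
  fixes S :: "'s set"
  assumes "finite S" "finite J"
  shows "(\<lambda>k. \<Sum>p \<in> S \<rightarrow>\<^sub>E J. tensor G S f (\<lambda>s. a s (p s)) k) = tensor G S f (\<lambda>s g. \<Sum>l\<in>J. a s l g)"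
proof
  fix k :: "('s \<Rightarrow> 's) \<times> ('s \<Rightarrow> 'g)"
  obtain f' \<rho>' where k: "k = (f', \<rho>')" by (cases k)
  have "(\<Prod>s\<in>S. \<Sum>l\<in>J. a s l (\<rho>' s)) = (\<Sum>p \<in> S \<rightarrow>\<^sub>E J. \<Prod>s\<in>S. a s (p s) (\<rho>' s))"
    using assms by (intro prod_sum_PiE) auto
  then show "(\<Sum>p \<in> S \<rightarrow>\<^sub>E J. tensor G S f (\<lambda>s. a s (p s)) k) = tensor G S f (\<lambda>s g. \<Sum>l\<in>J. a s l g) k"
    by (cases "f' = f"; cases "\<rho>' \<in> S \<rightarrow>\<^sub>E carrier G") (simp_all add: k tensor_def)
qed

text \<open>
  The labels of the composite at \<open>s\<close> only involve the factors of \<open>a\<close> at \<open>s\<close> and of \<open>b\<close> at \<open>f s\<close>, which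
  are convolved.  The factors of \<open>b\<close> outside the image of \<open>f\<close> do not influence the composite, so
  their coefficients are summed.
\<close>

lemma tensor_cmp:
  fixes S T U :: "'s::infinite set" and a b :: "'s \<Rightarrow> 'g \<Rightarrow> 'k::field"
  assumes fin: "finite S" "finite T" "finite U" and f: "f \<in> inj_maps S T" and g: "g \<in> inj_maps T U"
  shows "lin_cmp (FI\<^sub>G G) S T U (tensor G T g b) (tensor G S f a) =
    (\<lambda>k. (\<Prod>t \<in> T - f ` S. \<Sum>x \<in> carrier G. b t x) *
       tensor G S (compose S g f) (\<lambda>s. group_conv G (b (f s)) (a s)) k)"
proof
  fix k :: "('s \<Rightarrow> 's) \<times> ('s \<Rightarrow> 'g)"
  obtain f' \<tau> where k: "k = (f', \<tau>)" by (cases k)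
  let ?m = "\<lambda>\<sigma> \<rho>. \<lambda>s \<in> S. \<sigma> (f s) \<otimes> \<rho> s"
  have fS: "f ` S \<subseteq> T" "inj_on f S" using f by (auto simp: inj_maps_def)
  have eq: "lin_cmp (FI\<^sub>G G) S T U (tensor G T g b) (tensor G S f a) k =
    (\<Sum>\<sigma> \<in> T \<rightarrow>\<^sub>E carrier G. (\<Prod>t\<in>T. b t (\<sigma> t)) * (\<Sum>\<rho> \<in> S \<rightarrow>\<^sub>E carrier G. (\<Prod>s\<in>S. a s (\<rho> s)) *
       of_bool ((compose S g f, ?m \<sigma> \<rho>) = k)))"
  proof -
    have "lin_cmp (FI\<^sub>G G) S T U (tensor G T g b) (tensor G S f a) k =
      (\<Sum>g' \<in> Hom (FI\<^sub>G G) T U. tensor G T g b g' * (\<Sum>f' \<in> Hom (FI\<^sub>G G) S T. tensor G S f a f' *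
        of_bool (Cmp (FI\<^sub>G G) S T U g' f' = k)))"
      by (simp add: lin_cmp_def sum_distrib_left mult.assoc)
    then show ?thesis using fin f g by (simp add: sum_tensor Cmp_FI_G)
  qed
  show "lin_cmp (FI\<^sub>G G) S T U (tensor G T g b) (tensor G S f a) k =
    (\<Prod>t \<in> T - f ` S. \<Sum>x \<in> carrier G. b t x) *
       tensor G S (compose S g f) (\<lambda>s. group_conv G (b (f s)) (a s)) k"
  proof (cases "f' = compose S g f \<and> \<tau> \<in> S \<rightarrow>\<^sub>E carrier G")
    case False
    have "of_bool ((compose S g f, ?m \<sigma> \<rho>) = k) = (0 :: 'k)"
      if "\<sigma> \<in> T \<rightarrow>\<^sub>E carrier G" "\<rho> \<in> S \<rightarrow>\<^sub>E carrier G" for \<sigma> \<rho>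
    proof -
      have "?m \<sigma> \<rho> \<in> S \<rightarrow>\<^sub>E carrier G" using that fS by (auto simp: PiE_iff)
      then show ?thesis using False k by auto
    qed
    then have "lin_cmp (FI\<^sub>G G) S T U (tensor G T g b) (tensor G S f a) k = 0"
      unfolding eq by (intro sum.neutral ballI) simp
    then show ?thesis using False by (auto simp: k tensor_def)
  next
    case True
    have inner: "(\<Sum>\<rho> \<in> S \<rightarrow>\<^sub>E carrier G. (\<Prod>s\<in>S. a s (\<rho> s)) * of_bool ((compose S g f, ?m \<sigma> \<rho>) = k)) =
        (\<Prod>s\<in>S. a s (inv (\<sigma> (f s)) \<otimes> \<tau> s))" if \<sigma>: "\<sigma> \<in> T \<rightarrow>\<^sub>E carrier G" for \<sigma>
    proof -
      have "(\<Prod>s\<in>S. a s (\<rho> s)) * of_bool ((compose S g f, ?m \<sigma> \<rho>) = k) =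
         (\<Prod>s\<in>S. a s (\<rho> s) * of_bool (inv (\<sigma> (f s)) \<otimes> \<tau> s = \<rho> s))" if \<rho>: "\<rho> \<in> S \<rightarrow>\<^sub>E carrier G" for \<rho>
      proof (cases "?m \<sigma> \<rho> = \<tau>")
        case mt: True
        have "inv (\<sigma> (f s)) \<otimes> \<tau> s = \<rho> s" if "s \<in> S" for s
        proof -
          have "\<sigma> (f s) \<in> carrier G" "\<rho> s \<in> carrier G" using \<sigma> \<rho> fS that by (auto simp: PiE_iff)
          moreover have "\<tau> s = \<sigma> (f s) \<otimes> \<rho> s" using mt that by auto
          ultimately show ?thesis by (simp add: m_assoc[symmetric])
        qed
        then show ?thesis using mt True k by (auto intro!: prod.cong)
      next
        case mf: False
        then obtain s where s: "s \<in> S" "\<sigma> (f s) \<otimes> \<rho> s \<noteq> \<tau> s"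
          using True extensionalityI[of "?m \<sigma> \<rho>" S \<tau>] by (auto simp: PiE_iff)
        have "inv (\<sigma> (f s)) \<otimes> \<tau> s \<noteq> \<rho> s"
        proof
          assume *: "inv (\<sigma> (f s)) \<otimes> \<tau> s = \<rho> s"
          have "\<sigma> (f s) \<in> carrier G" "\<tau> s \<in> carrier G" using \<sigma> True fS s by (auto simp: PiE_iff)
          then show False using s(2) by (simp flip: * add: m_assoc[symmetric])
        qed
        then have "(\<Prod>s\<in>S. a s (\<rho> s) * of_bool (inv (\<sigma> (f s)) \<otimes> \<tau> s = \<rho> s)) = 0"
          using s fin by (intro prod_zero) auto
        then show ?thesis using mf k by auto
      qed
      then have "(\<Sum>\<rho> \<in> S \<rightarrow>\<^sub>E carrier G. (\<Prod>s\<in>S. a s (\<rho> s)) * of_bool ((compose S g f, ?m \<sigma> \<rho>) = k)) =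
        (\<Sum>\<rho> \<in> S \<rightarrow>\<^sub>E carrier G. \<Prod>s\<in>S. a s (\<rho> s) * of_bool (inv (\<sigma> (f s)) \<otimes> \<tau> s = \<rho> s))"
        by (intro sum.cong) auto
      also have "\<dots> = (\<Prod>s\<in>S. \<Sum>x\<in>carrier G. a s x * of_bool (inv (\<sigma> (f s)) \<otimes> \<tau> s = x))"
        using fin finite_G by (intro prod_sum_PiE[symmetric]) auto
      also have "\<dots> = (\<Prod>s\<in>S. a s (inv (\<sigma> (f s)) \<otimes> \<tau> s))"
      proof (intro prod.cong refl)
        fix s assume "s \<in> S"
        then have "\<sigma> (f s) \<in> carrier G" "\<tau> s \<in> carrier G" using \<sigma> True fS by (auto simp: PiE_iff)
        then show "(\<Sum>x\<in>carrier G. a s x * of_bool (inv (\<sigma> (f s)) \<otimes> \<tau> s = x)) = a s (inv (\<sigma> (f s)) \<otimes> \<tau> s)"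
          using finite_G by (simp add: sum_kronecker)
      qed
      finally show ?thesis .
    qed
    \<comment> \<open>For given labels of the second morphism and of the composite, those of the
      first are determined; so the double sum is a sum over the second labels of a product over \<open>T\<close>.\<close>
    define F where "F t x = b t x * (if t \<in> f ` S then
      a (inv_into S f t) (inv x \<otimes> \<tau> (inv_into S f t)) else 1)" for t x
    have "lin_cmp (FI\<^sub>G G) S T U (tensor G T g b) (tensor G S f a) k =
      (\<Sum>\<sigma> \<in> T \<rightarrow>\<^sub>E carrier G. \<Prod>t\<in>T. F t (\<sigma> t))"
      unfolding eq
    proof (intro sum.cong refl)
      fix \<sigma> assume \<sigma>: "\<sigma> \<in> T \<rightarrow>\<^sub>E carrier G"
      have "(\<Prod>s\<in>S. a s (inv (\<sigma> (f s)) \<otimes> \<tau> s)) =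
        (\<Prod>t \<in> f ` S. a (inv_into S f t) (inv (\<sigma> t) \<otimes> \<tau> (inv_into S f t)))"
        using fS by (simp add: prod.reindex)
      also have "\<dots> = (\<Prod>t\<in>T. if t \<in> f ` S then a (inv_into S f t) (inv (\<sigma> t) \<otimes> \<tau> (inv_into S f t)) else 1)"
        using fin fS by (intro prod.mono_neutral_cong_left) auto
      finally show "(\<Prod>t\<in>T. b t (\<sigma> t)) * (\<Sum>\<rho> \<in> S \<rightarrow>\<^sub>E carrier G. (\<Prod>s\<in>S. a s (\<rho> s)) *
          of_bool ((compose S g f, ?m \<sigma> \<rho>) = k)) = (\<Prod>t\<in>T. F t (\<sigma> t))"
        using inner[OF \<sigma>] by (simp add: F_def prod.distrib)
    qed
    also have "\<dots> = (\<Prod>t\<in>T. \<Sum>x\<in>carrier G. F t x)"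
      using fin finite_G by (intro prod_sum_PiE[symmetric]) auto
    also have "\<dots> = (\<Prod>t \<in> T - f ` S. \<Sum>x\<in>carrier G. F t x) * (\<Prod>t \<in> f ` S. \<Sum>x\<in>carrier G. F t x)"
      using fin fS by (simp add: prod.subset_diff)
    also have "(\<Prod>t \<in> T - f ` S. \<Sum>x\<in>carrier G. F t x) = (\<Prod>t \<in> T - f ` S. \<Sum>x\<in>carrier G. b t x)"
      by (intro prod.cong refl) (auto simp: F_def)
    also have "(\<Prod>t \<in> f ` S. \<Sum>x\<in>carrier G. F t x) = (\<Prod>s\<in>S. group_conv G (b (f s)) (a s) (\<tau> s))"
      using fS by (simp add: prod.reindex F_def group_conv_def)
    finally show ?thesis using True by (simp add: k tensor_def)
  qed
qed

end

section \<open>Colourings\<close>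

text \<open>
  Objects and morphisms of \<open>FI \<times> FB\<^sup>r\<close> are treated uniformly as tuples indexed by \<open>{..r}\<close>; index \<open>0\<close> is
  the factor \<open>FI\<close>.
\<close>

definition part :: "'a \<times> (nat \<Rightarrow> 'a) \<Rightarrow> nat \<Rightarrow> 'a" where
  "part A i = (case i of 0 \<Rightarrow> fst A | Suc k \<Rightarrow> snd A k)"

definition from_parts :: "nat \<Rightarrow> (nat \<Rightarrow> 'a) \<Rightarrow> 'a \<times> (nat \<Rightarrow> 'a)" where
  "from_parts r F = (F 0, \<lambda>k \<in> {..<r}. F (Suc k))"

abbreviation FIFB :: "nat \<Rightarrow> ('s::infinite set \<times> (nat \<Rightarrow> 's set), ('s \<Rightarrow> 's) \<times> (nat \<Rightarrow> 's \<Rightarrow> 's)) cat" where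
  "FIFB r \<equiv> prod_cat FI (power_cat FB r)"

lemma part_from_parts: "i \<le> r \<Longrightarrow> part (from_parts r F) i = F i"
  by (cases i) (auto simp: part_def from_parts_def)

lemma part_simps [simp]: "part A 0 = fst A" "part A (Suc k) = snd A k"
  by (simp_all add: part_def)

lemma part_eqI:
  assumes "snd A \<in> extensional {..<r}" "snd B \<in> extensional {..<r}" "\<And>i. i \<le> r \<Longrightarrow> part A i = part B i"
  shows "A = B"
proof (rule prod_eqI)
  show "fst A = fst B" using assms(3)[of 0] by simp
  show "snd A = snd B"
    by (rule extensionalityI[OF assms(1,2)]) (use assms(3)[of "Suc _"] in auto)
qed

lemma all_le_Suc: "(\<forall>i \<le> r. Q i) \<longleftrightarrow> Q 0 \<and> (\<forall>k < r. Q (Suc k))"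
  by (metis Suc_le_eq le0 not0_implies_Suc)

lemma Obj_FIFB: "A \<in> Obj (FIFB r) \<longleftrightarrow> snd A \<in> extensional {..<r} \<and> (\<forall>i \<le> r. finite (part A i))"
  by (cases A) (auto simp: all_le_Suc prod_cat_def power_cat_def FI_def FB_def PiE_iff)

lemma Hom_FIFB: "\<phi> \<in> Hom (FIFB r) A B \<longleftrightarrow> snd \<phi> \<in> extensional {..<r} \<and>
    (\<forall>i \<le> r. part \<phi> i \<in> part A i \<rightarrow>\<^sub>E part B i \<and> inj_on (part \<phi> i) (part A i) \<and>
       (0 < i \<longrightarrow> part \<phi> i ` part A i = part B i))"
  by (cases A; cases B; cases \<phi>)
    (auto simp: all_le_Suc prod_cat_def power_cat_def FI_def FB_def PiE_iff bij_betw_def)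

lemma Idt_FIFB:
  "snd (Idt (FIFB r) A) \<in> extensional {..<r}" "i \<le> r \<Longrightarrow> part (Idt (FIFB r) A) i = (\<lambda>x \<in> part A i. x)"
  by (cases A; cases i; simp add: prod_cat_def power_cat_def FI_def FB_def)+

lemma Cmp_FIFB:
  "snd (Cmp (FIFB r) A B E \<psi> \<phi>) \<in> extensional {..<r}"
  "i \<le> r \<Longrightarrow> part (Cmp (FIFB r) A B E \<psi> \<phi>) i = compose (part A i) (part \<psi> i) (part \<phi> i)"
  by (cases A; cases B; cases E; cases \<psi>; cases \<phi>; cases i; simp add: prod_cat_def power_cat_def FI_def FB_def)+

lemma hom_finite_FIFB: "hom_finite_category (FIFB r)"
proof (intro hom_finite_category.intro hom_finite_category_axioms.intro category_prod_cat
    category_FI category_power_cat category_FB)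
  fix A B :: "'a set \<times> (nat \<Rightarrow> 'a set)"
  assume "A \<in> Obj (FIFB r)" "B \<in> Obj (FIFB r)"
  then have fin: "finite (fst A)" "finite (fst B)" "\<And>k. k < r \<Longrightarrow> finite (snd A k)" "\<And>k. k < r \<Longrightarrow> finite (snd B k)"
    by (auto simp: prod_cat_def power_cat_def FI_def FB_def)
  have "Hom (FIFB r) A B \<subseteq> (fst A \<rightarrow>\<^sub>E fst B) \<times> (\<Pi>\<^sub>E k \<in> {..<r}. snd A k \<rightarrow>\<^sub>E snd B k)"
    by (cases A; cases B)
      (auto simp: prod_cat_def power_cat_def FI_def FB_def PiE_iff intro: extensional_arb)
  moreover have "finite ((fst A \<rightarrow>\<^sub>E fst B) \<times> (\<Pi>\<^sub>E k \<in> {..<r}. snd A k \<rightarrow>\<^sub>E snd B k))"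
    using fin by (intro finite_cartesian_product finite_PiE) auto
  ultimately show "finite (Hom (FIFB r) A B)" by (rule finite_subset)
qed


section \<open>Coloured sets as summands in the linearised category\<close>

text \<open>
  \<open>E i a b\<close> are matrix units of the group algebra for the \<open>i\<close>-th irreducible representation, of degree
  \<open>n i\<close> and with matrix coefficients \<open>R i\<close>.
\<close>

locale matrix_units = finite_group G for G :: "('g, 'b) monoid_scheme" (structure) +
  fixes r :: nat and n :: "nat \<Rightarrow> nat" and E :: "nat \<Rightarrow> nat \<Rightarrow> nat \<Rightarrow> 'g \<Rightarrow> 'k::field"
    and R :: "nat \<Rightarrow> 'g \<Rightarrow> nat \<Rightarrow> nat \<Rightarrow> 'k"
  assumes n_pos: "i \<le> r \<Longrightarrow> 0 < n i"
    and E_E: "i \<le> r \<Longrightarrow> l \<le> r \<Longrightarrow> a < n i \<Longrightarrow> b < n i \<Longrightarrow> c < n l \<Longrightarrow> d < n l \<Longrightarrow> g \<in> carrier G \<Longrightarrow>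
      group_conv G (E i a b) (E l c d) g = (if i = l \<and> b = c then E i a d g else 0)"
    and E_g_E: "i \<le> r \<Longrightarrow> l \<le> r \<Longrightarrow> a < n i \<Longrightarrow> b < n i \<Longrightarrow> c < n l \<Longrightarrow> d < n l \<Longrightarrow>
      h \<in> carrier G \<Longrightarrow> g \<in> carrier G \<Longrightarrow>
      group_conv G (E i a b) (group_conv G (\<lambda>x. of_bool (h = x)) (E l c d)) g =
        (if i = l then R i h b c * E i a d g else 0)"
    and sum_E: "g \<in> carrier G \<Longrightarrow> (\<Sum>i\<le>r. \<Sum>a<n i. E i a a g) = of_bool (\<one> = g)"
    and augmentation_E: "i \<le> r \<Longrightarrow> (\<Sum>g\<in>carrier G. E i 0 0 g) = of_bool (i = 0)"
    and E_nonzero: "i \<le> r \<Longrightarrow> \<exists>g\<in>carrier G. E i 0 0 g \<noteq> 0"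

text \<open>
  The injection \<open>\<iota>\<close> realises disjoint unions: \<open>\<iota> (i, s)\<close> is the copy of \<open>s\<close> of colour \<open>i\<close>.
\<close>

locale coloured_matrix_units = matrix_units G r n E R
  for G :: "('g, 'b) monoid_scheme" (structure)
    and r :: nat and n :: "nat \<Rightarrow> nat" and E :: "nat \<Rightarrow> nat \<Rightarrow> nat \<Rightarrow> 'g \<Rightarrow> 'k::field"
    and R :: "nat \<Rightarrow> 'g \<Rightarrow> nat \<Rightarrow> nat \<Rightarrow> 'k" +
  fixes \<iota> :: "nat \<times> 's::infinite \<Rightarrow> 's"
  assumes inj_\<iota>: "inj \<iota>"
begin

definition colour :: "'s \<Rightarrow> nat" where "colour x = fst (inv_into UNIV \<iota> x)"

definition elem :: "'s \<Rightarrow> 's" where "elem x = snd (inv_into UNIV \<iota> x)"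

lemma colour_\<iota> [simp]: "colour (\<iota> (i, s)) = i" and elem_\<iota> [simp]: "elem (\<iota> (i, s)) = s"
  by (simp_all add: colour_def elem_def inj_\<iota>)

lemma \<iota>_eq [simp]: "\<iota> x = \<iota> y \<longleftrightarrow> x = y"
  using inj_\<iota> by (auto dest: injD)

definition union :: "'s set \<times> (nat \<Rightarrow> 's set) \<Rightarrow> 's set" where
  "union A = \<iota> ` (SIGMA i:{..r}. part A i)"

definition union_map :: "'s set \<times> (nat \<Rightarrow> 's set) \<Rightarrow> ('s \<Rightarrow> 's) \<times> (nat \<Rightarrow> 's \<Rightarrow> 's) \<Rightarrow> 's \<Rightarrow> 's" where
  "union_map A \<phi> = (\<lambda>x \<in> union A. \<iota> (colour x, part \<phi> (colour x) (elem x)))"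

lemma unionE:
  assumes "x \<in> union A" obtains i s where "i \<le> r" "s \<in> part A i" "x = \<iota> (i, s)"
  using assms by (auto simp: union_def)

lemma \<iota>_in_union [simp]: "\<iota> (i, s) \<in> union A \<longleftrightarrow> i \<le> r \<and> s \<in> part A i"
  by (auto simp: union_def)

lemma finite_union: "A \<in> Obj (FIFB r) \<Longrightarrow> finite (union A)"
  by (auto simp: Obj_FIFB union_def)

lemma colour_le: "x \<in> union A \<Longrightarrow> colour x \<le> r"
  by (auto simp: union_def)

lemma union_map_\<iota> [simp]: "i \<le> r \<Longrightarrow> s \<in> part A i \<Longrightarrow> union_map A \<phi> (\<iota> (i, s)) = \<iota> (i, part \<phi> i s)"
  by (simp add: union_map_def)

lemma union_map_colour: "x \<in> union A \<Longrightarrow> colour (union_map A \<phi> x) = colour x"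
  by (simp add: union_map_def)

lemma part_Hom:
  assumes "\<phi> \<in> Hom (FIFB r) A B" "i \<le> r" "s \<in> part A i"
  shows "part \<phi> i s \<in> part B i"
    and "s' \<in> part A i \<Longrightarrow> part \<phi> i s = part \<phi> i s' \<longleftrightarrow> s = s'"
  using assms by (auto simp: Hom_FIFB dest: inj_onD)

lemma union_map_in:
  assumes \<phi>: "\<phi> \<in> Hom (FIFB r) A B"
  shows "union_map A \<phi> \<in> inj_maps (union A) (union B)"
  unfolding inj_maps_def
proof (intro CollectI conjI PiE_I inj_onI)
  show "union_map A \<phi> x \<in> union B" if "x \<in> union A" for x
    using that part_Hom[OF \<phi>] by (auto elim!: unionE)
  show "x = y" if "x \<in> union A" "y \<in> union A" "union_map A \<phi> x = union_map A \<phi> y" for x y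
    using that part_Hom(2)[OF \<phi>] by (auto elim!: unionE)
qed (simp add: union_map_def)

lemma union_map_inj:
  assumes "\<phi> \<in> Hom (FIFB r) A B" "\<psi> \<in> Hom (FIFB r) A B" "union_map A \<phi> = union_map A \<psi>"
  shows "\<phi> = \<psi>"
proof (rule part_eqI)
  fix i assume i: "i \<le> r"
  show "part \<phi> i = part \<psi> i"
  proof (rule extensionalityI)
    show "part \<phi> i \<in> extensional (part A i)" "part \<psi> i \<in> extensional (part A i)"
      using assms i by (auto simp: Hom_FIFB PiE_iff)
    fix s assume "s \<in> part A i"
    then show "part \<phi> i s = part \<psi> i s"
      using fun_cong[OF assms(3), of "\<iota> (i, s)"] i by simp
  qed
qed (use assms in \<open>auto simp: Hom_FIFB\<close>)

lemma union_map_Idt: "union_map A (Idt (FIFB r) A) = (\<lambda>x \<in> union A. x)"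
  by (rule extensionalityI[of _ "union A"])
    (auto simp: union_map_def Idt_FIFB elim!: unionE)

lemma union_map_Cmp:
  assumes "\<phi> \<in> Hom (FIFB r) A B"
  shows "union_map A (Cmp (FIFB r) A B D \<psi> \<phi>) = compose (union A) (union_map B \<psi>) (union_map A \<phi>)"
  by (rule extensionalityI[of _ "union A"])
    (use part_Hom[OF assms] in \<open>auto simp: union_map_def Cmp_FIFB compose_def elim!: unionE\<close>)

lemma union_map_outside:
  assumes \<phi>: "\<phi> \<in> Hom (FIFB r) A B" and y: "y \<in> union B - union_map A \<phi> ` union A"
  shows "colour y = 0"
proof (rule ccontr)
  assume 0: "colour y \<noteq> 0"
  obtain i t where t: "i \<le> r" "t \<in> part B i" "y = \<iota> (i, t)" using y by (auto elim: unionE)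
  then have "t \<in> part \<phi> i ` part A i" using \<phi> 0 by (auto simp: Hom_FIFB)
  then obtain s where "s \<in> part A i" "t = part \<phi> i s" by auto
  then have "y = union_map A \<phi> (\<iota> (i, s))" "\<iota> (i, s) \<in> union A" using t by auto
  then have "y \<in> union_map A \<phi> ` union A" by (rule image_eqI)
  then show False using y by blast
qed

text \<open>
  An injection that preserves colours restricts to an injection on each colour class, and if the
  points outside its image have colour \<open>0\<close>, these restrictions are onto for the other colours.
\<close>

lemma union_map_surj:
  assumes f: "f \<in> inj_maps (union A) (union B)"
    and c: "\<And>x. x \<in> union A \<Longrightarrow> colour (f x) = colour x"
    and out: "\<And>y. y \<in> union B - f ` union A \<Longrightarrow> colour y = 0"
  shows "\<exists>\<phi> \<in> Hom (FIFB r) A B. union_map A \<phi> = f"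
proof -
  define \<phi> where "\<phi> = from_parts r (\<lambda>i. \<lambda>s \<in> part A i. elem (f (\<iota> (i, s))))"
  have f\<iota>: "f (\<iota> (i, s)) = \<iota> (i, elem (f (\<iota> (i, s)))) \<and> elem (f (\<iota> (i, s))) \<in> part B i"
    if "i \<le> r" "s \<in> part A i" for i s
  proof -
    have "f (\<iota> (i, s)) \<in> union B" using f that by (auto simp: inj_maps_def PiE_iff)
    then obtain i' t where t: "i' \<le> r" "t \<in> part B i'" "f (\<iota> (i, s)) = \<iota> (i', t)" by (rule unionE)
    moreover have "i' = i" using c[of "\<iota> (i, s)"] that t by simp
    ultimately show ?thesis by simp
  qed
  have p: "part \<phi> i = (\<lambda>s \<in> part A i. elem (f (\<iota> (i, s))))" if "i \<le> r" for i
    using that by (simp add: \<phi>_def part_from_parts)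
  have "\<phi> \<in> Hom (FIFB r) A B"
    unfolding Hom_FIFB
  proof (intro conjI allI impI)
    show "snd \<phi> \<in> extensional {..<r}" by (simp add: \<phi>_def from_parts_def)
    fix i assume i: "i \<le> r"
    show "part \<phi> i \<in> part A i \<rightarrow>\<^sub>E part B i" using f\<iota> i by (auto simp: p)
    show "inj_on (part \<phi> i) (part A i)"
    proof (rule inj_onI)
      fix s s' assume s: "s \<in> part A i" "s' \<in> part A i" "part \<phi> i s = part \<phi> i s'"
      then have "elem (f (\<iota> (i, s))) = elem (f (\<iota> (i, s')))" using p[OF i] by simp
      then have "\<iota> (i, elem (f (\<iota> (i, s)))) = \<iota> (i, elem (f (\<iota> (i, s'))))" by simp
      then have feq: "f (\<iota> (i, s)) = f (\<iota> (i, s'))"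
        unfolding conjunct1[OF f\<iota>[OF i s(1)], symmetric] conjunct1[OF f\<iota>[OF i s(2)], symmetric] .
      have "\<iota> (i, s) = \<iota> (i, s')"
        by (rule inj_onD[of f "union A"]) (use feq f s i in \<open>auto simp: inj_maps_def\<close>)
      then show "s = s'" by simp
    qed
    assume "0 < i"
    show "part \<phi> i ` part A i = part B i"
    proof
      show "part \<phi> i ` part A i \<subseteq> part B i" using f\<iota> i by (auto simp: p)
      show "part B i \<subseteq> part \<phi> i ` part A i"
      proof
        fix t assume t: "t \<in> part B i"
        then have "\<iota> (i, t) \<in> f ` union A" using out[of "\<iota> (i, t)"] i \<open>0 < i\<close> by auto
        then obtain i' s where s: "i' \<le> r" "s \<in> part A i'" "\<iota> (i, t) = f (\<iota> (i', s))"
          by (auto elim!: unionE)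
        moreover have "i' = i" using c[of "\<iota> (i', s)"] s by (metis \<iota>_in_union colour_\<iota>)
        ultimately show "t \<in> part \<phi> i ` part A i"
          using p[OF i] by (metis elem_\<iota> image_iff restrict_apply')
      qed
    qed
  qed
  moreover have "union_map A \<phi> = f"
  proof (rule extensionalityI[of _ "union A"])
    show "f \<in> extensional (union A)" using f by (simp add: inj_maps_def PiE_iff)
    fix x assume "x \<in> union A"
    then obtain i s where "i \<le> r" "s \<in> part A i" "x = \<iota> (i, s)" by (rule unionE)
    then show "union_map A \<phi> x = f x" using f\<iota>[of i s] by (simp add: p)
  qed (simp add: union_map_def)
  ultimately show ?thesis by blast
qed

lemma Obj_FI_G: "S \<in> Obj (FI\<^sub>G G) \<longleftrightarrow> finite S"
  by (simp add: FI\<^sub>G_def)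

text \<open>
  A labelling chooses a diagonal matrix unit \<open>E i a a\<close> at each point; it indexes a direct summand of
  \<open>S\<close>, isomorphic to the object given by the colour classes of the labelling.
\<close>

definition labels :: "(nat \<times> nat) set" where
  "labels = (SIGMA i:{..r}. {..<n i})"

definition labellings :: "'s set \<Rightarrow> ('s \<Rightarrow> nat \<times> nat) set" where
  "labellings S = S \<rightarrow>\<^sub>E labels"

definition fibres :: "'s set \<Rightarrow> ('s \<Rightarrow> nat \<times> nat) \<Rightarrow> 's set \<times> (nat \<Rightarrow> 's set)" where
  "fibres S p = from_parts r (\<lambda>i. {s \<in> S. fst (p s) = i})"

definition emb :: "'s set \<times> (nat \<Rightarrow> 's set) \<Rightarrow> 's set \<times> (nat \<Rightarrow> 's set) \<Rightarrow> ('s \<Rightarrow> 's) \<times> (nat \<Rightarrow> 's \<Rightarrow> 's)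
    \<Rightarrow> ('s \<Rightarrow> 's) \<times> ('s \<Rightarrow> 'g) \<Rightarrow> 'k" where
  "emb A B \<phi> = tensor G (union A) (union_map A \<phi>) (\<lambda>x. E (colour x) 0 0)"

definition proj :: "'s set \<Rightarrow> ('s \<Rightarrow> nat \<times> nat) \<Rightarrow> ('s \<Rightarrow> 's) \<times> ('s \<Rightarrow> 'g) \<Rightarrow> 'k" where
  "proj S p = tensor G S (\<lambda>s \<in> S. \<iota> (fst (p s), s)) (\<lambda>s. E (fst (p s)) 0 (snd (p s)))"

definition incl :: "'s set \<Rightarrow> ('s \<Rightarrow> nat \<times> nat) \<Rightarrow> ('s \<Rightarrow> 's) \<times> ('s \<Rightarrow> 'g) \<Rightarrow> 'k" where
  "incl S p = tensor G (union (fibres S p)) (\<lambda>x \<in> union (fibres S p). elem x)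
     (\<lambda>x. E (colour x) (snd (p (elem x))) 0)"

lemma labelD:
  assumes "p \<in> labellings S" "s \<in> S"
  shows "fst (p s) \<le> r" "snd (p s) < n (fst (p s))"
proof -
  have "p s \<in> labels" using assms by (auto simp: labellings_def)
  then show "fst (p s) \<le> r" "snd (p s) < n (fst (p s))" by (auto simp: labels_def)
qed

lemma union_fibres:
  assumes "p \<in> labellings S"
  shows "union (fibres S p) = (\<lambda>s. \<iota> (fst (p s), s)) ` S"
  using labelD[OF assms] by (auto simp: fibres_def part_from_parts elim!: unionE)

lemma fibres_Obj: "finite S \<Longrightarrow> fibres S p \<in> Obj (FIFB r)"
  by (auto simp: Obj_FIFB fibres_def part_from_parts) (simp add: from_parts_def)

lemma to_fibres_in: "p \<in> labellings S \<Longrightarrow> (\<lambda>s \<in> S. \<iota> (fst (p s), s)) \<in> inj_maps S (union (fibres S p))"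
  by (auto simp: inj_maps_def union_fibres inj_on_def)

lemma from_fibres_in:
  "p \<in> labellings S \<Longrightarrow> (\<lambda>x \<in> union (fibres S p). elem x) \<in> inj_maps (union (fibres S p)) S"
  by (auto simp: inj_maps_def union_fibres inj_on_def)

lemma id_in: "(\<lambda>x \<in> S. x) \<in> inj_maps S S"
  by (auto simp: inj_maps_def inj_on_def)

lemma E00_conv:
  assumes "i \<le> r" "g \<in> carrier G"
  shows "a < n i \<Longrightarrow> group_conv G (E i 0 0) (E i 0 a) g = E i 0 a g"
    and "a < n i \<Longrightarrow> group_conv G (E i a 0) (E i 0 0) g = E i a 0 g"
  using E_E[of i i] assms n_pos by auto

lemma emb_in: "\<phi> \<in> Hom (FIFB r) A B \<Longrightarrow> emb A B \<phi> \<in> lin_hom (FI\<^sub>G G) (union A) (union B)"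
  unfolding emb_def by (intro tensor_in union_map_in)

lemma emb_Idt: "emb A A (Idt (FIFB r) A) = tensor G (union A) (\<lambda>x \<in> union A. x) (\<lambda>x. E (colour x) 0 0)"
  by (simp add: emb_def union_map_Idt)

lemma emb_Cmp:
  assumes "A \<in> Obj (FIFB r)" "B \<in> Obj (FIFB r)" "D \<in> Obj (FIFB r)"
    and \<phi>: "\<phi> \<in> Hom (FIFB r) A B" and \<psi>: "\<psi> \<in> Hom (FIFB r) B D"
  shows "emb A D (Cmp (FIFB r) A B D \<psi> \<phi>) =
    lin_cmp (FI\<^sub>G G) (union A) (union B) (union D) (emb B D \<psi>) (emb A B \<phi>)"
proof -
  have 1: "(\<Prod>t \<in> union B - union_map A \<phi> ` union A. \<Sum>x \<in> carrier G. E (colour t) 0 0 x) = 1"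
    using union_map_outside[OF \<phi>] colour_le[of _ B] by (intro prod.neutral) (auto simp: augmentation_E)
  have "emb A D (Cmp (FIFB r) A B D \<psi> \<phi>) = tensor G (union A) (compose (union A) (union_map B \<psi>) (union_map A \<phi>))
      (\<lambda>s. group_conv G (E (colour (union_map A \<phi> s)) 0 0) (E (colour s) 0 0))"
    unfolding emb_def union_map_Cmp[OF \<phi>] using n_pos
    by (intro tensor_cong) (auto simp: union_map_colour colour_le E00_conv)
  then show ?thesis
    unfolding emb_def using assms
    by (subst tensor_cmp) (auto simp: finite_union union_map_in 1)
qed

text \<open>
  By \<open>E_g_E\<close>, sandwiching multiplies the tensor factor at each point by a scalar, or kills it if the
  colours differ; by \<open>augmentation_E\<close>, new points of nontrivial colour kill it too.
\<close>

lemma emb_full: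
  assumes A: "A \<in> Obj (FIFB r)" and B: "B \<in> Obj (FIFB r)" and h: "h \<in> Hom (FI\<^sub>G G) (union A) (union B)"
  shows "\<exists>c. lin_cmp (FI\<^sub>G G) (union A) (union B) (union B) (emb B B (Idt (FIFB r) B))
            (lin_cmp (FI\<^sub>G G) (union A) (union A) (union B) (dirac h) (emb A A (Idt (FIFB r) A)))
          = (\<lambda>k. \<Sum>\<phi> \<in> Hom (FIFB r) A B. c \<phi> * emb A B \<phi> k)"
proof -
  obtain f \<rho> where fr: "h = (f, \<rho>)" "f \<in> inj_maps (union A) (union B)" "\<rho> \<in> union A \<rightarrow>\<^sub>E carrier G"
    using h by (auto simp: Hom_FI_G)
  note fin = finite_union[OF A] finite_union[OF B]
  have fB: "f x \<in> union B" if "x \<in> union A" for x using fr that by (auto simp: inj_maps_def PiE_iff)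
  have fext: "f \<in> extensional (union A)" using fr by (auto simp: inj_maps_def PiE_iff)
  have comp: "compose (union A) f (\<lambda>x \<in> union A. x) = f" "compose (union A) (\<lambda>x \<in> union B. x) f = f"
    using fext fB by (auto simp: compose_def extensional_def fun_eq_iff)
  have "lin_cmp (FI\<^sub>G G) (union A) (union A) (union B) (dirac h) (emb A A (Idt (FIFB r) A)) =
    tensor G (union A) f (\<lambda>s. group_conv G (\<lambda>x. of_bool (\<rho> s = x)) (E (colour s) 0 0))"
    unfolding fr(1) emb_Idt using fin fr
    by (simp add: tensor_dirac tensor_cmp[OF _ _ _ id_in] comp cong: tensor_cong)
  then have "lin_cmp (FI\<^sub>G G) (union A) (union B) (union B) (emb B B (Idt (FIFB r) B))
      (lin_cmp (FI\<^sub>G G) (union A) (union A) (union B) (dirac h) (emb A A (Idt (FIFB r) A))) =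
    (\<lambda>k. (\<Prod>t \<in> union B - f ` union A. \<Sum>x \<in> carrier G. E (colour t) 0 0 x) *
      tensor G (union A) f (\<lambda>s. group_conv G (E (colour (f s)) 0 0)
        (group_conv G (\<lambda>x. of_bool (\<rho> s = x)) (E (colour s) 0 0))) k)"
    unfolding emb_Idt using fin fr by (simp add: tensor_cmp[OF _ _ _ _ id_in] comp)
  also have "tensor G (union A) f (\<lambda>s. group_conv G (E (colour (f s)) 0 0)
        (group_conv G (\<lambda>x. of_bool (\<rho> s = x)) (E (colour s) 0 0))) =
     tensor G (union A) f (\<lambda>s g. (if colour (f s) = colour s then R (colour s) (\<rho> s) 0 0 else 0) * E (colour s) 0 0 g)"
    using fr colour_le[OF fB] colour_le[of _ A]
    by (intro tensor_cong refl) (auto simp: E_g_E n_pos PiE_iff)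
  also have "\<dots> = (\<lambda>k. (\<Prod>s \<in> union A. if colour (f s) = colour s then R (colour s) (\<rho> s) 0 0 else 0) *
      tensor G (union A) f (\<lambda>s. E (colour s) 0 0) k)"
    by (rule tensor_scale)
  finally have eq: "lin_cmp (FI\<^sub>G G) (union A) (union B) (union B) (emb B B (Idt (FIFB r) B))
      (lin_cmp (FI\<^sub>G G) (union A) (union A) (union B) (dirac h) (emb A A (Idt (FIFB r) A))) =
    (\<lambda>k. (\<Prod>t \<in> union B - f ` union A. \<Sum>x \<in> carrier G. E (colour t) 0 0 x) *
      ((\<Prod>s \<in> union A. if colour (f s) = colour s then R (colour s) (\<rho> s) 0 0 else 0) *
      tensor G (union A) f (\<lambda>s. E (colour s) 0 0) k))" .
  show ?thesis
  proof (cases "(\<forall>x \<in> union A. colour (f x) = colour x) \<and> (\<forall>y \<in> union B - f ` union A. colour y = 0)")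
    case True
    then obtain \<phi> where \<phi>: "\<phi> \<in> Hom (FIFB r) A B" "union_map A \<phi> = f"
      using union_map_surj[OF fr(2)] by blast
    define K where "K = (\<Prod>t \<in> union B - f ` union A. \<Sum>x \<in> carrier G. E (colour t) 0 0 x) *
      (\<Prod>s \<in> union A. if colour (f s) = colour s then R (colour s) (\<rho> s) 0 0 else 0)"
    have "(\<Sum>\<phi>' \<in> Hom (FIFB r) A B. (K * of_bool (\<phi> = \<phi>')) * emb A B \<phi>' k) = K * emb A B \<phi> k" for k
    proof -
      have "(\<Sum>\<phi>' \<in> Hom (FIFB r) A B. (K * of_bool (\<phi> = \<phi>')) * emb A B \<phi>' k) =
        (\<Sum>\<phi>' \<in> Hom (FIFB r) A B. of_bool (\<phi> = \<phi>') * (K * emb A B \<phi>' k))"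
        by (intro sum.cong) auto
      also have "\<dots> = K * emb A B \<phi> k"
        using \<phi> hom_finite_category.finite_Hom[OF hom_finite_FIFB A B] by (simp add: sum_kronecker)
      finally show ?thesis .
    qed
    then show ?thesis
      unfolding eq using \<phi> by (intro exI[of _ "\<lambda>\<phi>'. K * of_bool (\<phi> = \<phi>')"]) (simp add: K_def emb_def mult.assoc)
  next
    case False
    then consider x where "x \<in> union A" "colour (f x) \<noteq> colour x" |
      y where "y \<in> union B - f ` union A" "colour y \<noteq> 0" by blast
    then have z: "(\<Prod>t \<in> union B - f ` union A. \<Sum>x \<in> carrier G. E (colour t) 0 0 x) *
      ((\<Prod>s \<in> union A. if colour (f s) = colour s then R (colour s) (\<rho> s) 0 0 else 0) *
      tensor G (union A) f (\<lambda>s. E (colour s) 0 0) k) = 0" for k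
    proof cases
      case (1 x)
      then have "(\<Prod>s \<in> union A. if colour (f s) = colour s then R (colour s) (\<rho> s) 0 0 else 0) = 0"
        using fin by (intro prod_zero) auto
      then show ?thesis by simp
    next
      case (2 y)
      then have "(\<Prod>t \<in> union B - f ` union A. \<Sum>x \<in> carrier G. E (colour t) 0 0 x) = 0"
        using fin colour_le[of y B] by (intro prod_zero) (auto simp: augmentation_E intro!: bexI[of _ y])
      then show ?thesis by simp
    qed
    show ?thesis unfolding eq z by (intro exI[of _ "\<lambda>\<phi>. 0"]) simp
  qed
qed

text \<open>
  Different morphisms have different underlying maps, so the tensors have disjoint supports.
\<close>

lemma emb_faithful:
  assumes A: "A \<in> Obj (FIFB r)" "B \<in> Obj (FIFB r)" and \<phi>: "\<phi> \<in> Hom (FIFB r) A B"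
    and zero: "(\<lambda>k. \<Sum>\<phi> \<in> Hom (FIFB r) A B. c \<phi> * emb A B \<phi> k) = (\<lambda>k. 0)"
  shows "c \<phi> = 0"
proof -
  have "\<forall>x \<in> union A. \<exists>g\<in>carrier G. E (colour x) 0 0 g \<noteq> 0"
    using E_nonzero colour_le by blast
  \<comment> \<open>A point of the support of the tensor of \<open>\<phi>\<close>.\<close>
  then obtain \<rho>0 where \<rho>0: "\<And>x. x \<in> union A \<Longrightarrow> \<rho>0 x \<in> carrier G \<and> E (colour x) 0 0 (\<rho>0 x) \<noteq> 0"
    by metis
  define \<rho> where "\<rho> = restrict \<rho>0 (union A)"
  have \<rho>: "\<rho> \<in> union A \<rightarrow>\<^sub>E carrier G" using \<rho>0 by (auto simp: \<rho>_def)
  define K where "K = (\<Prod>x \<in> union A. E (colour x) 0 0 (\<rho> x))"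
  have K: "K \<noteq> 0" using \<rho>0 finite_union[OF A(1)] by (auto simp: K_def \<rho>_def)
  have "emb A B \<psi> (union_map A \<phi>, \<rho>) = of_bool (\<phi> = \<psi>) * K" if "\<psi> \<in> Hom (FIFB r) A B" for \<psi>
    using union_map_inj[OF \<phi> that] \<rho> by (auto simp: emb_def tensor_def K_def)
  then have "(\<Sum>\<psi> \<in> Hom (FIFB r) A B. c \<psi> * emb A B \<psi> (union_map A \<phi>, \<rho>)) =
      (\<Sum>\<psi> \<in> Hom (FIFB r) A B. of_bool (\<phi> = \<psi>) * (c \<psi> * K))"
    by (intro sum.cong) auto
  also have "\<dots> = c \<phi> * K"
    using \<phi> hom_finite_category.finite_Hom[OF hom_finite_FIFB A] by (simp add: sum_kronecker)
  finally show ?thesis using fun_cong[OF zero, of "(union_map A \<phi>, \<rho>)"] K by simp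
qed

lemma e_proj:
  assumes S: "finite S" and p: "p \<in> labellings S"
  shows "lin_cmp (FI\<^sub>G G) S (union (fibres S p)) (union (fibres S p))
    (emb (fibres S p) (fibres S p) (Idt (FIFB r) (fibres S p))) (proj S p) = proj S p"
proof -
  have fin: "finite (union (fibres S p))" using S by (simp add: union_fibres[OF p])
  show ?thesis
    unfolding emb_Idt proj_def tensor_cmp[OF S fin fin to_fibres_in[OF p] id_in]
    using labelD[OF p] by (simp add: union_fibres[OF p] compose_def image_restrict_eq cong: restrict_cong)
      (intro tensor_cong, auto simp: E00_conv)
qed

lemma incl_e:
  assumes S: "finite S" and p: "p \<in> labellings S"
  shows "lin_cmp (FI\<^sub>G G) (union (fibres S p)) (union (fibres S p)) S (incl S p)
    (emb (fibres S p) (fibres S p) (Idt (FIFB r) (fibres S p))) = incl S p"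
proof -
  have fin: "finite (union (fibres S p))" using S by (simp add: union_fibres[OF p])
  show ?thesis
    unfolding emb_Idt incl_def tensor_cmp[OF fin fin S id_in from_fibres_in[OF p]]
    using labelD[OF p] by (simp add: compose_def cong: restrict_cong)
      (intro tensor_cong, auto simp: E00_conv union_fibres[OF p])
qed

text \<open>
  Two labellings that differ at \<open>s\<close> give a factor \<open>E_E\<close> with mismatched indices at \<open>s\<close>, which is
  zero.
\<close>

lemma proj_incl:
  assumes S: "finite S" and p: "p \<in> labellings S" and q: "q \<in> labellings S"
  shows "lin_cmp (FI\<^sub>G G) (union (fibres S p)) S (union (fibres S q)) (proj S q) (incl S p) =
    (if p = q then emb (fibres S p) (fibres S p) (Idt (FIFB r) (fibres S p)) else (\<lambda>k. 0))"
proof -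
  have fin: "finite (union (fibres S p))" "finite (union (fibres S q))"
    using S by (simp_all add: union_fibres[OF p] union_fibres[OF q])
  have im: "(\<lambda>x \<in> union (fibres S p). elem x) ` union (fibres S p) = S"
    by (force simp: union_fibres[OF p])
  have "lin_cmp (FI\<^sub>G G) (union (fibres S p)) S (union (fibres S q)) (proj S q) (incl S p) =
    tensor G (union (fibres S p)) (\<lambda>x \<in> union (fibres S p). \<iota> (fst (q (elem x)), elem x))
      (\<lambda>x. group_conv G (E (fst (q (elem x))) 0 (snd (q (elem x)))) (E (colour x) (snd (p (elem x))) 0))"
    unfolding proj_def incl_def tensor_cmp[OF fin(1) S fin(2) from_fibres_in[OF p] to_fibres_in[OF q]] im
    by (simp, intro tensor_cong) (auto simp: compose_def union_fibres[OF p] intro!: restrict_ext)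
  also have "\<dots> = (if p = q then emb (fibres S p) (fibres S p) (Idt (FIFB r) (fibres S p)) else (\<lambda>k. 0))"
  proof (cases "p = q")
    case True
    then show ?thesis unfolding emb_Idt using labelD[OF p] n_pos
      by (simp, intro tensor_cong) (auto simp: union_fibres[OF q] E_E intro!: restrict_ext)
  next
    case False
    then obtain s where s: "s \<in> S" "p s \<noteq> q s" using p q by (auto simp: labellings_def dest: PiE_ext)
    have mem: "\<iota> (fst (p s), s) \<in> union (fibres S p)" using s by (simp add: union_fibres[OF p])
    then have "tensor G (union (fibres S p)) (\<lambda>x \<in> union (fibres S p). \<iota> (fst (q (elem x)), elem x))
      (\<lambda>x. group_conv G (E (fst (q (elem x))) 0 (snd (q (elem x)))) (E (colour x) (snd (p (elem x))) 0)) = (\<lambda>k. 0)"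
      using s labelD[OF p s(1)] labelD[OF q s(1)] n_pos
      by (intro tensor_zero[OF fin(1) mem]) (auto simp: E_E prod_eq_iff)
    then show ?thesis using False by simp
  qed
  finally show ?thesis .
qed

text \<open>
  Expanding the tensor power of \<open>\<Sum> E i a a = 1\<close>.
\<close>

lemma incl_proj:
  assumes S: "finite S"
  shows "(\<lambda>k. \<Sum>p \<in> labellings S. lin_cmp (FI\<^sub>G G) S (union (fibres S p)) S (incl S p) (proj S p) k) =
    dirac (Idt (FI\<^sub>G G) S)"
proof -
  have "lin_cmp (FI\<^sub>G G) S (union (fibres S p)) S (incl S p) (proj S p) =
    tensor G S (\<lambda>s \<in> S. s) (\<lambda>s. E (fst (p s)) (snd (p s)) (snd (p s)))" if p: "p \<in> labellings S" for p
  proof -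
    have fin: "finite (union (fibres S p))" using S by (simp add: union_fibres[OF p])
    have im: "(\<lambda>s \<in> S. \<iota> (fst (p s), s)) ` S = union (fibres S p)"
      by (auto simp: union_fibres[OF p])
    show ?thesis
      unfolding proj_def incl_def tensor_cmp[OF S fin S to_fibres_in[OF p] from_fibres_in[OF p]] im
      using labelD[OF p] n_pos
      by (simp, intro tensor_cong) (auto simp: compose_def union_fibres[OF p] E_E intro!: restrict_ext)
  qed
  then have "(\<lambda>k. \<Sum>p \<in> labellings S. lin_cmp (FI\<^sub>G G) S (union (fibres S p)) S (incl S p) (proj S p) k) =
    (\<lambda>k. \<Sum>p \<in> S \<rightarrow>\<^sub>E labels. tensor G S (\<lambda>s \<in> S. s) (\<lambda>s. E (fst (p s)) (snd (p s)) (snd (p s))) k)"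
    unfolding labellings_def by (intro ext sum.cong) auto
  also have "\<dots> = tensor G S (\<lambda>s \<in> S. s) (\<lambda>s g. \<Sum>l\<in>labels. E (fst l) (snd l) (snd l) g)"
    using S by (intro tensor_sum[of S labels _ "\<lambda>s l. E (fst l) (snd l) (snd l)"]) (auto simp: labels_def)
  also have "\<dots> = tensor G S (\<lambda>s \<in> S. s) (\<lambda>s g. of_bool ((\<lambda>s \<in> S. \<one>) s = g))"
  proof (intro tensor_cong refl)
    fix s g assume "s \<in> S" "g \<in> carrier G"
    moreover have "(\<Sum>l\<in>labels. E (fst l) (snd l) (snd l) g) = (\<Sum>i\<le>r. \<Sum>a<n i. E i a a g)"
      unfolding labels_def by (subst sum.Sigma) (auto simp: case_prod_beta)
    ultimately show "(\<Sum>l\<in>labels. E (fst l) (snd l) (snd l) g) = of_bool ((\<lambda>s \<in> S. \<one>) s = g)"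
      by (simp add: sum_E)
  qed
  also have "\<dots> = dirac (Idt (FI\<^sub>G G) S)"
    using S by (subst tensor_dirac[symmetric]) (auto simp: FI\<^sub>G_def)
  finally show ?thesis .
qed

sublocale morita: morita_data "FI\<^sub>G G" "FIFB r" union emb labellings fibres proj incl
proof (intro morita_data.intro morita_data_axioms.intro hom_finite_FI_G hom_finite_FIFB)
  show "union A \<in> Obj (FI\<^sub>G G)" if "A \<in> Obj (FIFB r)" for A using that by (simp add: Obj_FI_G finite_union)
  show "finite (labellings S)" if "S \<in> Obj (FI\<^sub>G G)" for S
    using that by (auto simp: Obj_FI_G labellings_def labels_def intro!: finite_PiE)
  show "fibres S p \<in> Obj (FIFB r)" if "S \<in> Obj (FI\<^sub>G G)" for S p using that by (simp add: Obj_FI_G fibres_Obj)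
  show "proj S p \<in> lin_hom (FI\<^sub>G G) S (union (fibres S p))" if "p \<in> labellings S" for S p
    unfolding proj_def using that by (intro tensor_in to_fibres_in)
  show "incl S p \<in> lin_hom (FI\<^sub>G G) (union (fibres S p)) S" if "p \<in> labellings S" for S p
    unfolding incl_def using that by (intro tensor_in from_fibres_in)
qed (auto simp: Obj_FI_G emb_in emb_Cmp emb_full e_proj incl_e proj_incl incl_proj intro: emb_faithful)

end

theorem (in matrix_units) equivalence:
  "equivalent_categories
     (Rep TYPE('k) TYPE('v::infinite) (FI\<^sub>G G :: ('s::infinite set, _) cat))
     (Rep TYPE('k) TYPE('v) (FIFB r :: ('s set \<times> _, _) cat))"
proof -
  have "\<exists>\<iota> :: nat \<times> 's \<Rightarrow> 's. inj \<iota>"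
  proof -
    have inf: "infinite (UNIV :: 's set)" by (rule infinite_UNIV)
    then obtain h :: "nat \<Rightarrow> 's" where h: "inj h"
      using infinite_countable_subset by blast
    obtain k where k: "bij_betw k ((UNIV :: 's set) \<times> (UNIV :: 's set)) (UNIV :: 's set)"
      using card_of_ordIso[THEN iffD2, OF card_of_Times_same_infinite[OF inf]] by blast
    have "inj (\<lambda>(i, s). k (h i, s))"
    proof (rule injI)
      fix x y :: "nat \<times> 's"
      assume "(case x of (i, s) \<Rightarrow> k (h i, s)) = (case y of (i, s) \<Rightarrow> k (h i, s))"
      then have "(h (fst x), snd x) = (h (fst y), snd y)"
        by (intro inj_onD[OF bij_betw_imp_inj_on[OF k]]) (simp_all add: case_prod_beta)
      then show "x = y" using h by (auto simp: prod_eq_iff dest: injD)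
    qed
    then show ?thesis by blast
  qed
  then obtain \<iota> :: "nat \<times> 's \<Rightarrow> 's" where "inj \<iota>" by blast
  then interpret coloured_matrix_units G r n E R \<iota> by unfold_locales
  show ?thesis by (rule morita.morita_equivalence)
qed


section \<open>Schur's lemma and orthogonality\<close>

lemma submodule_vecI:
  fixes W :: "'k::field vec set"
  assumes "W \<subseteq> carrier_vec n" "0\<^sub>v n \<in> W" "\<And>v w. v \<in> W \<Longrightarrow> w \<in> W \<Longrightarrow> v + w \<in> W"
    and "\<And>c v. v \<in> W \<Longrightarrow> c \<cdot>\<^sub>v v \<in> W"
  shows "submodule W ring_of_type_algebra (module_vec TYPE('k) n)"
proof -
  have "abelian_group (module_vec TYPE('k) n)"
  proof (rule abelian_groupI)
    fix v assume "v \<in> carrier (module_vec TYPE('k) n)"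
    then show "\<exists>w\<in>carrier (module_vec TYPE('k) n). w \<oplus>\<^bsub>module_vec TYPE('k) n\<^esub> v = \<zero>\<^bsub>module_vec TYPE('k) n\<^esub>"
      by (intro bexI[of _ "- v"]) (auto simp: module_vec_simps)
  qed (auto simp: module_vec_simps comm_add_vec[of _ n] assoc_add_vec[of _ n])
  then interpret Module.module "ring_of_type_algebra :: 'k ring" "module_vec TYPE('k) n"
    by (rule Module.moduleI[OF cring_from_type_algebra])
      (auto simp: module_vec_simps ring_of_type_algebra_def add_smult_distrib_vec
        smult_add_distrib_vec[of _ n] smult_smult_assoc)
  have neg: "\<ominus>\<^bsub>module_vec TYPE('k) n\<^esub> v \<in> W" if "v \<in> W" for v
  proof -
    have v: "v \<in> carrier_vec n" using that assms(1) by auto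
    have "\<ominus>\<^bsub>module_vec TYPE('k) n\<^esub> v = (- 1) \<cdot>\<^sub>v v"
      using v by (intro M.minus_equality) (auto simp: module_vec_simps)
    then show ?thesis using assms(4) that by simp
  qed
  show ?thesis
    by (rule submoduleI) (use assms neg in \<open>auto simp: module_vec_simps\<close>)
qed

text \<open>
  If \<open>n < m\<close>, padding both factors with zeros to square matrices would make the padded \<open>B\<close>, which has
  a zero row, invertible.
\<close>

lemma right_inverse_le:
  assumes A: "A \<in> carrier_mat m n" and B: "B \<in> carrier_mat n m" and AB: "A * B = (1\<^sub>m m :: 'k::field mat)"
  shows "m \<le> n"
proof (rule ccontr)
  assume nm: "\<not> m \<le> n"
  define A' where "A' = mat m m (\<lambda>(i, j). if j < n then A $$ (i, j) else 0)"
  define B' where "B' = mat m m (\<lambda>(i, j). if i < n then B $$ (i, j) else 0)"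
  have "(\<Sum>k<m. A' $$ (i, k) * B' $$ (k, j)) = (\<Sum>k<n. A $$ (i, k) * B $$ (k, j))" if "i < m" "j < m" for i j
    using that nm by (intro sum.mono_neutral_cong_right) (auto simp: A'_def B'_def)
  then have "A' * B' = A * B"
    using A B by (intro eq_matI) (auto simp: A'_def B'_def scalar_prod_def atLeast0LessThan)
  then have "B' * A' = 1\<^sub>m m"
    using mat_mult_left_right_inverse[of A' m B'] AB by (simp add: A'_def B'_def)
  moreover have "(B' * A') $$ (m - 1, m - 1) = 0"
    using nm by (auto simp: A'_def B'_def scalar_prod_def intro!: sum.neutral)
  ultimately show False using nm by simp
qed

lemma mult_unit_vec_eq_col:
  "(A :: 'k::field mat) \<in> carrier_mat m n \<Longrightarrow> j < n \<Longrightarrow> A *\<^sub>v unit_vec n j = col A j"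
  by (rule eq_vecI) (auto simp: scalar_prod_def unit_vec_def if_distrib cong: if_cong)

lemma mat_eq_zeroI:
  fixes A :: "'k::field mat"
  assumes A: "A \<in> carrier_mat m n" and z: "\<And>v. v \<in> carrier_vec n \<Longrightarrow> A *\<^sub>v v = 0\<^sub>v m"
  shows "A = 0\<^sub>m m n"
proof (rule eq_matI)
  fix i j assume "i < dim_row (0\<^sub>m m n :: 'k mat)" "j < dim_col (0\<^sub>m m n :: 'k mat)"
  then have ij: "i < m" "j < n" by auto
  have "col A j = 0\<^sub>v m" using z[of "unit_vec n j"] mult_unit_vec_eq_col[OF A ij(2)] by simp
  then have "col A j $ i = 0" using ij by simp
  then show "A $$ (i, j) = 0\<^sub>m m n $$ (i, j)" using A ij by simp
qed (use A in auto)

context finite_group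
begin

lemma matrix_repD:
  assumes "matrix_rep G (n, \<rho> :: _ \<Rightarrow> 'k::field mat)"
  shows "g \<in> carrier G \<Longrightarrow> \<rho> g \<in> carrier_mat n n"
    and "g \<in> carrier G \<Longrightarrow> h \<in> carrier G \<Longrightarrow> \<rho> (g \<otimes> h) = \<rho> g * \<rho> h"
    and "\<rho> \<one> = 1\<^sub>m n"
proof -
  interpret M: ring "ring_mat TYPE('k) n ()" by (rule ring_mat)
  have hom: "\<rho> \<in> hom G (GL TYPE('k) n)" using assms by (simp add: matrix_rep_def)
  have "group (GL TYPE('k) n)" unfolding GL_def by (rule M.units_group)
  then interpret group_hom G "GL TYPE('k) n" \<rho>
    by (intro group_hom.intro group_hom_axioms.intro is_group hom)
  show "\<rho> g \<in> carrier_mat n n" if "g \<in> carrier G" for g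
    using hom_closed[OF that] by (auto simp: GL_def units_of_def Units_def ring_mat_simps)
  show "\<rho> (g \<otimes> h) = \<rho> g * \<rho> h" if "g \<in> carrier G" "h \<in> carrier G"
    using hom_mult[OF that] by (simp add: GL_def units_of_def ring_mat_simps)
  show "\<rho> \<one> = 1\<^sub>m n" using hom_one by (simp add: GL_def units_of_def ring_mat_simps)
qed

lemma matrix_repI:
  fixes \<rho> :: "'g \<Rightarrow> 'k::field mat"
  assumes "\<And>g. g \<in> carrier G \<Longrightarrow> \<rho> g \<in> carrier_mat n n"
    and "\<And>g h. g \<in> carrier G \<Longrightarrow> h \<in> carrier G \<Longrightarrow> \<rho> (g \<otimes> h) = \<rho> g * \<rho> h"
    and "\<rho> \<one> = 1\<^sub>m n"
  shows "matrix_rep G (n, \<rho>)"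
proof -
  have "\<rho> g \<in> Units (ring_mat TYPE('k) n ())" if "g \<in> carrier G" for g
    using assms(1)[of g] assms(1)[of "inv g"] assms(2)[of g "inv g"] assms(2)[of "inv g" g] assms(3) that
    by (auto simp: Units_def ring_mat_simps intro!: bexI[of _ "\<rho> (inv g)"])
  then show ?thesis using assms(2)
    by (auto simp: matrix_rep_def hom_def GL_def units_of_def ring_mat_simps)
qed

lemma GL_iff:
  "P \<in> carrier (GL TYPE('k::field) n) \<longleftrightarrow>
    P \<in> carrier_mat n n \<and> (\<exists>Q \<in> carrier_mat n n. Q * P = 1\<^sub>m n \<and> P * Q = 1\<^sub>m n)"
  by (auto simp: GL_def units_of_def Units_def ring_mat_simps)

lemma iso_repsI:
  assumes "matrix_rep G (n, \<rho>)" "matrix_rep G (n, \<sigma>)" "P \<in> carrier (GL TYPE('k::field) n)"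
    and "\<And>g. g \<in> carrier G \<Longrightarrow> P * \<rho> g = \<sigma> g * P"
  shows "((n, \<rho> :: _ \<Rightarrow> 'k mat), (n, \<sigma>)) \<in> iso_reps G"
  using assms by (auto simp: iso_reps_def)

lemma iso_repsE:
  assumes "((n, \<rho> :: _ \<Rightarrow> 'k::field mat), (m, \<sigma>)) \<in> iso_reps G"
  obtains P Q where "n = m" "matrix_rep G (n, \<rho>)" "matrix_rep G (n, \<sigma>)" "P \<in> carrier_mat n n" "Q \<in> carrier_mat n n"
    "Q * P = 1\<^sub>m n" "P * Q = 1\<^sub>m n" "\<And>g. g \<in> carrier G \<Longrightarrow> P * \<rho> g = \<sigma> g * P"
  using assms by (auto simp: iso_reps_def GL_iff)

lemma iso_reps_refl: "matrix_rep G x \<Longrightarrow> (x, x :: nat \<times> ('g \<Rightarrow> 'k::field mat)) \<in> iso_reps G"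
proof -
  assume x: "matrix_rep G x"
  obtain n \<rho> where [simp]: "x = (n, \<rho>)" by (cases x)
  have "1\<^sub>m n \<in> carrier (GL TYPE('k) n)" unfolding GL_iff by (intro conjI bexI[of _ "1\<^sub>m n"]) auto
  then show ?thesis using x matrix_repD[of n \<rho>]
    by (auto intro!: iso_repsI[of n \<rho> \<rho> "1\<^sub>m n"]
      simp: left_mult_one_mat[of _ n n] right_mult_one_mat[of _ n n])
qed

lemma iso_reps_sym:
  assumes "(x, y :: nat \<times> ('g \<Rightarrow> 'k::field mat)) \<in> iso_reps G"
  shows "(y, x) \<in> iso_reps G"
proof -
  obtain n \<rho> m \<sigma> where [simp]: "x = (n, \<rho>)" "y = (m, \<sigma>)" by (cases x; cases y)
  from assms obtain P Q where pq: "n = m" "matrix_rep G (n, \<rho>)" "matrix_rep G (n, \<sigma>)" "P \<in> carrier_mat n n" "Q \<in> carrier_mat n n"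
    "Q * P = 1\<^sub>m n" "P * Q = 1\<^sub>m n" "\<And>g. g \<in> carrier G \<Longrightarrow> P * \<rho> g = \<sigma> g * P"
    by (auto elim: iso_repsE)
  have "Q * \<sigma> g = \<rho> g * Q" if g: "g \<in> carrier G" for g
  proof -
    have c: "\<rho> g \<in> carrier_mat n n" "\<sigma> g \<in> carrier_mat n n" using pq g matrix_repD(1) by blast+
    have "Q * \<sigma> g = Q * \<sigma> g * (P * Q)" using pq c by simp
    also have "\<dots> = Q * (\<sigma> g * P) * Q" using pq c by (simp add: assoc_mult_mat[of _ n n _ n _ n])
    also have "\<dots> = Q * (P * \<rho> g) * Q" using pq g by simp
    also have "\<dots> = (Q * P) * \<rho> g * Q" using assoc_mult_mat[OF pq(5,4) c(1)] by simp
    also have "\<dots> = \<rho> g * Q" unfolding pq(6) left_mult_one_mat[OF c(1)] ..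
    finally show ?thesis .
  qed
  then show ?thesis using pq by (auto intro!: iso_repsI[of m \<sigma> \<rho> Q] simp: GL_iff)
qed

lemma iso_reps_trans:
  assumes "(x, y :: nat \<times> ('g \<Rightarrow> 'k::field mat)) \<in> iso_reps G" "(y, z) \<in> iso_reps G"
  shows "(x, z) \<in> iso_reps G"
proof -
  obtain n \<rho> m \<sigma> l \<tau> where [simp]: "x = (n, \<rho>)" "y = (m, \<sigma>)" "z = (l, \<tau>)" by (cases x; cases y; cases z)
  from assms(1) obtain P Q where pq: "n = m" "matrix_rep G (n, \<rho>)" "matrix_rep G (n, \<sigma>)" "P \<in> carrier_mat n n" "Q \<in> carrier_mat n n"
    "Q * P = 1\<^sub>m n" "P * Q = 1\<^sub>m n" "\<And>g. g \<in> carrier G \<Longrightarrow> P * \<rho> g = \<sigma> g * P"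
    by (auto elim: iso_repsE)
  from assms(2) obtain P' Q' where pq': "m = l" "matrix_rep G (m, \<tau>)" "P' \<in> carrier_mat m m" "Q' \<in> carrier_mat m m"
    "Q' * P' = 1\<^sub>m m" "P' * Q' = 1\<^sub>m m" "\<And>g. g \<in> carrier G \<Longrightarrow> P' * \<sigma> g = \<tau> g * P'"
    by (auto elim: iso_repsE)
  note as = assoc_mult_mat[of _ n n _ n _ n]
  have PP: "P' \<in> carrier_mat n n" "Q' \<in> carrier_mat n n" using pq' pq by auto
  have "P' * P * \<rho> g = \<tau> g * (P' * P)" if g: "g \<in> carrier G" for g
  proof -
    have c: "\<rho> g \<in> carrier_mat n n" "\<sigma> g \<in> carrier_mat n n" "\<tau> g \<in> carrier_mat n n"
      using pq pq' g matrix_repD(1) by blast+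
    have "P' * P * \<rho> g = P' * (P * \<rho> g)" using pq PP c by (simp add: as)
    also have "\<dots> = (P' * \<sigma> g) * P" using pq PP c g by (simp add: as)
    also have "\<dots> = \<tau> g * (P' * P)" using pq pq' PP c g by (simp add: as)
    finally show ?thesis .
  qed
  moreover have "P' * P \<in> carrier (GL TYPE('k) n)"
  proof -
    have "(Q * Q') * (P' * P) = Q * ((Q' * P') * P)" using pq PP by (simp add: as)
    also have "\<dots> = 1\<^sub>m n" using pq pq' PP by simp
    finally have 1: "(Q * Q') * (P' * P) = 1\<^sub>m n" .
    have "(P' * P) * (Q * Q') = P' * ((P * Q) * Q')" using pq(4,5) PP by (simp add: as)
    also have "\<dots> = 1\<^sub>m n" using pq pq' PP by simp
    finally show ?thesis using 1 pq PP unfolding GL_iff by (intro conjI bexI[of _ "Q * Q'"]) auto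
  qed
  ultimately show ?thesis using pq pq' by (auto intro!: iso_repsI[of l \<rho> \<tau> "P' * P"])
qed

lemma irreducible_repD:
  assumes "irreducible_rep G (n, \<rho> :: _ \<Rightarrow> 'k::field mat)"
  shows "matrix_rep G (n, \<rho>)" "n \<noteq> 0"
    and "W \<subseteq> carrier_vec n \<Longrightarrow> 0\<^sub>v n \<in> W \<Longrightarrow> (\<And>v w. v \<in> W \<Longrightarrow> w \<in> W \<Longrightarrow> v + w \<in> W) \<Longrightarrow>
      (\<And>c v. v \<in> W \<Longrightarrow> c \<cdot>\<^sub>v v \<in> W) \<Longrightarrow> (\<And>g v. g \<in> carrier G \<Longrightarrow> v \<in> W \<Longrightarrow> \<rho> g *\<^sub>v v \<in> W) \<Longrightarrow>
      W = {0\<^sub>v n} \<or> W = carrier_vec n"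
  using assms submodule_vecI[of W n] unfolding irreducible_rep_def by auto

text \<open>
  Kernel and image of \<open>T\<close> are invariant, so a nonzero \<open>T\<close> is bijective; a preimage of the standard
  basis then provides its inverse.
\<close>

lemma schur_zero:
  fixes \<rho> \<sigma> :: "'g \<Rightarrow> 'k::field mat"
  assumes irr: "irreducible_rep G (n, \<rho>)" "irreducible_rep G (m, \<sigma>)"
    and T: "T \<in> carrier_mat m n" "\<And>g. g \<in> carrier G \<Longrightarrow> T * \<rho> g = \<sigma> g * T"
    and not_iso: "((n, \<rho>), (m, \<sigma>)) \<notin> iso_reps G"
  shows "T = 0\<^sub>m m n"
proof (rule ccontr)
  assume nz: "T \<noteq> 0\<^sub>m m n"
  note \<rho> = matrix_repD[OF irreducible_repD(1)[OF irr(1)]]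
  note \<sigma> = matrix_repD[OF irreducible_repD(1)[OF irr(2)]]
  have equi: "T *\<^sub>v (\<rho> g *\<^sub>v v) = \<sigma> g *\<^sub>v (T *\<^sub>v v)" if "g \<in> carrier G" "v \<in> carrier_vec n" for g v
    using that T \<rho> \<sigma> by (metis assoc_mult_mat_vec)
  let ?K = "{v \<in> carrier_vec n. T *\<^sub>v v = 0\<^sub>v m}"
  let ?I = "(\<lambda>v. T *\<^sub>v v) ` carrier_vec n"
  have K: "?K = {0\<^sub>v n} \<or> ?K = carrier_vec n"
  proof (rule irreducible_repD(3)[OF irr(1)])
    show "\<rho> g *\<^sub>v v \<in> ?K" if "g \<in> carrier G" "v \<in> ?K" for g v
      using that \<rho>(1)[OF that(1)] \<sigma>(1)[OF that(1)] by (auto simp: equi)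
  qed (use T in \<open>auto simp: mult_add_distrib_mat_vec mult_mat_vec\<close>)
  then have K0: "?K = {0\<^sub>v n}" using nz mat_eq_zeroI[OF T(1)] by auto
  have I: "?I = {0\<^sub>v m} \<or> ?I = carrier_vec m"
  proof (rule irreducible_repD(3)[OF irr(2)])
    show "?I \<subseteq> carrier_vec m" using T by auto
    show "0\<^sub>v m \<in> ?I" using T by (auto intro!: image_eqI[of _ _ "0\<^sub>v n"])
    show "v + w \<in> ?I" if "v \<in> ?I" "w \<in> ?I" for v w
      using that T(1) by (auto simp: mult_add_distrib_mat_vec[symmetric])
    show "c \<cdot>\<^sub>v v \<in> ?I" if "v \<in> ?I" for c v
      using that T(1) by (auto simp: mult_mat_vec[symmetric])
    show "\<sigma> g *\<^sub>v v \<in> ?I" if "g \<in> carrier G" "v \<in> ?I" for g v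
      using that \<rho>(1)[OF that(1)] by (auto simp: equi[symmetric])
  qed
  have I1: "?I = carrier_vec m" using I nz mat_eq_zeroI[OF T(1)] by blast
  have "\<forall>i<m. \<exists>s. s \<in> carrier_vec n \<and> T *\<^sub>v s = unit_vec m i"
  proof (intro allI impI)
    fix i assume "i < m"
    have "unit_vec m i \<in> ?I" unfolding I1 by simp
    then show "\<exists>s. s \<in> carrier_vec n \<and> T *\<^sub>v s = unit_vec m i" by auto
  qed
  then obtain s where s: "\<And>i. i < m \<Longrightarrow> s i \<in> carrier_vec n \<and> T *\<^sub>v s i = unit_vec m i" by metis
  define S where "S = mat_of_cols n (map s [0..<m])"
  have S: "S \<in> carrier_mat n m" by (simp add: S_def mat_of_cols_def)
  have colS: "col S i = s i" if "i < m" for i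
    using that s by (simp add: S_def)
  have TS: "T * S = 1\<^sub>m m"
  proof (rule mat_col_eqI)
    fix i assume "i < dim_col (1\<^sub>m m :: 'k mat)"
    then have i: "i < m" by simp
    have "col (T * S) i = T *\<^sub>v col S i" using T S i by (intro col_mult2)
    then show "col (T * S) i = col (1\<^sub>m m) i" using s i colS by simp
  qed (use T S in auto)
  have ST: "S * T = 1\<^sub>m n"
  proof (rule mat_col_eqI)
    fix j assume "j < dim_col (1\<^sub>m n :: 'k mat)"
    then have j: "j < n" by simp
    have "T *\<^sub>v (S *\<^sub>v (T *\<^sub>v unit_vec n j) - unit_vec n j) = 0\<^sub>v m"
    proof -
      have "T *\<^sub>v (S *\<^sub>v (T *\<^sub>v unit_vec n j)) = (T * S) *\<^sub>v (T *\<^sub>v unit_vec n j)"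
        using T S by (intro assoc_mult_mat_vec[symmetric]) auto
      then show ?thesis using T S TS by (simp add: mult_minus_distrib_mat_vec)
    qed
    then have "S *\<^sub>v (T *\<^sub>v unit_vec n j) - unit_vec n j \<in> ?K" using T S by auto
    then have z: "S *\<^sub>v (T *\<^sub>v unit_vec n j) - unit_vec n j = 0\<^sub>v n" unfolding K0 by simp
    have "S *\<^sub>v (T *\<^sub>v unit_vec n j) = unit_vec n j"
    proof (rule eq_vecI)
      fix i assume "i < dim_vec (unit_vec n j :: 'k vec)"
      then have i: "i < n" by simp
      have "(S *\<^sub>v (T *\<^sub>v unit_vec n j) - unit_vec n j) $ i = 0" using z i by simp
      then show "(S *\<^sub>v (T *\<^sub>v unit_vec n j)) $ i = unit_vec n j $ i" using i S by simp
    qed (use S in auto)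
    moreover have "col (S * T) j = S *\<^sub>v (T *\<^sub>v unit_vec n j)"
      unfolding mult_unit_vec_eq_col[OF T(1) j] by (rule col_mult2[OF S T(1) j])
    ultimately show "col (S * T) j = col (1\<^sub>m n) j" using j by simp
  qed (use T S in auto)
  have nm: "n = m" using right_inverse_le[OF T(1) S TS] right_inverse_le[OF S T(1) ST] by simp
  have "T \<in> carrier (GL TYPE('k) n)" using T S TS ST nm by (auto simp: GL_iff)
  then have "((n, \<rho>), (n, \<sigma>)) \<in> iso_reps G"
    using irr T nm irreducible_repD(1) by (intro iso_repsI) auto
  then show False using not_iso nm by simp
qed

text \<open>
  Over the algebraic closure \<open>T\<close> has an eigenvalue, whose eigenspace is invariant and hence everything.
  The entries of \<open>T\<close> lie in the ground field, so the scalar does as well.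
\<close>

lemma schur_scalar:
  fixes \<rho> :: "'g \<Rightarrow> 'k::field mat"
  assumes rep: "matrix_rep G (n, \<rho>)" and irr: "absolutely_irreducible_rep G (n, \<rho>)"
    and T: "T \<in> carrier_mat n n" "\<And>g. g \<in> carrier G \<Longrightarrow> T * \<rho> g = \<rho> g * T"
  shows "\<exists>c. \<forall>i<n. \<forall>j<n. T $$ (i, j) = (if i = j then c else 0)"
proof -
  let ?h = "to_ac :: 'k \<Rightarrow> 'k alg_closure"
  interpret h: inj_comm_ring_hom ?h by unfold_locales auto
  let ?T = "map_mat ?h T" and ?\<rho> = "\<lambda>g. map_mat ?h (\<rho> g)"
  have irr': "irreducible_rep G (n, ?\<rho>)" using irr by (simp add: absolutely_irreducible_rep_def)
  note \<rho> = matrix_repD[OF rep]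
  have T': "?T \<in> carrier_mat n n" using T by simp
  have n: "n \<noteq> 0" using irreducible_repD(2)[OF irr'] .
  have "degree (char_poly ?T) > 0" using degree_monic_char_poly[OF T'] n by simp
  then obtain x where "poly (char_poly ?T) x = 0" using alg_closed_imp_poly_has_root by blast
  then have "eigenvalue ?T x" using eigenvalue_root_char_poly[OF T'] by simp
  then obtain v where v: "v \<in> carrier_vec n" "v \<noteq> 0\<^sub>v n" "?T *\<^sub>v v = x \<cdot>\<^sub>v v"
    using T' by (auto simp: eigenvalue_def eigenvector_def)
  let ?W = "{w \<in> carrier_vec n. ?T *\<^sub>v w = x \<cdot>\<^sub>v w}"
  have "?W = {0\<^sub>v n} \<or> ?W = carrier_vec n"
  proof (rule irreducible_repD(3)[OF irr'])
    show "v + w \<in> ?W" if "v \<in> ?W" "w \<in> ?W" for v w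
      using that T' by (auto simp: mult_add_distrib_mat_vec smult_add_distrib_vec)
    show "c \<cdot>\<^sub>v v \<in> ?W" if "v \<in> ?W" for c v
      using that T' by (auto simp: mult_mat_vec smult_smult_assoc mult.commute)
    show "?\<rho> g *\<^sub>v w \<in> ?W" if g: "g \<in> carrier G" and w: "w \<in> ?W" for g w
    proof -
      have c: "?\<rho> g \<in> carrier_mat n n" using \<rho>(1)[OF g] by simp
      have "?T *\<^sub>v (?\<rho> g *\<^sub>v w) = (?T * ?\<rho> g) *\<^sub>v w" using T' c w by (intro assoc_mult_mat_vec[symmetric]) auto
      also have "?T * ?\<rho> g = ?\<rho> g * ?T"
        using T(2)[OF g] h.mat_hom_mult[OF T(1) \<rho>(1)[OF g]] h.mat_hom_mult[OF \<rho>(1)[OF g] T(1)] by simp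
      also have "\<dots> *\<^sub>v w = ?\<rho> g *\<^sub>v (?T *\<^sub>v w)" using T' c w by (intro assoc_mult_mat_vec) auto
      also have "\<dots> = x \<cdot>\<^sub>v (?\<rho> g *\<^sub>v w)" using c w by (auto simp: mult_mat_vec)
      finally show ?thesis using c w by auto
    qed
  qed (use T' in auto)
  then have W: "?W = carrier_vec n" using v by auto
  have entry: "?h (T $$ (i, j)) = (if i = j then x else 0)" if ij: "i < n" "j < n" for i j
  proof -
    have "unit_vec n j \<in> ?W" unfolding W by simp
    then have "col ?T j = x \<cdot>\<^sub>v unit_vec n j" using mult_unit_vec_eq_col[OF T' ij(2)] by simp
    then have "col ?T j $ i = (x \<cdot>\<^sub>v unit_vec n j) $ i" by simp
    then show ?thesis using ij T by (auto split: if_splits)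
  qed
  have "T $$ (i, j) = (if i = j then T $$ (0, 0) else 0)" if ij: "i < n" "j < n" for i j
  proof -
    have "?h (T $$ (i, j)) = ?h (if i = j then T $$ (0, 0) else 0)"
      using entry[OF ij] entry[of 0 0] n by auto
    then show ?thesis by simp
  qed
  then show ?thesis by blast
qed

definition rep_coeff :: "nat \<Rightarrow> ('g \<Rightarrow> nat \<Rightarrow> nat \<Rightarrow> 'k::field) \<Rightarrow> bool" where
  "rep_coeff n R \<longleftrightarrow> (\<forall>g \<in> carrier G. \<forall>h \<in> carrier G. \<forall>a<n. \<forall>b<n. R (g \<otimes> h) a b = (\<Sum>c<n. R g a c * R h c b)) \<and>
     (\<forall>a<n. \<forall>b<n. R \<one> a b = of_bool (a = b))"

lemma rep_coeff_matrix_rep: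
  assumes "matrix_rep G (n, \<rho> :: _ \<Rightarrow> 'k::field mat)"
  shows "rep_coeff n (\<lambda>g a b. \<rho> g $$ (a, b))"
  unfolding rep_coeff_def
proof (intro conjI ballI allI impI)
  fix g h a b assume a: "g \<in> carrier G" "h \<in> carrier G" "a < n" "b < n"
  then show "\<rho> (g \<otimes> h) $$ (a, b) = (\<Sum>c<n. \<rho> g $$ (a, c) * \<rho> h $$ (c, b))"
    using matrix_repD(1)[OF assms a(1)] matrix_repD(1)[OF assms a(2)]
    by (simp add: matrix_repD(2)[OF assms] scalar_prod_def atLeast0LessThan)
qed (simp add: matrix_repD(3)[OF assms])

text \<open>
  The sum of the \<open>R' g X R (inv g)\<close>, for \<open>X\<close> the elementary matrix at \<open>(d, b)\<close>, is an intertwiner; the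
  statement spells this out in matrix entries.
\<close>

lemma average_intertwines:
  fixes R R' :: "'g \<Rightarrow> nat \<Rightarrow> nat \<Rightarrow> 'k::field"
  assumes R: "rep_coeff n R" and R': "rep_coeff m R'" and h: "h \<in> carrier G"
    and "b < n" "d < m" "a < n" "c < m"
  shows "(\<Sum>x<n. (\<Sum>g\<in>carrier G. R' g c d * R (inv g) b x) * R h x a) =
    (\<Sum>y<m. R' h c y * (\<Sum>g\<in>carrier G. R' g y d * R (inv g) b a))"
proof -
  have "(\<Sum>x<n. (\<Sum>g\<in>carrier G. R' g c d * R (inv g) b x) * R h x a) =
      (\<Sum>g\<in>carrier G. R' g c d * (\<Sum>x<n. R (inv g) b x * R h x a))"
    unfolding sum_distrib_left sum_distrib_right by (subst sum.swap) (simp add: mult.assoc)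
  also have "\<dots> = (\<Sum>g\<in>carrier G. R' g c d * R (inv g \<otimes> h) b a)"
    using assms by (intro sum.cong refl) (simp add: rep_coeff_def)
  also have "\<dots> = (\<Sum>g\<in>carrier G. R' (h \<otimes> g) c d * R (inv g) b a)"
  proof (rule sum.reindex_bij_witness[of _ "\<lambda>g. h \<otimes> g" "\<lambda>g. inv h \<otimes> g"])
    show "R' (h \<otimes> (inv h \<otimes> g)) c d * R (inv (inv h \<otimes> g)) b a = R' g c d * R (inv g \<otimes> h) b a"
      if "g \<in> carrier G" for g
      using that h by (simp add: m_assoc[symmetric] inv_mult_group)
  qed (use h in \<open>auto simp: m_assoc[symmetric]\<close>)
  also have "\<dots> = (\<Sum>g\<in>carrier G. (\<Sum>y<m. R' h c y * R' g y d) * R (inv g) b a)"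
    using assms by (intro sum.cong refl) (simp add: rep_coeff_def)
  also have "\<dots> = (\<Sum>y<m. R' h c y * (\<Sum>g\<in>carrier G. R' g y d * R (inv g) b a))"
    unfolding sum_distrib_left sum_distrib_right by (subst sum.swap) (simp add: mult.assoc)
  finally show ?thesis .
qed

lemma average_mat:
  fixes \<rho> \<sigma> :: "'g \<Rightarrow> 'k::field mat"
  assumes \<rho>: "matrix_rep G (n, \<rho>)" and \<sigma>: "matrix_rep G (m, \<sigma>)" and "b < n" "d < m" and h: "h \<in> carrier G"
  defines "T \<equiv> mat m n (\<lambda>(c, a). \<Sum>g\<in>carrier G. \<sigma> g $$ (c, d) * \<rho> (inv g) $$ (b, a))"
  shows "T * \<rho> h = \<sigma> h * T"
proof (rule eq_matI)
  note carr = matrix_repD(1)[OF \<rho> h] matrix_repD(1)[OF \<sigma> h]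
  fix c a assume "c < dim_row (\<sigma> h * T)" "a < dim_col (\<sigma> h * T)"
  then have ca: "c < m" "a < n" using carr by (auto simp: T_def)
  show "(T * \<rho> h) $$ (c, a) = (\<sigma> h * T) $$ (c, a)"
    using average_intertwines[OF rep_coeff_matrix_rep[OF \<rho>] rep_coeff_matrix_rep[OF \<sigma>] h assms(3,4) ca(2,1)] carr ca
    by (simp add: T_def scalar_prod_def atLeast0LessThan)
qed (use matrix_repD(1)[OF \<rho> h] matrix_repD(1)[OF \<sigma> h] in \<open>auto simp: T_def\<close>)

lemma orthogonality_distinct:
  fixes \<rho> \<sigma> :: "'g \<Rightarrow> 'k::field mat"
  assumes irr: "irreducible_rep G (n, \<rho>)" "irreducible_rep G (m, \<sigma>)" "((n, \<rho>), (m, \<sigma>)) \<notin> iso_reps G"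
    and "a < n" "b < n" "c < m" "d < m"
  shows "(\<Sum>g\<in>carrier G. \<sigma> g $$ (c, d) * \<rho> (inv g) $$ (b, a)) = 0"
proof -
  let ?T = "mat m n (\<lambda>(c, a). \<Sum>g\<in>carrier G. \<sigma> g $$ (c, d) * \<rho> (inv g) $$ (b, a))"
  have "?T = 0\<^sub>m m n"
    by (rule schur_zero[OF irr(1,2) _ average_mat irr(3)]) (use assms irreducible_repD(1) in auto)
  then have "?T $$ (c, a) = 0" using assms by simp
  then show ?thesis using assms by simp
qed

text \<open>
  The average of an elementary matrix is a scalar matrix, and comparing traces determines the scalar.
  For a matrix of trace \<open>1\<close> the comparison also shows that the degree is invertible in the field.
\<close>

lemma orthogonality_same:
  fixes \<rho> :: "'g \<Rightarrow> 'k::field mat"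
  assumes irr: "irreducible_rep G (n, \<rho>)" "absolutely_irreducible_rep G (n, \<rho>)"
    and order: "(of_nat (card (carrier G)) :: 'k) \<noteq> 0"
  shows "(of_nat n :: 'k) \<noteq> 0"
    and "a < n \<Longrightarrow> b < n \<Longrightarrow> c < n \<Longrightarrow> d < n \<Longrightarrow>
      (\<Sum>g\<in>carrier G. \<rho> g $$ (c, d) * \<rho> (inv g) $$ (b, a)) =
      (if c = a \<and> b = d then of_nat (card (carrier G)) / of_nat n else 0)"
proof -
  note rep = irreducible_repD(1)[OF irr(1)]
  have n: "n \<noteq> 0" using irreducible_repD(2)[OF irr(1)] .
  define S where "S b d c a = (\<Sum>g\<in>carrier G. \<rho> g $$ (c, d) * \<rho> (inv g) $$ (b, a))" for a b c d
  have main: "\<exists>x. (\<forall>c<n. \<forall>a<n. S b d c a = (if c = a then x else 0)) \<and>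
      of_nat n * x = of_nat (card (carrier G)) * of_bool (b = d)" if bd: "b < n" "d < n" for b d
  proof -
    let ?T = "mat n n (\<lambda>(c, a). \<Sum>g\<in>carrier G. \<rho> g $$ (c, d) * \<rho> (inv g) $$ (b, a))"
    have "\<exists>x. \<forall>i<n. \<forall>j<n. ?T $$ (i, j) = (if i = j then x else 0)"
      using bd by (intro schur_scalar[OF rep irr(2) _ average_mat[OF rep rep]]) auto
    then obtain x where x: "\<And>c a. c < n \<Longrightarrow> a < n \<Longrightarrow> S b d c a = (if c = a then x else 0)"
      unfolding S_def by auto
    have "of_nat n * x = (\<Sum>a<n. S b d a a)" using x by simp
    also have "\<dots> = (\<Sum>g\<in>carrier G. \<Sum>a<n. \<rho> (inv g) $$ (b, a) * \<rho> g $$ (a, d))"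
      unfolding S_def by (subst sum.swap) (simp add: mult.commute)
    also have "\<dots> = (\<Sum>g\<in>carrier G. of_bool (b = d))"
    proof (rule sum.cong[OF refl])
      fix g assume g: "g \<in> carrier G"
      have "\<rho> (inv g \<otimes> g) $$ (b, d) = (\<Sum>a<n. \<rho> (inv g) $$ (b, a) * \<rho> g $$ (a, d))"
        using rep_coeff_matrix_rep[OF rep] g bd unfolding rep_coeff_def by blast
      moreover have "\<rho> \<one> $$ (b, d) = of_bool (b = d)"
        using rep_coeff_matrix_rep[OF rep] bd unfolding rep_coeff_def by blast
      ultimately show "(\<Sum>a<n. \<rho> (inv g) $$ (b, a) * \<rho> g $$ (a, d)) = of_bool (b = d)"
        using g by simp
    qed
    finally show ?thesis using x by (intro exI[of _ x]) auto
  qed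
  show n': "(of_nat n :: 'k) \<noteq> 0"
    using main[of 0 0] n order by auto
  show "(\<Sum>g\<in>carrier G. \<rho> g $$ (c, d) * \<rho> (inv g) $$ (b, a)) =
      (if c = a \<and> b = d then of_nat (card (carrier G)) / of_nat n else 0)"
    if abcd: "a < n" "b < n" "c < n" "d < n"
  proof -
    obtain x where "(\<forall>c<n. \<forall>a<n. S b d c a = (if c = a then x else 0)) \<and>
        of_nat n * x = of_nat (card (carrier G)) * of_bool (b = d)"
      using main[OF abcd(2,4)] by blast
    then have "S b d c a = (if c = a then x else 0)" "of_nat n * x = of_nat (card (carrier G)) * of_bool (b = d)"
      using abcd by simp_all
    then show ?thesis using n' unfolding S_def by (auto simp: field_simps)
  qed
qed

end


section \<open>Matrix units of the group algebra\<close>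


definition scale_fun :: "'k::field \<Rightarrow> ('a \<Rightarrow> 'k) \<Rightarrow> 'a \<Rightarrow> 'k" where
  "scale_fun c f = (\<lambda>x. c * f x)"

text \<open>
  Bases and dimensions of subspaces of the regular representation are taken in this space.
\<close>

interpretation fun_space: vector_space "scale_fun :: 'k::field \<Rightarrow> ('a \<Rightarrow> 'k) \<Rightarrow> 'a \<Rightarrow> 'k"
  by unfold_locales (auto simp: scale_fun_def fun_eq_iff algebra_simps)

lemma sum_fun_apply: "(\<Sum>i\<in>I. (f i :: 'a \<Rightarrow> 'k::field)) x = (\<Sum>i\<in>I. f i x)"
  by (induction I rule: infinite_finite_induct) auto

lemma (in finite_group) span_deltas:
  fixes w :: "'g \<Rightarrow> 'k::field"
  assumes "\<And>x. x \<notin> carrier G \<Longrightarrow> w x = 0"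
  shows "w \<in> fun_space.span ((\<lambda>g x. of_bool (g = x)) ` carrier G)"
proof -
  have "w = (\<Sum>g\<in>carrier G. scale_fun (w g) (\<lambda>x. of_bool (g = x)))"
  proof
    fix x
    have "(\<Sum>g\<in>carrier G. scale_fun (w g) (\<lambda>x. of_bool (g = x))) x = (\<Sum>g\<in>carrier G. w g * of_bool (x = g))"
      by (auto simp: sum_fun_apply scale_fun_def intro!: sum.cong)
    then show "w x = (\<Sum>g\<in>carrier G. scale_fun (w g) (\<lambda>x. of_bool (g = x))) x"
      using assms finite_G by (simp add: sum_kronecker)
  qed
  also have "\<dots> \<in> fun_space.span ((\<lambda>g x. of_bool (g = x)) ` carrier G)"
    by (intro fun_space.span_sum fun_space.span_scale fun_space.span_base) auto
  finally show ?thesis .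
qed

text \<open>
  A system of representatives of all irreducible representations, starting with the trivial one.
\<close>

locale irrep_system = finite_group G for G :: "('g, 'b) monoid_scheme" (structure) +
  fixes r :: nat and irr :: "nat \<Rightarrow> nat \<times> ('g \<Rightarrow> 'k::field mat)"
  assumes irreducible: "i \<le> r \<Longrightarrow> irreducible_rep G (irr i)"
    and absolutely_irreducible: "i \<le> r \<Longrightarrow> absolutely_irreducible_rep G (irr i)"
    and distinct: "i \<le> r \<Longrightarrow> l \<le> r \<Longrightarrow> i \<noteq> l \<Longrightarrow> (irr i, irr l) \<notin> iso_reps G"
    and exhaust: "irreducible_rep G x \<Longrightarrow> \<exists>i\<le>r. (x, irr i) \<in> iso_reps G"
    and irr_0: "irr 0 = trivial_rep"
    and order_nonzero: "(of_nat (card (carrier G)) :: 'k) \<noteq> 0"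
begin

definition n :: "nat \<Rightarrow> nat" where "n i = fst (irr i)"

definition R :: "nat \<Rightarrow> 'g \<Rightarrow> nat \<Rightarrow> nat \<Rightarrow> 'k" where "R i g a b = snd (irr i) g $$ (a, b)"

definition E :: "nat \<Rightarrow> nat \<Rightarrow> nat \<Rightarrow> 'g \<Rightarrow> 'k" where
  "E i a b g = of_nat (n i) / of_nat (card (carrier G)) * R i (inv g) b a"

lemma irr_eq: "irr i = (n i, snd (irr i))"
  by (simp add: n_def)

lemma R_mult:
  assumes "i \<le> r" "g \<in> carrier G" "h \<in> carrier G" "a < n i" "b < n i"
  shows "R i (g \<otimes> h) a b = (\<Sum>c<n i. R i g a c * R i h c b)"
proof -
  have "matrix_rep G (n i, snd (irr i))"
    using irreducible[OF assms(1)] irr_eq[of i] irreducible_repD(1) by metis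
  from rep_coeff_matrix_rep[OF this] show ?thesis
    using assms unfolding rep_coeff_def R_def by blast
qed

lemma R_one:
  assumes "i \<le> r" "a < n i" "b < n i"
  shows "R i \<one> a b = of_bool (a = b)"
proof -
  have "matrix_rep G (n i, snd (irr i))"
    using irreducible[OF assms(1)] irr_eq[of i] irreducible_repD(1) by metis
  from rep_coeff_matrix_rep[OF this] show ?thesis
    using assms unfolding rep_coeff_def R_def by blast
qed

lemma n_nonzero: "i \<le> r \<Longrightarrow> (of_nat (n i) :: 'k) \<noteq> 0"
  using orthogonality_same(1)[of "n i" "snd (irr i)"] irreducible absolutely_irreducible order_nonzero
  by (simp flip: irr_eq)

lemma orthogonality:
  assumes "i \<le> r" "l \<le> r" "a < n i" "b < n i" "c < n l" "d < n l"
  shows "(\<Sum>g\<in>carrier G. E i a b g * R l g c d) = of_bool (i = l \<and> a = c \<and> b = d)"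
proof -
  have "(\<Sum>g\<in>carrier G. E i a b g * R l g c d) = of_nat (n i) / of_nat (card (carrier G)) *
      (\<Sum>g\<in>carrier G. snd (irr l) g $$ (c, d) * snd (irr i) (inv g) $$ (b, a))"
    by (simp add: E_def R_def sum_distrib_left ac_simps)
  also have "\<dots> = of_bool (i = l \<and> a = c \<and> b = d)"
  proof (cases "i = l")
    case True
    then show ?thesis
      using orthogonality_same(2)[of "n i" "snd (irr i)" a b c d] irreducible absolutely_irreducible
        order_nonzero n_nonzero[of i] assms by (auto simp flip: irr_eq)
  next
    case False
    then show ?thesis
      using orthogonality_distinct[of "n i" "snd (irr i)" "n l" "snd (irr l)" a b c d] irreducible
        distinct[OF assms(1,2)] assms by (simp flip: irr_eq)
  qed
  finally show ?thesis .
qed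

text \<open>
  A translate of a matrix unit is a combination of matrix units with matrix coefficients as
  coefficients; this turns products in the group algebra into the orthogonality relations.
\<close>

lemma E_translate:
  assumes "i \<le> r" "g \<in> carrier G" "h \<in> carrier G" "a < n i" "b < n i"
  shows "E i a b (inv h \<otimes> g) = (\<Sum>c<n i. E i c b g * R i h c a)"
    and "E i a b (inv h \<otimes> g) = (\<Sum>c<n i. of_nat (n i) / of_nat (card (carrier G)) * R i (inv g) b c * R i h c a)"
proof -
  have "inv (inv h \<otimes> g) = inv g \<otimes> h" using assms by (simp add: inv_mult_group)
  then show "E i a b (inv h \<otimes> g) = (\<Sum>c<n i. of_nat (n i) / of_nat (card (carrier G)) * R i (inv g) b c * R i h c a)"
    using assms by (simp add: E_def R_mult sum_distrib_left mult.assoc)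
  then show "E i a b (inv h \<otimes> g) = (\<Sum>c<n i. E i c b g * R i h c a)"
    by (simp add: E_def)
qed

lemma group_conv_E:
  assumes "i \<le> r" "g \<in> carrier G" "a < n i" "b < n i"
  shows "group_conv G z (E i a b) g = (\<Sum>c<n i. E i c b g * (\<Sum>h\<in>carrier G. z h * R i h c a))"
proof -
  have "group_conv G z (E i a b) g = (\<Sum>h\<in>carrier G. \<Sum>c<n i. E i c b g * (z h * R i h c a))"
    unfolding group_conv_def using assms
    by (intro sum.cong refl) (simp add: E_translate(1) sum_distrib_left ac_simps)
  then show ?thesis by (simp add: sum.swap[of _ "{..<n i}"] sum_distrib_left)
qed

lemma E_E:
  assumes "i \<le> r" "l \<le> r" "a < n i" "b < n i" "c < n l" "d < n l" "g \<in> carrier G"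
  shows "group_conv G (E i a b) (E l c d) g = (if i = l \<and> b = c then E i a d g else 0)"
proof -
  have "group_conv G (E i a b) (E l c d) g = (\<Sum>x<n l. E l x d g * of_bool (i = l \<and> a = x \<and> b = c))"
    using assms by (simp add: group_conv_E orthogonality)
  also have "\<dots> = (if i = l \<and> b = c then \<Sum>x<n l. E l x d g * of_bool (a = x) else 0)"
    by auto
  finally show ?thesis using assms by (auto simp: sum_kronecker)
qed

lemma E_g_E:
  assumes "i \<le> r" "l \<le> r" "a < n i" "b < n i" "c < n l" "d < n l" "h \<in> carrier G" "g \<in> carrier G"
  shows "group_conv G (E i a b) (group_conv G (\<lambda>x. of_bool (h = x)) (E l c d)) g =
    (if i = l then R i h b c * E i a d g else 0)"
proof -
  have "group_conv G (\<lambda>x. of_bool (h = x)) (E l c d) g' = (\<Sum>x<n l. E l x d g' * R l h x c)"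
    if "g' \<in> carrier G" for g'
    using that assms finite_G by (simp add: group_conv_def sum_kronecker E_translate(1))
  then have "group_conv G (E i a b) (group_conv G (\<lambda>x. of_bool (h = x)) (E l c d)) g =
      (\<Sum>g'\<in>carrier G. \<Sum>x<n l. R l h x c * (E i a b g' * E l x d (inv g' \<otimes> g)))"
    unfolding group_conv_def[of G "E i a b"] using assms
    by (intro sum.cong refl) (simp add: sum_distrib_left ac_simps)
  also have "\<dots> = (\<Sum>x<n l. R l h x c * group_conv G (E i a b) (E l x d) g)"
    by (subst sum.swap) (simp add: group_conv_def sum_distrib_left)
  also have "\<dots> = (\<Sum>x<n l. R l h x c * (if i = l \<and> b = x then E i a d g else 0))"
    using assms by (simp add: E_E)
  also have "\<dots> = (if i = l then R i h b c * E i a d g else 0)"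
    using assms by (auto simp: if_distrib cong: if_cong)
  finally show ?thesis .
qed

lemma augmentation_E:
  assumes "i \<le> r"
  shows "(\<Sum>g\<in>carrier G. E i 0 0 g) = of_bool (i = 0)"
proof -
  have n: "0 < n i" "n 0 = 1" using n_nonzero[OF assms] irr_0 by (cases "n i"; simp add: n_def trivial_rep_def)+
  have "R 0 g 0 0 = 1" for g by (simp add: R_def irr_0 trivial_rep_def)
  then have "(\<Sum>g\<in>carrier G. E i 0 0 g) = (\<Sum>g\<in>carrier G. E i 0 0 g * R 0 g 0 0)" by simp
  also have "\<dots> = of_bool (i = 0)" using n assms by (subst orthogonality) auto
  finally show ?thesis .
qed

lemma n_pos: "i \<le> r \<Longrightarrow> 0 < n i"
  using n_nonzero[of i] by (cases "n i") auto

lemma E_nonzero: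
  assumes "i \<le> r"
  shows "\<exists>g\<in>carrier G. E i 0 0 g \<noteq> 0"
proof (rule ccontr)
  assume "\<not> ?thesis"
  then have "(\<Sum>g\<in>carrier G. E i 0 0 g * R i g 0 0) = 0" by (intro sum.neutral) auto
  then show False using orthogonality[of i i 0 0 0 0] n_pos assms by simp
qed

text \<open>
  The defect of completeness.  It is a central idempotent of the group algebra which acts as zero
  in every irreducible representation.
\<close>

definition defect :: "'g \<Rightarrow> 'k" where
  "defect g = (if g \<in> carrier G then of_bool (\<one> = g) - (\<Sum>i\<le>r. \<Sum>a<n i. E i a a g) else 0)"

lemma defect_annihilates:
  assumes "i \<le> r" "c < n i" "d < n i"
  shows "(\<Sum>g\<in>carrier G. defect g * R i g c d) = 0"
proof -
  have "(\<Sum>g\<in>carrier G. defect g * R i g c d) = (\<Sum>g\<in>carrier G. of_bool (\<one> = g) * R i g c d) -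
      (\<Sum>g\<in>carrier G. \<Sum>l\<le>r. \<Sum>a<n l. E l a a g * R i g c d)"
    by (simp add: defect_def left_diff_distrib sum_subtractf sum_distrib_right)
  also have "(\<Sum>g\<in>carrier G. of_bool (\<one> = g) * R i g c d) = of_bool (c = d)"
    using assms finite_G by (simp add: sum_kronecker R_one)
  also have "(\<Sum>g\<in>carrier G. \<Sum>l\<le>r. \<Sum>a<n l. E l a a g * R i g c d) =
      (\<Sum>l\<le>r. \<Sum>a<n l. \<Sum>g\<in>carrier G. E l a a g * R i g c d)"
    by (subst sum.swap) (intro sum.cong refl sum.swap)
  also have "\<dots> = (\<Sum>l\<le>r. \<Sum>a<n l. of_bool (l = i \<and> a = c \<and> a = d))"
    using assms by (intro sum.cong refl orthogonality) auto
  also have "\<dots> = (\<Sum>l\<le>r. of_bool (i = l) * (\<Sum>a<n i. of_bool (c = a) * of_bool (c = d)))"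
  proof (intro sum.cong refl)
    fix l
    show "(\<Sum>a<n l. of_bool (l = i \<and> a = c \<and> a = d)) =
        (of_bool (i = l) * (\<Sum>a<n i. of_bool (c = a) * of_bool (c = d)) :: 'k)"
    proof (cases "i = l")
      case True
      have "(\<Sum>a<n l. of_bool (l = i \<and> a = c \<and> a = d)) = (\<Sum>a<n l. of_bool (c = a) * of_bool (c = d) :: 'k)"
        by (rule sum.cong) (use True in auto)
      then show ?thesis using True by simp
    qed simp
  qed
  also have "(\<Sum>a<n i. of_bool (c = a) * of_bool (c = d)) = (of_bool (c = d) :: 'k)"
    using assms by (subst sum_kronecker) auto
  also have "(\<Sum>l\<le>r. of_bool (i = l) * of_bool (c = d)) = (of_bool (c = d) :: 'k)"
    using assms by (subst sum_kronecker) auto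
  finally show ?thesis by simp
qed

text \<open>
  The matrix units enter through the traces of the matrices, that is, through the characters.
\<close>

lemma defect_class_function:
  assumes "g \<in> carrier G" "h \<in> carrier G"
  shows "defect (g \<otimes> h) = defect (h \<otimes> g)"
proof -
  have "(\<Sum>a<n i. R i (inv (g \<otimes> h)) a a) = (\<Sum>a<n i. R i (inv (h \<otimes> g)) a a)" if "i \<le> r" for i
  proof -
    have "(\<Sum>a<n i. R i (inv (g \<otimes> h)) a a) = (\<Sum>a<n i. \<Sum>c<n i. R i (inv h) a c * R i (inv g) c a)"
      using that assms by (simp add: inv_mult_group R_mult)
    also have "\<dots> = (\<Sum>a<n i. \<Sum>c<n i. R i (inv g) a c * R i (inv h) c a)"
      by (subst sum.swap) (simp add: mult.commute)
    also have "\<dots> = (\<Sum>a<n i. R i (inv (h \<otimes> g)) a a)"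
      using that assms by (simp add: inv_mult_group R_mult)
    finally show ?thesis .
  qed
  moreover have "\<one> = g \<otimes> h \<longleftrightarrow> \<one> = h \<otimes> g"
    using assms by (metis inv_comm)
  moreover have "(\<Sum>a<n i. E i a a x) =
      of_nat (n i) / of_nat (card (carrier G)) * (\<Sum>a<n i. R i (inv x) a a)" for i x
    unfolding E_def sum_distrib_left ..
  ultimately show ?thesis
    using assms by (auto simp: defect_def intro!: sum.cong)
qed

lemma defect_idem:
  assumes "g \<in> carrier G"
  shows "group_conv G defect defect g = defect g"
proof -
  have "group_conv G defect defect g = (\<Sum>h\<in>carrier G. defect h * (of_bool (g = h) -
      (\<Sum>i\<le>r. \<Sum>a<n i. E i a a (inv h \<otimes> g))))"
    unfolding group_conv_def
  proof (intro sum.cong refl arg_cong2[of _ _ _ _ "(*)"])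
    fix h assume h: "h \<in> carrier G"
    have "\<one> = inv h \<otimes> g \<longleftrightarrow> g = h" using h assms by (metis inv_equality inv_inv l_inv inv_closed)
    then show "defect (inv h \<otimes> g) = of_bool (g = h) - (\<Sum>i\<le>r. \<Sum>a<n i. E i a a (inv h \<otimes> g))"
      using h assms by (simp add: defect_def)
  qed
  also have "\<dots> = (\<Sum>h\<in>carrier G. defect h * of_bool (g = h)) -
      (\<Sum>h\<in>carrier G. \<Sum>i\<le>r. \<Sum>a<n i. defect h * E i a a (inv h \<otimes> g))"
    by (simp add: right_diff_distrib sum_subtractf sum_distrib_left)
  also have "(\<Sum>h\<in>carrier G. defect h * of_bool (g = h)) = defect g"
    using assms finite_G by (simp add: sum_kronecker)
  also have "(\<Sum>h\<in>carrier G. \<Sum>i\<le>r. \<Sum>a<n i. defect h * E i a a (inv h \<otimes> g)) =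
      (\<Sum>i\<le>r. \<Sum>a<n i. group_conv G defect (E i a a) g)"
    unfolding group_conv_def by (subst sum.swap) (intro sum.cong refl sum.swap)
  also have "\<dots> = 0"
    using assms by (intro sum.neutral ballI) (simp add: group_conv_E defect_annihilates)
  finally show ?thesis by simp
qed

definition translate :: "'g \<Rightarrow> ('g \<Rightarrow> 'k) \<Rightarrow> 'g \<Rightarrow> 'k" where
  "translate g w = (\<lambda>x. if x \<in> carrier G then w (inv g \<otimes> x) else 0)"

lemma translate_scale: "translate g (scale_fun c w) = scale_fun c (translate g w)"
  by (auto simp: translate_def scale_fun_def fun_eq_iff)

lemma translate_sum: "translate g (\<Sum>i\<in>I. f i) = (\<Sum>i\<in>I. translate g (f i))"
  by (auto simp: translate_def fun_eq_iff sum_fun_apply)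

lemma translate_translate:
  assumes "g \<in> carrier G" "h \<in> carrier G"
  shows "translate (g \<otimes> h) w = translate g (translate h w)"
  using assms by (auto simp: translate_def fun_eq_iff inv_mult_group m_assoc)

text \<open>The part of the regular representation on which the defect acts as the identity.\<close>

definition defect_space :: "('g \<Rightarrow> 'k) set" where
  "defect_space = {w. (\<forall>x. x \<notin> carrier G \<longrightarrow> w x = 0) \<and> (\<forall>x \<in> carrier G. group_conv G defect w x = w x)}"

definition invariant :: "('g \<Rightarrow> 'k) set \<Rightarrow> bool" where
  "invariant U \<longleftrightarrow> fun_space.subspace U \<and> (\<forall>g \<in> carrier G. \<forall>w \<in> U. translate g w \<in> U)"

lemma invariant_defect_space: "invariant defect_space"
  unfolding invariant_def
proof (intro conjI ballI)
  show "fun_space.subspace defect_space"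
    unfolding fun_space.subspace_def defect_space_def
    by (auto simp: group_conv_def scale_fun_def distrib_left sum.distrib ac_simps simp flip: sum_distrib_left)
  fix g w assume g: "g \<in> carrier G" and w: "w \<in> defect_space"
  have "group_conv G defect (translate g w) x = translate g w x" if x: "x \<in> carrier G" for x
  proof -
    have "group_conv G defect (translate g w) x = (\<Sum>h\<in>carrier G. defect h * w (inv g \<otimes> (inv h \<otimes> x)))"
      using x unfolding group_conv_def translate_def by (intro sum.cong) auto
    also have "\<dots> = (\<Sum>h\<in>carrier G. defect h * w (inv h \<otimes> (inv g \<otimes> x)))"
    proof (rule sum.reindex_bij_witness[of _ "\<lambda>h. g \<otimes> h \<otimes> inv g" "\<lambda>h. inv g \<otimes> h \<otimes> g"])
      fix h assume h: "h \<in> carrier G"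
      have "defect (inv g \<otimes> h \<otimes> g) = defect (g \<otimes> (inv g \<otimes> h))"
        using g h by (intro defect_class_function) auto
      also have "\<dots> = defect h" using g h by (simp add: m_assoc[symmetric])
      finally show "defect (inv g \<otimes> h \<otimes> g) * w (inv (inv g \<otimes> h \<otimes> g) \<otimes> (inv g \<otimes> x)) =
          defect h * w (inv g \<otimes> (inv h \<otimes> x))"
        using g h x by (simp add: inv_mult_group m_assoc) (simp add: m_assoc[symmetric])
    qed ((use g in \<open>auto simp flip: m_assoc\<close>), use g in \<open>simp_all add: m_assoc\<close>)
    also have "\<dots> = translate g w x"
      using w g x by (simp add: translate_def defect_space_def group_conv_def)
    finally show ?thesis .
  qed
  then show "translate g w \<in> defect_space" by (simp add: defect_space_def translate_def)
qed

lemma defect_space_deltas: "defect_space \<subseteq> fun_space.span ((\<lambda>g x. of_bool (g = x)) ` carrier G)"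
  by (auto simp: defect_space_def intro: span_deltas)

text \<open>
  A smallest nonzero invariant subspace of the defect space would be an irreducible
  representation, in which the defect acts both as the identity and as zero.
\<close>

lemma defect_space_trivial:
  assumes w0: "w0 \<in> defect_space"
  shows "w0 = 0"
proof (rule ccontr)
  assume "w0 \<noteq> 0"
  define Q where "Q U \<longleftrightarrow> invariant U \<and> U \<subseteq> defect_space \<and> (\<exists>w \<in> U. w \<noteq> 0)" for U
  have "Q defect_space" using w0 \<open>w0 \<noteq> 0\<close> invariant_defect_space by (auto simp: Q_def)
  then obtain U where U: "Q U" and U_min: "\<And>U'. Q U' \<Longrightarrow> fun_space.dim U \<le> fun_space.dim U'"
    using ex_has_least_nat[of Q _ fun_space.dim] by blast
  obtain B where B: "B \<subseteq> U" "fun_space.independent B" "U \<subseteq> fun_space.span B" "card B = fun_space.dim U"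
    by (rule fun_space.basis_exists)
  have sub: "fun_space.subspace U" and inv_U: "\<And>g w. g \<in> carrier G \<Longrightarrow> w \<in> U \<Longrightarrow> translate g w \<in> U"
    and U_def: "U \<subseteq> defect_space" using U by (auto simp: Q_def invariant_def)
  have finB: "finite B"
    using fun_space.independent_span_bound[OF finite_imageI[OF finite_G] B(2)] B(1) U_def defect_space_deltas by blast
  define m where "m = card B"
  obtain b where b: "bij_betw b {..<m} B"
    using ex_bij_betw_nat_finite[OF finB] by (auto simp: m_def atLeast0LessThan)
  have bU: "b a \<in> U" if "a < m" for a using b that B(1) by (auto simp: bij_betw_def)
  define comb where "comb c = (\<Sum>a<m. scale_fun (c a) (b a))" for c
  have comb_U: "comb c \<in> U" for c
    unfolding comb_def using sub bU by (intro fun_space.subspace_sum fun_space.subspace_scale) auto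
  have comb_inj: "c a = c' a" if "comb c = comb c'" "a < m" for c c' a
  proof -
    define c0 where "c0 v = c (inv_into {..<m} b v) - c' (inv_into {..<m} b v)" for v
    have "(\<Sum>v\<in>B. scale_fun (c0 v) v) = (\<Sum>a<m. scale_fun (c a - c' a) (b a))"
      using b by (subst sum.reindex_bij_betw[OF b, symmetric]) (auto simp: c0_def bij_betw_def intro!: sum.cong)
    also have "\<dots> = comb c - comb c'"
      by (simp add: comb_def fun_space.scale_left_diff_distrib sum_subtractf)
    finally have "(\<Sum>v\<in>B. scale_fun (c0 v) v) = 0" using that(1) by simp
    then have "c0 (b a) = 0"
      using fun_space.independentD[OF B(2) finB subset_refl] b that(2) by (auto simp: bij_betw_def)
    then show ?thesis using b that(2) by (simp add: c0_def bij_betw_def)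
  qed
  have comb_surj: "\<exists>c. w = comb c" if "w \<in> U" for w
  proof -
    have "w \<in> range (\<lambda>k. \<Sum>v\<in>B. scale_fun (k v) v)"
      using B(3) that fun_space.span_finite[OF finB] by blast
    then obtain k where "w = (\<Sum>v\<in>B. scale_fun (k v) v)" by blast
    then have "w = comb (\<lambda>a. k (b a))"
      unfolding comb_def by (simp add: sum.reindex_bij_betw[OF b, symmetric])
    then show ?thesis by blast
  qed
  have m0: "m \<noteq> 0"
  proof
    assume "m = 0"
    then have "U \<subseteq> {0}" using B(3) finB by (simp add: m_def)
    then show False using U by (auto simp: Q_def)
  qed
  have "\<forall>g. \<exists>s. \<forall>a<m. g \<in> carrier G \<longrightarrow> translate g (b a) = comb (\<lambda>c. s c a)"
  proof
    fix g
    have "\<forall>a. \<exists>s. a < m \<longrightarrow> g \<in> carrier G \<longrightarrow> translate g (b a) = comb s"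
      using comb_surj inv_U bU by blast
    then obtain s where "\<forall>a. a < m \<longrightarrow> g \<in> carrier G \<longrightarrow> translate g (b a) = comb (s a)" by metis
    then show "\<exists>s. \<forall>a<m. g \<in> carrier G \<longrightarrow> translate g (b a) = comb (\<lambda>c. s c a)"
      by (intro exI[of _ "\<lambda>c a. s a c"]) auto
  qed
  then obtain s where s: "\<And>g a. g \<in> carrier G \<Longrightarrow> a < m \<Longrightarrow> translate g (b a) = comb (\<lambda>c. s g c a)"
    by metis
  have translate_comb: "translate g (comb c) = comb (\<lambda>x. \<Sum>a<m. s g x a * c a)" if g: "g \<in> carrier G" for g c
  proof -
    have "translate g (comb c) = (\<Sum>a<m. scale_fun (c a) (comb (\<lambda>x. s g x a)))"
      unfolding comb_def[of c] using s[OF g] by (simp add: translate_sum translate_scale)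
    also have "\<dots> = (\<Sum>x<m. \<Sum>a<m. scale_fun (c a * s g x a) (b x))"
      unfolding comb_def by (subst sum.swap) (simp add: fun_space.scale_sum_right)
    also have "\<dots> = comb (\<lambda>x. \<Sum>a<m. s g x a * c a)"
      unfolding comb_def by (simp add: fun_space.scale_sum_left mult.commute)
    finally show ?thesis .
  qed
  have b_comb: "b a = comb (\<lambda>x. of_bool (a = x))" if "a < m" for a
  proof -
    have "comb (\<lambda>x. of_bool (a = x)) = (\<Sum>x<m. if x = a then b a else 0)"
      unfolding comb_def by (intro sum.cong) auto
    then show ?thesis using that by simp
  qed
  define \<sigma> where "\<sigma> g = mat m m (\<lambda>(x, a). s g x a)" for g
  have rep: "matrix_rep G (m, \<sigma>)"
  proof (rule matrix_repI)
    show "\<sigma> g \<in> carrier_mat m m" for g by (simp add: \<sigma>_def)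
    show "\<sigma> (g \<otimes> h) = \<sigma> g * \<sigma> h" if gh: "g \<in> carrier G" "h \<in> carrier G" for g h
    proof (rule eq_matI)
      fix x a assume "x < dim_row (\<sigma> g * \<sigma> h)" "a < dim_col (\<sigma> g * \<sigma> h)"
      then have xa: "x < m" "a < m" by (auto simp: \<sigma>_def)
      have "comb (\<lambda>x. s (g \<otimes> h) x a) = comb (\<lambda>x. \<Sum>y<m. s g x y * s h y a)"
        using gh xa s translate_translate[of g h "b a"] translate_comb by simp
      from comb_inj[OF this xa(1)] show "\<sigma> (g \<otimes> h) $$ (x, a) = (\<sigma> g * \<sigma> h) $$ (x, a)"
        using xa by (simp add: \<sigma>_def scalar_prod_def atLeast0LessThan)
    qed (auto simp: \<sigma>_def)
    show "\<sigma> \<one> = 1\<^sub>m m"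
    proof (rule eq_matI)
      fix x a assume "x < dim_row (1\<^sub>m m :: 'k mat)" "a < dim_col (1\<^sub>m m :: 'k mat)"
      then have xa: "x < m" "a < m" by auto
      have "b a \<in> defect_space" using bU[OF xa(2)] U_def by blast
      then have "translate \<one> (b a) = b a" by (auto simp: translate_def defect_space_def fun_eq_iff)
      then have "comb (\<lambda>x. s \<one> x a) = comb (\<lambda>x. of_bool (a = x))" using s[of \<one> a] b_comb xa by simp
      from comb_inj[OF this xa(1)] show "\<sigma> \<one> $$ (x, a) = 1\<^sub>m m $$ (x, a)"
        using xa by (auto simp: \<sigma>_def)
    qed (auto simp: \<sigma>_def)
  qed
  \<comment> \<open>An invariant subspace of the coordinate space spans an invariant subspace of
    \<open>U\<close>, which is zero or, having the dimension of \<open>U\<close>, everything.\<close>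
  have "irreducible_rep G (m, \<sigma>)"
    unfolding irreducible_rep_def prod.case
  proof (intro conjI allI impI rep m0)
    fix W assume W: "submodule W ring_of_type_algebra (module_vec TYPE('k) m) \<and>
      (\<forall>g\<in>carrier G. \<forall>w\<in>W. \<sigma> g *\<^sub>v w \<in> W)"
    then interpret W: submodule W "ring_of_type_algebra :: 'k ring" "module_vec TYPE('k) m" by blast
    have W_sub: "W \<subseteq> carrier_vec m" and W0: "0\<^sub>v m \<in> W"
      and W_add: "\<And>v w. v \<in> W \<Longrightarrow> w \<in> W \<Longrightarrow> v + w \<in> W" and W_smult: "\<And>c v. v \<in> W \<Longrightarrow> c \<cdot>\<^sub>v v \<in> W"
      using W.subset W.one_closed W.m_closed W.smult_closed
      by (auto simp: module_vec_simps ring_of_type_algebra_def)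
    define f where "f w = comb (\<lambda>a. w $ a)" for w :: "'k vec"
    have f_inj: "v = w" if "f v = f w" "v \<in> carrier_vec m" "w \<in> carrier_vec m" for v w
      using that comb_inj[of "\<lambda>a. v $ a" "\<lambda>a. w $ a"] by (intro eq_vecI) (auto simp: f_def)
    have f_add: "f (v + w) = f v + f w" if "v \<in> carrier_vec m" "w \<in> carrier_vec m" for v w
      using that by (simp add: f_def comb_def fun_space.scale_left_distrib sum.distrib)
    have f_smult: "f (c \<cdot>\<^sub>v v) = scale_fun c (f v)" if "v \<in> carrier_vec m" for c v
      using that by (simp add: f_def comb_def fun_space.scale_sum_right)
    have f_zero: "f (0\<^sub>v m) = 0" by (simp add: f_def comb_def)
    have f_translate: "translate g (f w) = f (\<sigma> g *\<^sub>v w)" if "g \<in> carrier G" "w \<in> carrier_vec m" for g w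
    proof -
      have "comb (\<lambda>a. (\<sigma> g *\<^sub>v w) $ a) = comb (\<lambda>x. \<Sum>a<m. s g x a * w $ a)"
        using that unfolding comb_def
        by (intro sum.cong) (auto simp: \<sigma>_def scalar_prod_def atLeast0LessThan)
      then show ?thesis using translate_comb[OF that(1)] by (simp add: f_def)
    qed
    show "W = {0\<^sub>v m} \<or> W = carrier_vec m"
    proof (cases "W = {0\<^sub>v m}")
      case False
      then obtain w where w: "w \<in> W" "w \<noteq> 0\<^sub>v m" using W0 by blast
      have fw: "f w \<noteq> 0" using f_inj[of w "0\<^sub>v m"] w W_sub f_zero by auto
      have "fun_space.subspace (f ` W)"
        unfolding fun_space.subspace_def
      proof (intro conjI ballI allI)
        show "0 \<in> f ` W" using f_zero W0 by (metis imageI)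
        show "x + y \<in> f ` W" if xy: "x \<in> f ` W" "y \<in> f ` W" for x y
        proof -
          obtain v w where vw: "x = f v" "v \<in> W" "y = f w" "w \<in> W" using xy by auto
          then have vc: "v \<in> carrier_vec m" "w \<in> carrier_vec m" using W_sub by blast+
          have "x + y = f (v + w)" unfolding vw(1,3) f_add[OF vc] ..
          then show ?thesis using W_add[OF vw(2,4)] by blast
        qed
        show "scale_fun c x \<in> f ` W" if x: "x \<in> f ` W" for c x
        proof -
          obtain v where v: "x = f v" "v \<in> W" using x by auto
          then have vc: "v \<in> carrier_vec m" using W_sub by blast
          have "scale_fun c x = f (c \<cdot>\<^sub>v v)" unfolding v(1) f_smult[OF vc] ..
          then show ?thesis using W_smult[OF v(2)] by blast
        qed
      qed
      moreover have "translate g x \<in> f ` W" if "g \<in> carrier G" "x \<in> f ` W" for g x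
        using that W W_sub f_translate by auto
      moreover have "f ` W \<subseteq> U" using comb_U by (auto simp: f_def)
      ultimately have QW: "Q (f ` W)" using w fw U_def by (auto simp: Q_def invariant_def)
      obtain B' where B': "B' \<subseteq> f ` W" "fun_space.independent B'" "f ` W \<subseteq> fun_space.span B'"
        "card B' = fun_space.dim (f ` W)" by (rule fun_space.basis_exists)
      have B'B: "finite B' \<and> card B' \<le> card B"
        using fun_space.independent_span_bound[OF finB B'(2)] B'(1) B(3) \<open>f ` W \<subseteq> U\<close> by blast
      have "U \<subseteq> fun_space.span B'"
      proof (rule ccontr)
        assume "\<not> ?thesis"
        then obtain x where x: "x \<in> U" "x \<notin> fun_space.span B'" by blast
        have "fun_space.independent (insert x B')" using x B'(2) by (intro fun_space.independent_insertI)
        moreover have "insert x B' \<subseteq> fun_space.span B" using x B'(1) B(3) \<open>f ` W \<subseteq> U\<close> by blast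
        ultimately have "card (insert x B') \<le> card B" using fun_space.independent_span_bound[OF finB] by blast
        moreover have "x \<notin> B'" using x fun_space.span_base by blast
        ultimately show False using U_min[OF QW] B'(4) B(4) B'B by simp
      qed
      moreover have "fun_space.span B' \<subseteq> f ` W"
        using \<open>fun_space.subspace (f ` W)\<close> B'(1) by (intro fun_space.span_minimal)
      ultimately have "U \<subseteq> f ` W" by blast
      have "v \<in> W" if v: "v \<in> carrier_vec m" for v
      proof -
        have "f v \<in> f ` W" using comb_U \<open>U \<subseteq> f ` W\<close> by (auto simp: f_def)
        then obtain v' where "v' \<in> W" "f v = f v'" by auto
        then show ?thesis using f_inj[of v v'] v W_sub by auto
      qed
      then show ?thesis using W_sub by blast
    qed simp
  qed
  then obtain i where i: "i \<le> r" "((m, \<sigma>), irr i) \<in> iso_reps G" using exhaust by blast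
  then have "((m, \<sigma>), (n i, snd (irr i))) \<in> iso_reps G" using irr_eq[of i] by simp
  then obtain P Q' where pq: "m = n i" "matrix_rep G (m, snd (irr i))" "P \<in> carrier_mat m m" "Q' \<in> carrier_mat m m"
    "Q' * P = 1\<^sub>m m" "\<And>g. g \<in> carrier G \<Longrightarrow> P * \<sigma> g = snd (irr i) g * P"
    by (rule iso_repsE) blast
  have \<sigma>_eq: "\<sigma> g = Q' * (snd (irr i) g * P)" if g: "g \<in> carrier G" for g
  proof -
    have c: "\<sigma> g \<in> carrier_mat m m" by (simp add: \<sigma>_def)
    have "Q' * (snd (irr i) g * P) = Q' * (P * \<sigma> g)" using pq(6)[OF g] by simp
    also have "\<dots> = Q' * P * \<sigma> g" using pq c by (intro assoc_mult_mat[symmetric]) auto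
    finally show ?thesis using pq(5) c by simp
  qed
  \<comment> \<open>\<open>\<sigma>\<close> is conjugate to one of the given representations, so
    the defect acts on it as zero.\<close>
  have zero: "(\<Sum>g\<in>carrier G. defect g * s g x a) = 0" if xa: "x < m" "a < m" for x a
  proof -
    have "s g x a = (\<Sum>c<m. \<Sum>d<m. Q' $$ (x, c) * P $$ (d, a) * R i g c d)" if g: "g \<in> carrier G" for g
    proof -
      have c: "snd (irr i) g \<in> carrier_mat m m" using matrix_repD(1)[OF pq(2) g] .
      have "s g x a = (Q' * (snd (irr i) g * P)) $$ (x, a)"
        using xa by (simp flip: \<sigma>_eq[OF g] add: \<sigma>_def)
      also have "\<dots> = (\<Sum>c<m. Q' $$ (x, c) * (\<Sum>d<m. R i g c d * P $$ (d, a)))"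
        using xa pq(3,4) c by (simp add: scalar_prod_def atLeast0LessThan R_def)
      finally show ?thesis by (simp add: sum_distrib_left ac_simps)
    qed
    then have "(\<Sum>g\<in>carrier G. defect g * s g x a) =
      (\<Sum>g\<in>carrier G. \<Sum>c<m. \<Sum>d<m. Q' $$ (x, c) * P $$ (d, a) * (defect g * R i g c d))"
      by (intro sum.cong refl) (simp add: sum_distrib_left ac_simps)
    also have "\<dots> = (\<Sum>c<m. \<Sum>d<m. Q' $$ (x, c) * P $$ (d, a) * (\<Sum>g\<in>carrier G. defect g * R i g c d))"
      unfolding sum_distrib_left by (subst sum.swap) (intro sum.cong refl sum.swap)
    also have "\<dots> = 0" using pq(1) i by (simp add: defect_annihilates)
    finally show ?thesis .
  qed
  have "b 0 = 0"
  proof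
    fix x
    have b0: "b 0 \<in> defect_space" using bU[of 0] m0 U_def by blast
    show "b 0 x = 0 x"
    proof (cases "x \<in> carrier G")
      case True
      have "b 0 x = (\<Sum>g\<in>carrier G. defect g * translate g (b 0) x)"
        using b0 True by (simp add: defect_space_def group_conv_def translate_def)
      also have "\<dots> = (\<Sum>g\<in>carrier G. \<Sum>a<m. b a x * (defect g * s g a 0))"
        using s[of _ 0] m0 by (intro sum.cong refl)
          (simp add: comb_def sum_fun_apply scale_fun_def sum_distrib_left ac_simps)
      also have "\<dots> = (\<Sum>a<m. b a x * (\<Sum>g\<in>carrier G. defect g * s g a 0))"
        by (subst sum.swap) (simp add: sum_distrib_left)
      also have "\<dots> = 0" using zero m0 by simp
      finally show ?thesis by simp
    qed (use b0 in \<open>simp add: defect_space_def\<close>)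
  qed
  moreover have "b 0 \<in> B" using b m0 by (auto simp: bij_betw_def)
  ultimately show False using B(2) fun_space.dependent_zero by metis
qed

lemma sum_E:
  assumes "g \<in> carrier G"
  shows "(\<Sum>i\<le>r. \<Sum>a<n i. E i a a g) = of_bool (\<one> = g)"
proof -
  have "defect \<in> defect_space"
    by (auto simp: defect_space_def defect_idem) (simp add: defect_def)
  then have "defect g = 0" using defect_space_trivial by (metis zero_fun_apply)
  then show ?thesis using assms by (simp add: defect_def)
qed

sublocale matrix_units G r n E R
  by unfold_locales
    (simp_all add: n_pos E_E E_g_E sum_E augmentation_E E_nonzero)

end

section \<open>The classes of irreducible representations\<close>

context finite_group
begin

lemma irreducible_trivial: "irreducible_rep G (trivial_rep :: nat \<times> ('g \<Rightarrow> 'k::field mat))"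
proof -
  have "matrix_rep G (1, \<lambda>_. 1\<^sub>m 1 :: 'k mat)" by (rule matrix_repI) auto
  moreover have "W = {0\<^sub>v 1} \<or> W = carrier_vec 1"
    if W: "submodule W ring_of_type_algebra (module_vec TYPE('k) 1)" for W
  proof (cases "W \<subseteq> {0\<^sub>v 1}")
    case True
    interpret submodule W "ring_of_type_algebra :: 'k ring" "module_vec TYPE('k) 1" by (rule W)
    show ?thesis using True one_closed by (auto simp: module_vec_simps)
  next
    case False
    interpret submodule W "ring_of_type_algebra :: 'k ring" "module_vec TYPE('k) 1" by (rule W)
    obtain w where w: "w \<in> W" "w \<noteq> 0\<^sub>v 1" using False by auto
    have W_sub: "W \<subseteq> carrier_vec 1" using subset by (simp add: module_vec_simps)
    then have wc: "w \<in> carrier_vec 1" using w by blast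
    have w0: "w $ 0 \<noteq> 0"
    proof
      assume "w $ 0 = 0"
      then have "w = 0\<^sub>v 1" using wc by (intro eq_vecI) auto
      then show False using w by simp
    qed
    have "v \<in> W" if v: "v \<in> carrier_vec 1" for v
    proof -
      have "v = (v $ 0 / w $ 0) \<cdot>\<^sub>v w" using v wc w0 by (intro eq_vecI) auto
      also have "\<dots> \<in> W" using smult_closed[of "v $ 0 / w $ 0" w] w
        by (simp add: module_vec_simps ring_of_type_algebra_def)
      finally show ?thesis .
    qed
    then show ?thesis using W_sub by auto
  qed
  ultimately show ?thesis by (simp add: irreducible_rep_def trivial_rep_def)
qed

text \<open>
  Matrix coefficients of pairwise inequivalent irreducible representations are linearly
  independent by orthogonality, so there are at most as many of them as group elements.
\<close>

lemma finite_inequivalent_irreps: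
  fixes sel :: "'i \<Rightarrow> nat \<times> ('g \<Rightarrow> 'k::field mat)"
  assumes irr: "\<And>q. q \<in> Q \<Longrightarrow> irreducible_rep G (sel q) \<and> absolutely_irreducible_rep G (sel q)"
    and dist: "\<And>q q'. q \<in> Q \<Longrightarrow> q' \<in> Q \<Longrightarrow> q \<noteq> q' \<Longrightarrow> (sel q, sel q') \<notin> iso_reps G"
    and order: "(of_nat (card (carrier G)) :: 'k) \<noteq> 0"
  shows "finite Q"
proof -
  define f where "f q g = (if g \<in> carrier G then snd (sel q) g $$ (0, 0) else 0)" for q g
  define x where "x q = (\<Sum>g\<in>carrier G. f q g * snd (sel q) (inv g) $$ (0, 0))" for q
  have eq: "sel q = (fst (sel q), snd (sel q))" for q by simp
  have pos: "0 < fst (sel q)" if "q \<in> Q" for q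
    using irr[OF that] irreducible_repD(2)[of "fst (sel q)" "snd (sel q)"] by simp
  have x: "x q \<noteq> 0" if "q \<in> Q" for q
  proof -
    have "(\<Sum>g\<in>carrier G. snd (sel q) g $$ (0, 0) * snd (sel q) (inv g) $$ (0, 0)) =
        of_nat (card (carrier G)) / of_nat (fst (sel q))"
      using orthogonality_same(2)[of "fst (sel q)" "snd (sel q)" 0 0 0 0] irr[OF that] order pos[OF that] by simp
    moreover have "(of_nat (fst (sel q)) :: 'k) \<noteq> 0"
      using orthogonality_same(1)[of "fst (sel q)" "snd (sel q)"] irr[OF that] order by simp
    ultimately show ?thesis using order by (simp add: x_def f_def)
  qed
  have orth: "(\<Sum>g\<in>carrier G. f q' g * snd (sel q) (inv g) $$ (0, 0)) = of_bool (q' = q) * x q"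
    if "q \<in> Q" "q' \<in> Q" for q q'
  proof (cases "q' = q")
    case False
    then show ?thesis
      using orthogonality_distinct[of "fst (sel q)" "snd (sel q)" "fst (sel q')" "snd (sel q')" 0 0 0 0]
        irr[OF that(1)] irr[OF that(2)] dist[OF that] pos that by (simp add: f_def)
  qed (simp add: x_def)
  have inj: "inj_on f Q"
  proof (rule inj_onI)
    fix q q' assume q: "q \<in> Q" "q' \<in> Q" "f q = f q'"
    then have "of_bool (q' = q) * x q = x q" using orth[of q q'] by (simp add: x_def)
    then show "q = q'" using x q by (auto simp: of_bool_def split: if_splits)
  qed
  have "fun_space.independent (f ` Q)"
    unfolding fun_space.independent_explicit_finite_subsets
  proof (intro allI impI ballI)
    fix S and c :: "('g \<Rightarrow> 'k) \<Rightarrow> 'k" and v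
    assume S: "S \<subseteq> f ` Q" "finite S" and z: "(\<Sum>v\<in>S. scale_fun (c v) v) = 0" and v: "v \<in> S"
    obtain Q' where Q': "Q' \<subseteq> Q" "finite Q'" "S = f ` Q'"
      using finite_subset_image[OF S(2,1)] by blast
    obtain q where q: "q \<in> Q'" "v = f q" using v Q' by auto
    have injQ': "inj_on f Q'" using inj Q'(1) by (rule inj_on_subset)
    have z': "(\<Sum>q'\<in>Q'. c (f q') * f q' g) = 0" for g
      using fun_cong[OF z, of g] unfolding Q'(3)
      by (simp add: sum.reindex[OF injQ'] sum_fun_apply scale_fun_def)
    have "0 = (\<Sum>g\<in>carrier G. (\<Sum>q'\<in>Q'. c (f q') * f q' g) * snd (sel q) (inv g) $$ (0, 0))"
      by (simp add: z')
    also have "\<dots> = (\<Sum>q'\<in>Q'. c (f q') * (\<Sum>g\<in>carrier G. f q' g * snd (sel q) (inv g) $$ (0, 0)))"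
      unfolding sum_distrib_right sum_distrib_left by (subst sum.swap) (simp add: mult.assoc)
    also have "\<dots> = (\<Sum>q'\<in>Q'. of_bool (q = q') * (c (f q') * x q))"
      using Q'(1) q(1) by (intro sum.cong refl) (auto simp: orth subset_iff)
    also have "\<dots> = c v * x q" using Q' q by (simp add: sum_kronecker)
    finally show "c v = 0" using x Q' q by auto
  qed
  moreover have "f ` Q \<subseteq> fun_space.span ((\<lambda>g x. of_bool (g = x)) ` carrier G)"
  proof
    fix w assume "w \<in> f ` Q"
    then have w: "w y = 0" if "y \<notin> carrier G" for y using that by (auto simp: f_def)
    show "w \<in> fun_space.span ((\<lambda>g x. of_bool (g = x)) ` carrier G)"
      by (rule span_deltas) (rule w)
  qed
  ultimately have "finite (f ` Q)"
    using fun_space.independent_span_bound[of "(\<lambda>g x. of_bool (g = x)) ` carrier G" "f ` Q"] finite_G by simp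
  then show "finite Q" using inj by (rule finite_imageD)
qed

end

theorem theorem1p2p4:
  fixes G :: "('g, 'b) monoid_scheme"
  assumes "group G" and "finite (carrier G)"
    and "splitting_field_for TYPE('k::field) G"
    and "(of_nat (Coset.order G) :: 'k) dvd 1"
  shows "equivalent_categories
           (Rep TYPE('k) TYPE('v::infinite) (FI\<^sub>G G :: ('s::infinite set, _) cat))
           (Rep TYPE('k) TYPE('v)
              (prod_cat (FI :: ('s set, _) cat)
                 (power_cat (FB :: ('s set, _) cat) (num_nontrivial_irreps TYPE('k) G))))"
proof -
  interpret finite_group G
    by (intro finite_group.intro finite_group_axioms.intro assms)
  have order: "(of_nat (card (carrier G)) :: 'k) \<noteq> 0"
    using assms(4) by (auto simp: Coset.order_def)
  have split: "absolutely_irreducible_rep G x" if "irreducible_rep G x" for x :: "nat \<times> ('g \<Rightarrow> 'k mat)"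
    using assms(3) that unfolding splitting_field_for_def by blast
  have mrep: "matrix_rep G x" if "irreducible_rep G x" for x :: "nat \<times> ('g \<Rightarrow> 'k mat)"
    using that irreducible_repD(1)[of "fst x" "snd x"] by simp
  define A where "A = {\<rho> :: nat \<times> ('g \<Rightarrow> 'k mat). irreducible_rep G \<rho> \<and> (\<rho>, trivial_rep) \<notin> iso_reps G}"
  define Q where "Q = A // iso_reps G"
  define r where "r = num_nontrivial_irreps TYPE('k) G"
  have r: "r = card Q" by (simp add: r_def num_nontrivial_irreps_def Q_def A_def)
  have "\<forall>q \<in> Q. \<exists>x. x \<in> A \<and> q = iso_reps G `` {x}" by (auto simp: Q_def quotient_def)
  then obtain sel where sel: "\<And>q. q \<in> Q \<Longrightarrow> sel q \<in> A \<and> q = iso_reps G `` {sel q}" by metis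
  have sel_distinct: "(sel q, sel q') \<notin> iso_reps G" if q: "q \<in> Q" "q' \<in> Q" "q \<noteq> q'" for q q'
  proof
    assume iso: "(sel q, sel q') \<in> iso_reps G"
    have "iso_reps G `` {sel q} = iso_reps G `` {sel q'}"
      using iso iso_reps_sym iso_reps_trans by blast
    then show False using sel q by metis
  qed
  have fin: "finite Q"
    by (rule finite_inequivalent_irreps[of Q sel])
      (use sel sel_distinct split order in \<open>auto simp: A_def\<close>)
  obtain b where b: "bij_betw b {..<r} Q"
    using ex_bij_betw_nat_finite[OF fin] by (auto simp: r atLeast0LessThan)
  define irr where "irr i = (case i of 0 \<Rightarrow> trivial_rep | Suc k \<Rightarrow> sel (b k))" for i
  have bQ: "b k \<in> Q" if "k < r" for k using b that by (auto simp: bij_betw_def)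
  interpret irrep_system G r irr
  proof (intro irrep_system.intro irrep_system_axioms.intro finite_group_axioms)
    show irred: "irreducible_rep G (irr i)" if "i \<le> r" for i
    proof (cases i)
      case (Suc k)
      then show ?thesis using sel[OF bQ[of k]] that by (simp add: irr_def A_def)
    qed (simp add: irr_def irreducible_trivial)
    then show "absolutely_irreducible_rep G (irr i)" if "i \<le> r" for i
      using that split by blast
    show "irr 0 = trivial_rep" by (simp add: irr_def)
    show "(of_nat (card (carrier G)) :: 'k) \<noteq> 0" by (rule order)
    have nontriv: "(irr (Suc k), trivial_rep) \<notin> iso_reps G" if "k < r" for k
      using sel[OF bQ[OF that]] by (simp add: irr_def A_def)
    show "(irr i, irr l) \<notin> iso_reps G" if il: "i \<le> r" "l \<le> r" "i \<noteq> l" for i l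
    proof (cases i)
      case 0
      then obtain k where k: "l = Suc k" using il by (cases l) auto
      show ?thesis using nontriv[of k] iso_reps_sym[of trivial_rep "sel (b k)"] il k 0 by (auto simp: irr_def)
    next
      case i: (Suc k)
      show ?thesis
      proof (cases l)
        case 0
        then show ?thesis using nontriv[of k] il i by (auto simp: irr_def)
      next
        case (Suc k')
        then have "b k \<noteq> b k'" using b il i by (auto simp: bij_betw_def dest: inj_onD)
        then show ?thesis using sel_distinct[OF bQ bQ] il i Suc by (auto simp: irr_def)
      qed
    qed
    show "\<exists>i\<le>r. (x, irr i) \<in> iso_reps G" if x: "irreducible_rep G x" for x
    proof (cases "(x, trivial_rep) \<in> iso_reps G")
      case True
      then show ?thesis by (intro exI[of _ 0]) (simp add: irr_def)
    next
      case False
      then have "x \<in> A" using x by (simp add: A_def)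
      then have "iso_reps G `` {x} \<in> Q" unfolding Q_def by (rule quotientI)
      then obtain k where k: "k < r" "b k = iso_reps G `` {x}" using b by (auto simp: bij_betw_def image_iff)
      have "x \<in> iso_reps G `` {sel (b k)}"
        using sel[OF bQ[OF k(1)]] k(2) iso_reps_refl[OF mrep[OF x]] by blast
      then have "(x, irr (Suc k)) \<in> iso_reps G"
        using iso_reps_sym[of "sel (b k)" x] by (simp add: irr_def)
      then show ?thesis using k by (intro exI[of _ "Suc k"]) auto
    qed
  qed
  show ?thesis using equivalence unfolding r_def .
qed

end
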